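(* Let $G=AB$ be a finite group that is the product of subgroups $A$ and $B$, and assume that $G=AB$ is both a core-factorisation and a class-$\pi$-separable factorisation. Let $X\in\{A,B\}$ and write $X=X_0\times Z$ where $Z$ is abelian and $X_0$ has no non-trivial abelian direct factor. Then one of the following holds: (1) $X_0$ is a $\pi$-group or a $\pi'$-group. (2) For some $\sigma\in\{\pi,\pi'\}$: $X_0=X_\sigma X_{\sigma'}$ with $X_\sigma$ a Hall $\sigma$-subgroup and $X_{\sigma'}$ a normal Hall $\sigma'$-subgroup of $X_0$, both $X_\sigma$ and $X_{\sigma'}$ abelian, $X_0/O_\sigma(X_0)$ is a Frobenius group, $O_\sigma(X_0)=Z(X_0)$, the set of conjugacy class sizes of $X_0$ is $\{1,|X_\sigma/O_\sigma(X_0)|,|X_{\sigma'}|\}$, and $X_0$ is soluble. In particular, both $A$ and $B$ are class-$\pi$-separable groups.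
   Context: $\pi$ is a set of primes, $\pi'$ its complement ($\sigma'$ the complement of $\sigma$). A group is class-$\pi$-separable if each of its conjugacy class sizes is a $\pi$-number or a $\pi'$-number. $G=AB$ is a class-$\pi$-separable factorisation if $|x^G|=|G:C_G(x)|$ is either a $\pi$-number or a $\pi'$-number for every $x\in A\cup B$. A subgroup $U$ covers a section $V/W$ if $W(U\cap V)=V$. If $1\neq G=AB$, then $G=AB$ is a core-factorisation if $G$ has a chief series each of whose chief factors is covered by $A$ or by $B$. *)

theory Defs
  imports "HOL-Algebra.Algebra" "HOL-Computational_Algebra.Primes"
begin

definition pi_number :: "nat set \<Rightarrow> nat \<Rightarrow> bool" where
  "pi_number \<sigma> n \<longleftrightarrow> (\<forall>p. Factorial_Ring.prime p \<longrightarrow> p dvd n \<longrightarrow> p \<in> \<sigma>)"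

definition pi_compl :: "nat set \<Rightarrow> nat set" where
  "pi_compl \<sigma> = {p. Factorial_Ring.prime p} - \<sigma>"

definition conj_class :: "('a, 'b) monoid_scheme \<Rightarrow> 'a \<Rightarrow> 'a set" where
  "conj_class K x = {g \<otimes>\<^bsub>K\<^esub> x \<otimes>\<^bsub>K\<^esub> inv\<^bsub>K\<^esub> g | g. g \<in> carrier K}"

definition class_size :: "('a, 'b) monoid_scheme \<Rightarrow> 'a \<Rightarrow> nat" where
  "class_size K x = card (conj_class K x)"

definition class_sizes :: "('a, 'b) monoid_scheme \<Rightarrow> nat set" where
  "class_sizes K = {class_size K x | x. x \<in> carrier K}"

definition class_pi_separable :: "nat set \<Rightarrow> ('a, 'b) monoid_scheme \<Rightarrow> bool" where
  "class_pi_separable \<pi> K \<longleftrightarrow>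
     (\<forall>x \<in> carrier K. pi_number \<pi> (class_size K x) \<or> pi_number (pi_compl \<pi>) (class_size K x))"

definition class_pi_separable_factorisation ::
  "nat set \<Rightarrow> ('a, 'b) monoid_scheme \<Rightarrow> 'a set \<Rightarrow> 'a set \<Rightarrow> bool" where
  "class_pi_separable_factorisation \<pi> G A B \<longleftrightarrow>
     A <#>\<^bsub>G\<^esub> B = carrier G \<and>
     (\<forall>x \<in> A \<union> B. pi_number \<pi> (class_size G x) \<or> pi_number (pi_compl \<pi>) (class_size G x))"

definition chief_series :: "('a, 'b) monoid_scheme \<Rightarrow> (nat \<Rightarrow> 'a set) \<Rightarrow> nat \<Rightarrow> bool" where
  "chief_series G S n \<longleftrightarrow>
     S 0 = {\<one>\<^bsub>G\<^esub>} \<and> S n = carrier G \<and> (\<forall>i \<le> n. normal (S i) G) \<and>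
     (\<forall>i < n. S i \<subset> S (Suc i) \<and>
        \<not> (\<exists>N. normal N G \<and> S i \<subset> N \<and> N \<subset> S (Suc i)))"

definition covers :: "('a, 'b) monoid_scheme \<Rightarrow> 'a set \<Rightarrow> 'a set \<Rightarrow> 'a set \<Rightarrow> bool" where
  "covers G U V W \<longleftrightarrow> W <#>\<^bsub>G\<^esub> (U \<inter> V) = V"

definition core_factorisation :: "('a, 'b) monoid_scheme \<Rightarrow> 'a set \<Rightarrow> 'a set \<Rightarrow> bool" where
  "core_factorisation G A B \<longleftrightarrow>
     carrier G \<noteq> {\<one>\<^bsub>G\<^esub>} \<and> A <#>\<^bsub>G\<^esub> B = carrier G \<and>
     (\<exists>S n. chief_series G S n \<and>
        (\<forall>i < n. covers G A (S (Suc i)) (S i) \<or> covers G B (S (Suc i)) (S i)))"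

definition internal_direct :: "('a, 'b) monoid_scheme \<Rightarrow> 'a set \<Rightarrow> 'a set \<Rightarrow> 'a set \<Rightarrow> bool" where
  "internal_direct G U Y W \<longleftrightarrow>
     subgroup Y G \<and> subgroup W G \<and> Y <#>\<^bsub>G\<^esub> W = U \<and> Y \<inter> W = {\<one>\<^bsub>G\<^esub>} \<and>
     (\<forall>y \<in> Y. \<forall>w \<in> W. y \<otimes>\<^bsub>G\<^esub> w = w \<otimes>\<^bsub>G\<^esub> y)"

definition no_abelian_direct_factor :: "('a, 'b) monoid_scheme \<Rightarrow> 'a set \<Rightarrow> bool" where
  "no_abelian_direct_factor G U \<longleftrightarrow>
     \<not> (\<exists>Y W. internal_direct G U Y W \<and> W \<noteq> {\<one>\<^bsub>G\<^esub>} \<and> comm_group (G\<lparr>carrier := W\<rparr>))"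

definition hall_subgroup :: "nat set \<Rightarrow> ('a, 'b) monoid_scheme \<Rightarrow> 'a set \<Rightarrow> bool" where
  "hall_subgroup \<sigma> K H \<longleftrightarrow>
     subgroup H K \<and> pi_number \<sigma> (card H) \<and> pi_number (pi_compl \<sigma>) (card (carrier K) div card H)"

definition O_sub :: "nat set \<Rightarrow> ('a, 'b) monoid_scheme \<Rightarrow> 'a set" where
  "O_sub \<sigma> K = generate K (\<Union> {N. normal N K \<and> pi_number \<sigma> (card N)})"

definition group_center :: "('a, 'b) monoid_scheme \<Rightarrow> 'a set" where
  "group_center K = {z \<in> carrier K. \<forall>g \<in> carrier K. z \<otimes>\<^bsub>K\<^esub> g = g \<otimes>\<^bsub>K\<^esub> z}"

definition frobenius_group :: "('a, 'b) monoid_scheme \<Rightarrow> bool" where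
  "frobenius_group K \<longleftrightarrow> group K \<and> finite (carrier K) \<and>
     (\<exists>H. subgroup H K \<and> H \<noteq> {\<one>\<^bsub>K\<^esub>} \<and> H \<noteq> carrier K \<and>
        (\<forall>g \<in> carrier K - H. H \<inter> ((g <#\<^bsub>K\<^esub> H) #>\<^bsub>K\<^esub> inv\<^bsub>K\<^esub> g) = {\<one>\<^bsub>K\<^esub>}))"

end

theory Submission
  imports Defs
begin

text \<open>Write \<open>\<rho>\<close> for the complement of \<open>\<pi>\<close>.

  If no class size of an element of \<open>A \<union> B\<close> is divisible by \<open>q\<close>, then climbing down the covered normal series
  shows that the \<open>q\<close>-elements of \<open>G\<close> are central. Let \<open>x\<close> be a \<open>\<pi>\<close>-element of \<open>\<pi>\<close>-class size. All elements of
  \<open>A \<union> B\<close> of \<open>\<rho>\<close>-class size lie in the normal subgroup \<open>I = C\<^sub>G(x\<^sup>G)\<close>, so the \<open>\<rho>\<close>-elements are central modulo \<open>I\<close>;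
  since some conjugate of each of them commutes with \<open>x\<close>, they all do. By induction along a chief series, each
  \<open>x \<in> A\<close> of \<open>\<pi>\<close>-class size in \<open>G\<close> has \<open>\<pi>\<close>-class size in \<open>A\<close>: modulo a minimal normal subgroup \<open>L\<close> it commutes
  with a Sylow \<open>q\<close>-subgroup of \<open>A\<close>, \<open>q \<in> \<rho>\<close>, and the possible types of \<open>L\<close> are treated separately. Thus \<open>A\<close> is
  class-\<open>\<pi>\<close>-separable.

  In a class-\<open>\<pi>\<close>-separable group whose largest class size is a \<open>\<pi>\<close>-number, consider \<open>y\<close> of \<open>\<rho>\<close>-class size. The
  class \<open>x\<^sup>G\<close> of maximal size satisfies \<open>x\<^sup>G y\<^sup>G = (xy)\<^sup>G\<close> and is therefore a union of cosets of \<open>[G, y]\<close>, which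
  is a \<open>\<pi>\<close>-group. It follows that the \<open>\<pi>\<close>-elements form an abelian normal Hall subgroup \<open>M\<close>. A transfer argument
  splits off \<open>M \<inter> Z(G)\<close> as a direct factor. If it is trivial, the centraliser of any non-central \<open>\<rho>\<close>-element complements \<open>M\<close>.\<close>

section \<open>Centralisers and class sizes\<close>

text \<open>The obstacle is that \<open>|A : A \<inter> cent x|\<close> need not divide
  \<open>|G : cent x|\<close>, as \<open>A\<close> is not normal. Class sizes are inherited by
  divisibility only in normal subgroups and quotients, so knowledge about \<open>A\<close> has to be
  rebuilt along a series. Covering makes this possible: the bottom term of the series lies wholly in
  \<open>A\<close> or in \<open>B\<close>, so its elements satisfy the class size hypothesis too.

  \<open>G\<close> is not known to have Hall subgroups. The arguments therefore run one prime at a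
  time, with two tools: a class of size prime to \<open>q\<close> has a member centralised by any
  given \<open>q\<close>-subgroup (a fixed point count), and an element lies in a subgroup as soon
  as its powers of prime power order do.

  In the structure part a class of maximal size is taken because, for \<open>y\<close> of coprime
  class size, the class of \<open>x y\<close> is at least as large as that of \<open>x\<close> while
  its size divides the product of the two sizes; this forces the sizes for \<open>x\<close> and
  \<open>x y\<close> to agree. Everything is stated for two sets that may be exchanged, so each
  argument covers both types of class size.\<close>

abbreviation is_prime :: "nat \<Rightarrow> bool" where
  "is_prime \<equiv> Factorial_Ring.prime"

text \<open>A symmetric relation, so that each result can be reused with the roles of the two sets
  exchanged; \<open>pi_compl\<close> is no involution on arbitrary sets, since it discards
  non-primes.\<close>

definition complementary :: "nat set \<Rightarrow> nat set \<Rightarrow> bool" where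
  "complementary \<pi> \<rho> \<longleftrightarrow> (\<forall>p. is_prime p \<longrightarrow> (p \<in> \<pi> \<longleftrightarrow> p \<notin> \<rho>))"

lemma complementary_sym: "complementary \<pi> \<rho> \<Longrightarrow> complementary \<rho> \<pi>"
  by (auto simp: complementary_def)

lemma complementary_compl: "complementary \<pi> (pi_compl \<pi>)"
  by (auto simp: complementary_def pi_compl_def)

lemma pi_number_compl: "complementary \<pi> \<rho> \<Longrightarrow> pi_number (pi_compl \<pi>) n \<longleftrightarrow> pi_number \<rho> n"
  by (auto simp: complementary_def pi_compl_def pi_number_def)

lemma pi_number_dvd: "pi_number \<pi> n \<Longrightarrow> m dvd n \<Longrightarrow> pi_number \<pi> m"
  unfolding pi_number_def using dvd_trans by blast

lemma pi_number_mult: "pi_number \<pi> m \<Longrightarrow> pi_number \<pi> n \<Longrightarrow> pi_number \<pi> (m * n)"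
  unfolding pi_number_def by (metis prime_dvd_mult_iff)

lemma pi_number_1 [simp]: "pi_number \<pi> (Suc 0)"
  unfolding pi_number_def by (simp add: prime_nat_iff)

lemma pi_number_prime_power: "is_prime p \<Longrightarrow> p \<in> \<pi> \<Longrightarrow> pi_number \<pi> (p ^ k)"
  unfolding pi_number_def by (metis prime_dvd_power primes_dvd_imp_eq)

lemma pi_number_not_dvd:
  "complementary \<pi> \<rho> \<Longrightarrow> pi_number \<pi> n \<Longrightarrow> is_prime q \<Longrightarrow> q \<in> \<rho> \<Longrightarrow> \<not> q dvd n"
  unfolding pi_number_def complementary_def by blast

lemma pi_numberI:
  "complementary \<pi> \<rho> \<Longrightarrow> (\<And>q. is_prime q \<Longrightarrow> q \<in> \<rho> \<Longrightarrow> \<not> q dvd n) \<Longrightarrow> pi_number \<pi> n"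
  unfolding pi_number_def complementary_def by blast

lemma pi_number_coprime:
  assumes "complementary \<pi> \<rho>" "pi_number \<pi> m" "pi_number \<rho> n"
  shows "coprime m n"
proof (rule ccontr)
  assume "\<not> coprime m n"
  then have "gcd m n \<noteq> 1" by (simp add: coprime_iff_gcd_eq_1)
  then obtain p where "is_prime p" "p dvd gcd m n"
    using prime_factor_nat by blast
  then show False
    using assms unfolding pi_number_def complementary_def by auto
qed

text \<open>The counting device behind orbit-stabiliser, the product formula and the comparison of a
  class with its image in a quotient.\<close>

lemma card_equal_fibres:
  assumes "finite S" "\<And>x. x \<in> S \<Longrightarrow> card {y \<in> S. f y = f x} = c"
  shows "card (f ` S) * c = card S"
proof -
  have "card S = (\<Sum>x\<in>S. 1)" by simp
  also have "\<dots> = (\<Sum>y\<in>f ` S. \<Sum>x\<in>{x \<in> S. f x = y}. 1)"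
    by (rule sum.image_gen[OF assms(1)])
  also have "\<dots> = (\<Sum>y\<in>f ` S. c)"
    by (rule sum.cong) (auto simp: assms(2))
  finally show ?thesis by simp
qed

locale finite_group = group +
  assumes finite_carrier: "finite (carrier G)"
begin

lemma cancel [simp]:
  assumes "x \<in> carrier G" "y \<in> carrier G"
  shows "x \<otimes> (inv x \<otimes> y) = y" "inv x \<otimes> (x \<otimes> y) = y"
  using assms by (simp_all add: m_assoc[symmetric])

definition cj :: "'a \<Rightarrow> 'a \<Rightarrow> 'a" where
  "cj g x = g \<otimes> x \<otimes> inv g"

definition cent :: "'a \<Rightarrow> 'a set" where
  "cent x = {g \<in> carrier G. g \<otimes> x = x \<otimes> g}"

definition orb :: "'a set \<Rightarrow> 'a \<Rightarrow> 'a set" where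
  "orb N x = (\<lambda>g. cj g x) ` N"

text \<open>A condition on powers rather than on \<open>ord\<close>: it passes at once to conjugates
  and homomorphic images, and \<open>\<one>\<close> satisfies it for every \<open>p\<close>.\<close>

definition pel :: "nat \<Rightarrow> 'a \<Rightarrow> bool" where
  "pel p x \<longleftrightarrow> x \<in> carrier G \<and> (\<exists>k. x [^] (p ^ k) = \<one>)"

lemma cj_closed [simp]: "g \<in> carrier G \<Longrightarrow> x \<in> carrier G \<Longrightarrow> cj g x \<in> carrier G"
  by (simp add: cj_def)

lemma cj_mult: "g \<in> carrier G \<Longrightarrow> h \<in> carrier G \<Longrightarrow> x \<in> carrier G \<Longrightarrow> cj (g \<otimes> h) x = cj g (cj h x)"
  by (simp add: cj_def m_assoc inv_mult_group)

lemma cj_hom: "g \<in> carrier G \<Longrightarrow> x \<in> carrier G \<Longrightarrow> y \<in> carrier G \<Longrightarrow> cj g (x \<otimes> y) = cj g x \<otimes> cj g y"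
  by (simp add: cj_def m_assoc)

lemma cj_one [simp]: "x \<in> carrier G \<Longrightarrow> cj \<one> x = x"  "g \<in> carrier G \<Longrightarrow> cj g \<one> = \<one>"
  by (simp_all add: cj_def)

lemma cj_inv: "g \<in> carrier G \<Longrightarrow> x \<in> carrier G \<Longrightarrow> cj g (inv x) = inv (cj g x)"
  by (simp add: cj_def m_assoc inv_mult_group)

lemma cj_pow: "g \<in> carrier G \<Longrightarrow> x \<in> carrier G \<Longrightarrow> cj g (x [^] (n::nat)) = cj g x [^] n"
  by (induction n) (simp_all add: cj_hom)

lemma cj_cancel [simp]:
  "g \<in> carrier G \<Longrightarrow> x \<in> carrier G \<Longrightarrow> cj g (cj (inv g) x) = x"
  "g \<in> carrier G \<Longrightarrow> x \<in> carrier G \<Longrightarrow> cj (inv g) (cj g x) = x"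
  by (simp_all add: cj_mult[symmetric])

lemma cj_eq_iff:
  "g \<in> carrier G \<Longrightarrow> x \<in> carrier G \<Longrightarrow> y \<in> carrier G \<Longrightarrow> cj g x = cj g y \<longleftrightarrow> x = y"
  by (metis cj_cancel(2))

lemma cj_fix_iff: "g \<in> carrier G \<Longrightarrow> x \<in> carrier G \<Longrightarrow> cj g x = x \<longleftrightarrow> g \<otimes> x = x \<otimes> g"
  unfolding cj_def by (metis inv_solve_right m_closed)

lemma cj_cj: "g \<in> carrier G \<Longrightarrow> h \<in> carrier G \<Longrightarrow> x \<in> carrier G \<Longrightarrow> cj g (cj h x) = cj (cj g h) (cj g x)"
  by (simp add: cj_def m_assoc inv_mult_group)

lemma cent_subgroup: "x \<in> carrier G \<Longrightarrow> subgroup (cent x) G"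
proof (rule subgroupI)
  assume x: "x \<in> carrier G"
  show "cent x \<subseteq> carrier G" "cent x \<noteq> {}"
    using x by (auto simp: cent_def)
  fix a assume a: "a \<in> cent x"
  then have "a \<in> carrier G" "cj a x = x"
    using x by (simp_all add: cent_def cj_fix_iff)
  then have "cj (inv a) x = x"
    using x cj_cancel(2)[of a x] by simp
  then show "inv a \<in> cent x"
    using x a by (simp add: cent_def cj_fix_iff)
  fix b assume b: "b \<in> cent x"
  show "a \<otimes> b \<in> cent x"
    using x a b by (simp add: cent_def m_assoc) (simp add: m_assoc[symmetric])
qed

lemma mem_cent: "x \<in> carrier G \<Longrightarrow> g \<in> cent x \<longleftrightarrow> g \<in> carrier G \<and> cj g x = x"
  by (auto simp: cent_def cj_fix_iff)

lemma cent_sym: "x \<in> carrier G \<Longrightarrow> g \<in> cent x \<Longrightarrow> x \<in> cent g"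
  by (auto simp: cent_def)

lemma cent_carrier: "g \<in> cent x \<Longrightarrow> g \<in> carrier G"
  by (simp add: cent_def)

lemma cent_self [simp]: "x \<in> carrier G \<Longrightarrow> x \<in> cent x"
  by (simp add: cent_def)

lemma subgroup_pow: "subgroup H G \<Longrightarrow> x \<in> H \<Longrightarrow> x [^] (n::nat) \<in> H"
  by (induction n) (auto simp: subgroup.one_closed subgroup.m_closed)

lemma cent_pow: "x \<in> carrier G \<Longrightarrow> cent x \<subseteq> cent (x [^] (n::nat))"
  by (auto simp: mem_cent cj_pow)

lemma cent_cj: "g \<in> carrier G \<Longrightarrow> x \<in> carrier G \<Longrightarrow> h \<in> cent x \<Longrightarrow> cj g h \<in> cent (cj g x)"
  by (simp add: mem_cent cj_cj[symmetric])

lemma finite_subgroup: "subgroup H G \<Longrightarrow> finite H"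
  using finite_carrier finite_subset subgroup.subset by blast

lemma card_pos: "subgroup H G \<Longrightarrow> 0 < card H"
  using finite_subgroup subgroup.one_closed by (metis card_gt_0_iff empty_iff)

lemma inter_subgroup: "subgroup H G \<Longrightarrow> subgroup K G \<Longrightarrow> subgroup (H \<inter> K) G"
  by (rule subgroups_Inter_pair)

lemma card_subgroup_dvd: "subgroup H G \<Longrightarrow> subgroup K G \<Longrightarrow> H \<subseteq> K \<Longrightarrow> card H dvd card K"
proof -
  assume a: "subgroup H G" "subgroup K G" "H \<subseteq> K"
  interpret K: group "G\<lparr>carrier := K\<rparr>"
    using a(2) subgroup_imp_group by blast
  have "subgroup H (G\<lparr>carrier := K\<rparr>)" using a subgroup_incl by blast
  from K.lagrange[OF this] show ?thesis
    by (simp add: order_def) (metis dvd_triv_right)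
qed

text \<open>Orbit-stabiliser: two elements of \<open>N\<close> conjugate \<open>x\<close> alike
  exactly when they lie in the same left coset of \<open>N \<inter> cent x\<close>.\<close>

lemma card_orb:
  assumes N: "subgroup N G" and x: "x \<in> carrier G"
  shows "card (orb N x) * card (N \<inter> cent x) = card N"
  unfolding orb_def
proof (rule card_equal_fibres)
  show "finite N" using N by (rule finite_subgroup)
  fix g assume g: "g \<in> N"
  then have gc: "g \<in> carrier G" by (rule subgroup.mem_carrier[OF N])
  have "bij_betw (\<lambda>h. g \<otimes> h) (N \<inter> cent x) {h \<in> N. cj h x = cj g x}"
  proof (rule bij_betwI[where g = "\<lambda>h. inv g \<otimes> h"])
    show "(\<lambda>h. g \<otimes> h) \<in> N \<inter> cent x \<rightarrow> {h \<in> N. cj h x = cj g x}"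
      using N g gc x by (auto simp: mem_cent cj_mult subgroup.m_closed)
    show "(\<lambda>h. inv g \<otimes> h) \<in> {h \<in> N. cj h x = cj g x} \<rightarrow> N \<inter> cent x"
      using N g gc x subgroup.mem_carrier[OF N]
      by (auto simp: mem_cent cj_mult subgroup.m_closed subgroup.m_inv_closed)
    show "inv g \<otimes> (g \<otimes> h) = h" if "h \<in> N \<inter> cent x" for h
      using that gc cent_carrier by auto
    show "g \<otimes> (inv g \<otimes> h) = h" if "h \<in> {h \<in> N. cj h x = cj g x}" for h
      using that gc subgroup.mem_carrier[OF N] by auto
  qed
  then show "card {h \<in> N. cj h x = cj g x} = card (N \<inter> cent x)"
    by (metis bij_betw_same_card)
qed

lemma class_size_orb: "x \<in> carrier G \<Longrightarrow> class_size G x = card (orb (carrier G) x)"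
  unfolding class_size_def conj_class_def orb_def cj_def
  by (rule arg_cong[where f = card]) blast

lemma class_size_cent: "x \<in> carrier G \<Longrightarrow> class_size G x * card (cent x) = card (carrier G)"
proof -
  assume x: "x \<in> carrier G"
  have "carrier G \<inter> cent x = cent x" using cent_carrier by blast
  then show ?thesis using card_orb[OF subgroup_self x] x by (simp add: class_size_orb)
qed

lemma class_size_dvd_cent:
  "x \<in> carrier G \<Longrightarrow> y \<in> carrier G \<Longrightarrow> cent x \<subseteq> cent y \<Longrightarrow> class_size G y dvd class_size G x"
proof -
  assume a: "x \<in> carrier G" "y \<in> carrier G" "cent x \<subseteq> cent y"
  then obtain k where k: "card (cent y) = card (cent x) * k"
    using card_subgroup_dvd[OF cent_subgroup cent_subgroup] by blast
  have "class_size G x * card (cent x) = (class_size G y * k) * card (cent x)"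
    using class_size_cent[OF a(1)] class_size_cent[OF a(2)] k by (simp add: ac_simps)
  then show ?thesis using card_pos[OF cent_subgroup[OF a(1)]] by simp
qed

lemma class_size_pow_dvd: "x \<in> carrier G \<Longrightarrow> class_size G (x [^] (n::nat)) dvd class_size G x"
  by (rule class_size_dvd_cent) (auto simp: cent_pow[THEN subsetD])

lemma orb_cj: "g \<in> carrier G \<Longrightarrow> x \<in> carrier G \<Longrightarrow> orb (carrier G) (cj g x) = orb (carrier G) x"
proof -
  have *: "orb (carrier G) (cj g x) \<subseteq> orb (carrier G) x" if "g \<in> carrier G" "x \<in> carrier G" for g x
    using that by (auto simp: orb_def cj_mult[symmetric])
  assume "g \<in> carrier G" "x \<in> carrier G"
  then show ?thesis using *[of g x] *[of "inv g" "cj g x"] by simp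
qed

lemma class_size_cj: "g \<in> carrier G \<Longrightarrow> x \<in> carrier G \<Longrightarrow> class_size G (cj g x) = class_size G x"
  by (simp add: class_size_orb orb_cj)

lemma class_size_pos: "x \<in> carrier G \<Longrightarrow> 0 < class_size G x"
  using class_size_cent[of x] card_pos[OF subgroup_self] by (metis gr0I mult_0)

lemma class_size_1_iff: "x \<in> carrier G \<Longrightarrow> class_size G x = 1 \<longleftrightarrow> cent x = carrier G"
proof -
  assume x: "x \<in> carrier G"
  have "class_size G x = 1 \<longleftrightarrow> card (cent x) = card (carrier G)"
    using class_size_cent[OF x] card_pos[OF cent_subgroup[OF x]] card_pos[OF subgroup_self]
    by (metis mult_1 mult_cancel2 less_irrefl)
  also have "\<dots> \<longleftrightarrow> cent x = carrier G"
    using cent_carrier finite_carrier by (metis card_subset_eq subsetI)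
  finally show ?thesis .
qed

text \<open>The pairs with the same product as \<open>(a, b)\<close> are the
  \<open>(a \<otimes> d, inv d \<otimes> b)\<close> with \<open>d\<close> in the intersection, so
  all fibres of the multiplication have equal size.\<close>

lemma card_set_mult:
  assumes H: "subgroup H G" and K: "subgroup K G"
  shows "card (H <#> K) * card (H \<inter> K) = card H * card K"
proof -
  note Hc = subgroup.mem_carrier[OF H] and Kc = subgroup.mem_carrier[OF K]
  have im: "H <#> K = (\<lambda>(h, k). h \<otimes> k) ` (H \<times> K)"
    by (auto simp: set_mult_def)
  have "card ((\<lambda>(h, k). h \<otimes> k) ` (H \<times> K)) * card (H \<inter> K) = card (H \<times> K)"
  proof (rule card_equal_fibres)
    show "finite (H \<times> K)" using H K by (simp add: finite_subgroup)
    fix z assume "z \<in> H \<times> K"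
    then obtain a b where z: "z = (a, b)" and a: "a \<in> H" and b: "b \<in> K" by blast
    have "bij_betw (\<lambda>d. (a \<otimes> d, inv d \<otimes> b)) (H \<inter> K)
            {y \<in> H \<times> K. (case y of (h, k) \<Rightarrow> h \<otimes> k) = (case z of (h, k) \<Rightarrow> h \<otimes> k)}"
    proof (rule bij_betwI[where g = "\<lambda>y. inv a \<otimes> fst y"])
      show "(\<lambda>d. (a \<otimes> d, inv d \<otimes> b)) \<in> H \<inter> K \<rightarrow>
          {y \<in> H \<times> K. (case y of (h, k) \<Rightarrow> h \<otimes> k) = (case z of (h, k) \<Rightarrow> h \<otimes> k)}"
        using H K a b Hc Kc
        by (auto simp: z m_assoc subgroup.m_closed subgroup.m_inv_closed)
      show "(\<lambda>y. inv a \<otimes> fst y) \<in>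
          {y \<in> H \<times> K. (case y of (h, k) \<Rightarrow> h \<otimes> k) = (case z of (h, k) \<Rightarrow> h \<otimes> k)} \<rightarrow> H \<inter> K"
      proof
        fix y assume "y \<in> {y \<in> H \<times> K. (case y of (h, k) \<Rightarrow> h \<otimes> k) = (case z of (h, k) \<Rightarrow> h \<otimes> k)}"
        then obtain h k where y: "y = (h, k)" "h \<in> H" "k \<in> K" "h \<otimes> k = a \<otimes> b"
          by (auto simp: z)
        then have "inv a \<otimes> h = b \<otimes> inv k"
        proof -
          have "inv a \<otimes> h = inv a \<otimes> (h \<otimes> k) \<otimes> inv k"
            using y(2,3) a Hc Kc by (simp add: m_assoc)
          also have "\<dots> = b \<otimes> inv k"
            using y a b Hc Kc by simp
          finally show ?thesis .
        qed
        moreover have "inv a \<otimes> h \<in> H" "b \<otimes> inv k \<in> K"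
          using y a b H K by (simp_all add: subgroup.m_closed subgroup.m_inv_closed)
        ultimately show "inv a \<otimes> fst y \<in> H \<inter> K"
          by (simp add: y)
      qed
      show "inv a \<otimes> fst (a \<otimes> d, inv d \<otimes> b) = d" if "d \<in> H \<inter> K" for d
        using that a Hc by simp
      show "(a \<otimes> (inv a \<otimes> fst y), inv (inv a \<otimes> fst y) \<otimes> b) = y"
        if yy: "y \<in> {y \<in> H \<times> K. (case y of (h, k) \<Rightarrow> h \<otimes> k) = (case z of (h, k) \<Rightarrow> h \<otimes> k)}" for y
      proof -
        obtain h k where y: "y = (h, k)" "h \<in> H" "k \<in> K" "h \<otimes> k = a \<otimes> b"
          using yy by (auto simp: z)
        have "inv h \<otimes> (a \<otimes> b) = k" using y Hc Kc by (simp flip: y(4))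
        then show ?thesis using y a b Hc Kc by (simp add: inv_mult_group m_assoc)
      qed
    qed
    from bij_betw_same_card[OF this] show "card {y \<in> H \<times> K. (case y of (h, k) \<Rightarrow> h \<otimes> k) = (case z of (h, k) \<Rightarrow> h \<otimes> k)} = card (H \<inter> K)"
      by (rule sym)
  qed
  then show ?thesis by (simp add: im card_cartesian_product)
qed

text \<open>Both indices divide the index of \<open>H \<inter> K\<close>; by coprimality
  \<open>b\<close> already divides \<open>|H : H \<inter> K|\<close>, which makes \<open>H K\<close>
  at least as large as the group.\<close>

lemma coprime_index_product:
  assumes H: "subgroup H G" and K: "subgroup K G"
    and "card (carrier G) = a * card H" "card (carrier G) = b * card K" "coprime a b"
  shows "H <#> K = carrier G"
proof -
  let ?d = "card (H \<inter> K)"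
  have d: "subgroup (H \<inter> K) G" using H K by (rule inter_subgroup)
  obtain s where s: "card H = ?d * s" using card_subgroup_dvd[OF d H] by blast
  obtain t where t: "card K = ?d * t" using card_subgroup_dvd[OF d K] by blast
  have dp: "0 < ?d" using d by (rule card_pos)
  have "a * (?d * s) = b * (?d * t)" using assms(3,4) s t by argo
  then have "?d * (a * s) = ?d * (b * t)" by (simp only: ac_simps)
  then have "a * s = b * t" using dp by simp
  then have "b dvd a * s" by simp
  then have "b dvd s" using assms(5) by (simp add: coprime_commute coprime_dvd_mult_right_iff)
  moreover have "0 < s" using s card_pos[OF H] by (metis gr0I mult_0_right less_irrefl)
  ultimately have bs: "b \<le> s" by (simp add: dvd_imp_le)
  have "card (H <#> K) * ?d = card H * card K" using H K by (rule card_set_mult)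
  also have "\<dots> = card K * s * ?d" using s by simp
  finally have "card (H <#> K) = card K * s" using dp by simp
  then have "card (carrier G) \<le> card (H <#> K)" using assms(4) bs by simp
  moreover have "H <#> K \<subseteq> carrier G"
    using H K by (simp add: setmult_subset_G subgroup.subset)
  ultimately show ?thesis using finite_carrier by (simp add: card_seteq)
qed

section \<open>Orbits and fixed points of p-subgroups\<close>

lemma orb_carrier: "subgroup R G \<Longrightarrow> x \<in> carrier G \<Longrightarrow> orb R x \<subseteq> carrier G"
  by (auto simp: orb_def subgroup.mem_carrier)

lemma orb_self: "subgroup R G \<Longrightarrow> x \<in> carrier G \<Longrightarrow> x \<in> orb R x"
  unfolding orb_def by (rule image_eqI[of _ _ \<one>]) (simp_all add: subgroup.one_closed)

lemma orb_eqI: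
  assumes R: "subgroup R G" and x: "x \<in> carrier G" and t: "t \<in> orb R x"
  shows "orb R t = orb R x"
proof -
  obtain r where r: "r \<in> R" "t = cj r x" using t by (auto simp: orb_def)
  note Rc = subgroup.mem_carrier[OF R]
  show ?thesis
  proof
    show "orb R t \<subseteq> orb R x"
      using r x Rc by (auto simp: orb_def cj_mult[symmetric] subgroup.m_closed[OF R])
    show "orb R x \<subseteq> orb R t"
    proof
      fix s assume "s \<in> orb R x"
      then obtain k where k: "k \<in> R" "s = cj k x" by (auto simp: orb_def)
      have "s = cj (k \<otimes> inv r) t"
        using k r x Rc by (simp add: cj_mult)
      then show "s \<in> orb R t"
        using k r R by (auto simp: orb_def subgroup.m_closed subgroup.m_inv_closed)
    qed
  qed
qed

text \<open>Orbits of a \<open>p\<close>-group have \<open>p\<close>-power length. Without a fixed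
  point all orbits in \<open>S\<close> would have length divisible by \<open>p\<close>, and so would
  their disjoint union \<open>S\<close>.\<close>

lemma p_subgroup_fixed_point:
  assumes p: "is_prime p" and R: "subgroup R G" "card R = p ^ k"
    and S: "S \<subseteq> carrier G" "\<And>h s. h \<in> R \<Longrightarrow> s \<in> S \<Longrightarrow> cj h s \<in> S"
    and nd: "\<not> p dvd card S"
  shows "\<exists>s\<in>S. R \<subseteq> cent s"
proof (rule ccontr)
  assume none: "\<not> (\<exists>s\<in>S. R \<subseteq> cent s)"
  have fS: "finite S" using S(1) finite_carrier finite_subset by blast
  have U: "\<Union>(orb R ` S) = S"
  proof
    show "\<Union>(orb R ` S) \<subseteq> S" using S(2) by (auto simp: orb_def)
    show "S \<subseteq> \<Union>(orb R ` S)" using S(1) orb_self[OF R(1)] by blast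
  qed
  have "p dvd card (\<Union>(orb R ` S))"
  proof (rule dvd_partition)
    show "finite (\<Union>(orb R ` S))" using U fS by simp
    show "\<forall>c\<in>orb R ` S. p dvd card c"
    proof
      fix c assume "c \<in> orb R ` S"
      then obtain s where s: "s \<in> S" "c = orb R s" by blast
      then have sc: "s \<in> carrier G" using S by blast
      have eq: "card (orb R s) * card (R \<inter> cent s) = card R"
        using R(1) sc by (rule card_orb)
      have "R \<inter> cent s \<noteq> R" using none s by blast
      moreover have "finite R" using R(1) by (rule finite_subgroup)
      ultimately have "card (R \<inter> cent s) \<noteq> card R"
        by (metis card_subset_eq inf_le1)
      then have "card (orb R s) \<noteq> 1" using eq by auto
      moreover have "card (orb R s) dvd p ^ k" using eq R(2) by (metis dvd_triv_left)
      ultimately show "p dvd card c"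
        using p s(2) by (metis divides_primepow_nat dvd_power dvd_triv_left gr0I power_0)
    qed
    show "\<forall>c1\<in>orb R ` S. \<forall>c2\<in>orb R ` S. c1 \<noteq> c2 \<longrightarrow> c1 \<inter> c2 = {}"
    proof (intro ballI impI)
      fix c1 c2 assume c: "c1 \<in> orb R ` S" "c2 \<in> orb R ` S" and ne: "c1 \<noteq> c2"
      obtain a b where "a \<in> S" "b \<in> S" "c1 = orb R a" "c2 = orb R b" using c by blast
      then have "t \<in> c1 \<Longrightarrow> t \<in> c2 \<Longrightarrow> c1 = c2" for t
        using orb_eqI[OF R(1), of a t] orb_eqI[OF R(1), of b t] S(1) by auto
      then show "c1 \<inter> c2 = {}" using ne by blast
    qed
  qed
  then show False using U nd by simp
qed

text \<open>The fixed point count, applied to the class of \<open>x\<close>. It does duty for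
  Sylow's conjugacy theorem in what follows.\<close>

lemma p_subgroup_centralises_conjugate:
  assumes p: "is_prime p" and R: "subgroup R G" "card R = p ^ k"
    and x: "x \<in> carrier G" "\<not> p dvd class_size G x"
  shows "\<exists>g\<in>carrier G. R \<subseteq> cent (cj g x)"
proof -
  have "\<exists>s\<in>orb (carrier G) x. R \<subseteq> cent s"
  proof (rule p_subgroup_fixed_point[OF p R])
    show "orb (carrier G) x \<subseteq> carrier G" using x orb_carrier subgroup_self by blast
    show "cj h s \<in> orb (carrier G) x" if "h \<in> R" "s \<in> orb (carrier G) x" for h s
      using that x subgroup.mem_carrier[OF R(1)] by (auto simp: orb_def cj_mult[symmetric])
    show "\<not> p dvd card (orb (carrier G) x)" using x by (simp add: class_size_orb)
  qed
  then show ?thesis by (auto simp: orb_def)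
qed

lemma pel_carrier: "pel p x \<Longrightarrow> x \<in> carrier G"
  by (simp add: pel_def)

lemma pel_cj: "g \<in> carrier G \<Longrightarrow> pel p x \<Longrightarrow> pel p (cj g x)"
  unfolding pel_def by (metis cj_closed cj_pow cj_one(2))

lemma pel_subgroup:
  assumes p: "is_prime p" and h: "pel p h"
  obtains R k where "subgroup R G" "card R = p ^ k" "h \<in> R"
    "\<And>H. subgroup H G \<Longrightarrow> h \<in> H \<Longrightarrow> R \<subseteq> H"
proof -
  have hc: "h \<in> carrier G" using h by (rule pel_carrier)
  obtain k where "h [^] (p ^ k) = \<one>" using h by (auto simp: pel_def)
  then have "ord h dvd p ^ k" using hc pow_eq_id by blast
  then obtain j where "ord h = p ^ j" using p divides_primepow_nat by blast
  then have "card (generate G {h}) = p ^ j" using generate_pow_card[OF hc] by simp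
  moreover have "subgroup (generate G {h}) G" using hc by (simp add: generate_is_subgroup)
  moreover have "h \<in> generate G {h}" by (simp add: generate.incl)
  moreover have "generate G {h} \<subseteq> H" if "subgroup H G" "h \<in> H" for H
    using that by (simp add: generate_subgroup_incl)
  ultimately show ?thesis using that by blast
qed

lemma p_element_commutes_conjugate:
  assumes p: "is_prime p" and h: "pel p h"
    and x: "x \<in> carrier G" "\<not> p dvd class_size G x"
  shows "\<exists>g\<in>carrier G. h \<in> cent (cj g x)"
proof -
  obtain R k where "subgroup R G" "card R = p ^ k" "h \<in> R"
    using pel_subgroup[OF p h] by blast
  then show ?thesis using p_subgroup_centralises_conjugate[OF p _ _ x] by blast
qed

lemma subgroup_card_pow_eq_one:
  assumes R: "subgroup R G" and h: "h \<in> R"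
  shows "h [^] card R = \<one>"
proof -
  interpret R: group "G\<lparr>carrier := R\<rparr>" using R by (rule subgroup_imp_group)
  have "h [^]\<^bsub>G\<lparr>carrier := R\<rparr>\<^esub> card R = \<one>"
    using R.pow_order_eq_1[of h] h by (simp add: order_def)
  then show ?thesis by (simp add: nat_pow_consistent[symmetric])
qed

lemma p_subgroup_pel:
  assumes R: "subgroup R G" "card R = p ^ k" and h: "h \<in> R"
  shows "pel p h"
  using subgroup_card_pow_eq_one[OF R(1) h] R subgroup.mem_carrier[OF R(1) h]
  unfolding pel_def by auto

text \<open>The exponents \<open>n\<close> with \<open>x [^] n \<in> H\<close> are the multiples of the least positive one; a prime
  divisor of the latter is excluded by the corresponding primary component of \<open>x\<close>.\<close>

lemma mem_subgroup_if_primary_parts: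
  assumes H: "subgroup H G" and x: "x \<in> carrier G"
    and pp: "\<And>n p. is_prime p \<Longrightarrow> pel p (x [^] (n::nat)) \<Longrightarrow> x [^] n \<in> H"
  shows "x \<in> H"
proof -
  let ?P = "\<lambda>n::nat. 0 < n \<and> x [^] n \<in> H"
  define d where "d = (LEAST n. ?P n)"
  define N where "N = ord x"
  have N0: "0 < N" using ord_ge_1[OF finite_carrier x] by (simp add: N_def)
  have "?P N" using N0 x subgroup.one_closed[OF H] by (simp add: N_def)
  then have d: "?P d" unfolding d_def by (rule LeastI)
  have dvd: "d dvd n" if "x [^] n \<in> H" for n :: nat
  proof (rule ccontr)
    assume "\<not> d dvd n"
    then have r: "0 < n mod d" by (simp add: dvd_eq_mod_eq_0)
    have "x [^] n = x [^] (d * (n div d)) \<otimes> x [^] (n mod d)"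
      using x by (simp add: nat_pow_mult)
    also have "x [^] (d * (n div d)) = (x [^] d) [^] (n div d)"
      using x by (simp add: nat_pow_pow)
    finally have "x [^] (n mod d) = inv ((x [^] d) [^] (n div d)) \<otimes> x [^] n"
      using x by (simp add: inv_solve_left)
    moreover have "(x [^] d) [^] (n div d) \<in> H"
      using d H subgroup_pow by blast
    ultimately have "x [^] (n mod d) \<in> H"
      using that H by (simp add: subgroup.m_closed subgroup.m_inv_closed)
    then have "d \<le> n mod d" using r unfolding d_def by (intro Least_le) simp
    then show False using mod_less_divisor[of d n] d by linarith
  qed
  have "d = 1"
  proof (rule ccontr)
    assume "d \<noteq> 1"
    then obtain p where p: "is_prime p" "p dvd d" using prime_factor_nat by blast
    define e where "e = multiplicity p N"
    obtain m where m: "N = p ^ e * m" "\<not> p dvd m"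
      using multiplicity_decompose'[of N p] N0 p(1) unfolding e_def by (metis not_prime_unit neq0_conv)
    have "(x [^] m) [^] (p ^ e) = \<one>"
      using x m(1) pow_ord_eq_1[OF x] by (simp add: nat_pow_pow mult.commute N_def)
    then have "pel p (x [^] m)" using x by (auto simp: pel_def)
    then have "d dvd m" using dvd pp p(1) by blast
    then show False using p(2) m(2) dvd_trans by blast
  qed
  then show ?thesis using d x by simp
qed

lemma sylow_ex:
  assumes p: "is_prime p" and H: "subgroup H G"
  obtains P a m where "subgroup P G" "P \<subseteq> H" "card P = p ^ a" "card H = p ^ a * m" "\<not> p dvd m"
proof -
  interpret H: group "G\<lparr>carrier := H\<rparr>" using H by (rule subgroup_imp_group)
  obtain m where m: "card H = p ^ multiplicity p (card H) * m" "\<not> p dvd m"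
    using multiplicity_decompose'[of "card H" p] card_pos[OF H] p by (metis not_prime_unit neq0_conv)
  obtain P where P: "subgroup P (G\<lparr>carrier := H\<rparr>)" "card P = p ^ multiplicity p (card H)"
    using sylow_thm[OF p, of "G\<lparr>carrier := H\<rparr>"] m(1) finite_subgroup[OF H] H.is_group
    by (auto simp: order_def)
  have "subgroup P G" "P \<subseteq> H"
    using P(1) incl_subgroup[OF H] subgroup.subset by fastforce+
  then show ?thesis using that P(2) m by blast
qed

lemma conjugate_subgroup:
  assumes P: "subgroup P G" and g: "g \<in> carrier G"
  shows "subgroup (cj g ` P) G"
proof (rule subgroupI)
  note Pc = subgroup.mem_carrier[OF P]
  show "cj g ` P \<subseteq> carrier G" using g Pc by auto
  show "cj g ` P \<noteq> {}" using P subgroup.one_closed by blast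
  show "inv a \<in> cj g ` P" if "a \<in> cj g ` P" for a
    using that g Pc P by (auto simp: cj_inv[symmetric] subgroup.m_inv_closed)
  show "a \<otimes> b \<in> cj g ` P" if "a \<in> cj g ` P" "b \<in> cj g ` P" for a b
    using that g Pc P by (auto simp: cj_hom[symmetric] subgroup.m_closed)
qed

text \<open>A Sylow \<open>p\<close>-subgroup of \<open>K\<close> carries the full
  \<open>p\<close>-part of \<open>|K|\<close>, and a conjugate of it lies in \<open>H\<close>. Only
  its order counts, so the conjugating element may come from anywhere in \<open>G\<close>.\<close>

lemma not_dvd_index:
  assumes p: "is_prime p" and H: "subgroup H G" "subgroup K G" "H \<subseteq> K" and c: "card K = a * card H"
    and conj: "\<And>R k. subgroup R G \<Longrightarrow> R \<subseteq> K \<Longrightarrow> card R = p ^ k \<Longrightarrow> \<exists>g\<in>carrier G. cj g ` R \<subseteq> H"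
  shows "\<not> p dvd a"
proof
  assume "p dvd a"
  obtain P e m where P: "subgroup P G" "P \<subseteq> K" "card P = p ^ e" "card K = p ^ e * m" "\<not> p dvd m"
    using sylow_ex[OF p H(2)] by blast
  obtain g where g: "g \<in> carrier G" "cj g ` P \<subseteq> H" using conj P by blast
  note Pc = subgroup.mem_carrier[OF P(1)]
  have "subgroup (cj g ` P) G" using P(1) g(1) by (rule conjugate_subgroup)
  moreover have "card (cj g ` P) = card P"
    using g Pc by (intro card_image inj_onI) (simp add: cj_eq_iff)
  ultimately have "p ^ e dvd card H"
    using card_subgroup_dvd[of "cj g ` P" H] g(2) H P(3) by simp
  then have "p ^ e * p dvd card K" using c \<open>p dvd a\<close> by (metis mult.commute mult_dvd_mono)
  then show False using P p by (simp add: prime_gt_0_nat)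
qed

lemma class_size_not_dvd:
  assumes p: "is_prime p" and x: "x \<in> carrier G" and c: "\<And>h. pel p h \<Longrightarrow> h \<in> cent x"
  shows "\<not> p dvd class_size G x"
proof (rule not_dvd_index[OF p cent_subgroup[OF x] subgroup_self])
  show "cent x \<subseteq> carrier G" using cent_carrier by blast
  show "card (carrier G) = class_size G x * card (cent x)" using x by (simp add: class_size_cent)
  fix R k assume R: "subgroup R G" "R \<subseteq> carrier G" "card R = p ^ k"
  have "cj \<one> ` R \<subseteq> cent x"
    using R c p_subgroup_pel[OF R(1,3)] by (auto simp: subgroup.mem_carrier[OF R(1)])
  then show "\<exists>g\<in>carrier G. cj g ` R \<subseteq> cent x" by blast
qed

lemma normal_cj: "N \<lhd> G \<Longrightarrow> g \<in> carrier G \<Longrightarrow> n \<in> N \<Longrightarrow> cj g n \<in> N"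
  unfolding cj_def by (rule normal.inv_op_closed2)

lemma normalI_cj:
  assumes "subgroup N G" "\<And>g n. g \<in> carrier G \<Longrightarrow> n \<in> N \<Longrightarrow> cj g n \<in> N"
  shows "N \<lhd> G"
  using assms unfolding cj_def by (simp add: normal_inv_iff)

lemma normal_mult_subgroup:
  assumes N: "N \<lhd> G" and K: "subgroup K G"
  shows "subgroup (N <#> K) G"
  using mult_norm_subgroup[OF N K] .

text \<open>The left side is \<open>|N : N \<inter> cent x| = |N (cent x) : cent x|\<close>;
  normality of \<open>N\<close> makes \<open>N (cent x)\<close> a subgroup, and this is what fails
  for a factor \<open>A\<close>.\<close>

lemma class_in_normal_dvd:
  assumes N: "N \<lhd> G" and x: "x \<in> carrier G"
  shows "card (orb N x) dvd class_size G x"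
proof -
  have sN: "subgroup N G" using N by (rule normal_imp_subgroup)
  let ?C = "cent x"
  have sC: "subgroup ?C G" using x by (rule cent_subgroup)
  have NC: "subgroup (N <#> ?C) G" using N sC by (rule normal_mult_subgroup)
  have "card (N <#> ?C) * card (N \<inter> ?C) = card (orb N x) * card ?C * card (N \<inter> ?C)"
    using card_set_mult[OF sN sC] card_orb[OF sN x] by (metis mult.assoc mult.commute)
  then have "card (N <#> ?C) = card (orb N x) * card ?C"
    using card_pos[OF inter_subgroup[OF sN sC]] by simp
  moreover have "card (N <#> ?C) dvd card (carrier G)"
    using card_subgroup_dvd[OF NC subgroup_self] subgroup.subset[OF NC] by blast
  ultimately show ?thesis
    using class_size_cent[OF x] card_pos[OF sC] by (metis dvd_times_right_cancel_iff neq0_conv)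
qed

text \<open>Jordan's observation: at most \<open>|K : H|\<close> conjugates of \<open>H\<close>, all
  sharing \<open>\<one>\<close>, cannot fill \<open>K\<close> unless \<open>H = K\<close>.\<close>

lemma subgroup_eq_if_conjugates_cover:
  assumes H: "subgroup H G" and K: "subgroup K G" and HK: "H \<subseteq> K"
    and cov: "\<And>x. x \<in> K \<Longrightarrow> \<exists>k\<in>K. \<exists>h\<in>H. x = cj k h"
  shows "H = K"
proof -
  note Kc = subgroup.mem_carrier[OF K] and Hc = subgroup.mem_carrier[OF H]
  define F where "F = (\<lambda>k. cj k ` H)"
  have fK: "finite K" and fH: "finite H" using K H by (simp_all add: finite_subgroup)
  have cardF: "card (F k) = card H" if "k \<in> K" for k
    unfolding F_def using that Kc Hc by (intro card_image inj_onI) (simp add: cj_eq_iff)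
  have "card K = (\<Sum>k\<in>K. 1)" by simp
  also have "\<dots> = (\<Sum>y\<in>F ` K. \<Sum>x\<in>{x \<in> K. F x = y}. 1)"
    by (rule sum.image_gen[OF fK])
  \<comment> \<open>Each conjugate of \<open>H\<close> arises from at least \<open>|H|\<close>
    elements, namely from the whole coset \<open>k H\<close>.\<close>
  also have "\<dots> \<ge> (\<Sum>y\<in>F ` K. card H)"
  proof (rule sum_mono)
    fix y assume "y \<in> F ` K"
    then obtain k where k: "k \<in> K" "y = F k" by blast
    have sub: "(\<lambda>h. k \<otimes> h) ` H \<subseteq> {x \<in> K. F x = y}"
    proof
      fix z assume "z \<in> (\<lambda>h. k \<otimes> h) ` H"
      then obtain h where h: "h \<in> H" "z = k \<otimes> h" by blast
      have "cj h ` H = H"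
      proof
        show "cj h ` H \<subseteq> H"
          using h H by (auto simp: cj_def subgroup.m_closed subgroup.m_inv_closed)
        show "H \<subseteq> cj h ` H"
        proof
          fix s assume s: "s \<in> H"
          have "s = cj h (cj (inv h) s)" using s h Hc by simp
          moreover have "cj (inv h) s \<in> H"
            using s h H by (simp add: cj_def subgroup.m_closed subgroup.m_inv_closed Hc)
          ultimately show "s \<in> cj h ` H" by blast
        qed
      qed
      moreover have "F z = cj k ` (cj h ` H)"
        unfolding F_def image_image
        using h k Kc Hc by (intro image_cong) (simp_all add: cj_mult)
      ultimately have "F z = F k" by (simp add: F_def)
      then show "z \<in> {x \<in> K. F x = y}"
        using k h HK K by (auto simp: subgroup.m_closed)
    qed
    have "card H = card ((\<lambda>h. k \<otimes> h) ` H)"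
      using k Kc Hc by (intro card_image[symmetric] inj_onI) simp
    also have "\<dots> \<le> card {x \<in> K. F x = y}"
      using sub fK by (intro card_mono) auto
    finally show "card H \<le> (\<Sum>x\<in>{x \<in> K. F x = y}. 1)" by simp
  qed
  finally have le: "card (F ` K) * card H \<le> card K" by simp
  have "K - {\<one>} \<subseteq> (\<Union>C\<in>F ` K. C - {\<one>})"
    using cov unfolding F_def by blast
  then have "card (K - {\<one>}) \<le> card (\<Union>C\<in>F ` K. C - {\<one>})"
    using fK fH by (intro card_mono) (auto simp: F_def)
  also have "\<dots> \<le> (\<Sum>C\<in>F ` K. card (C - {\<one>}))"
    using fK by (intro card_UN_le) simp
  also have "\<dots> = (\<Sum>C\<in>F ` K. card H - 1)"
  proof (rule sum.cong[OF refl])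
    fix C assume "C \<in> F ` K"
    then obtain k where k: "k \<in> K" "C = F k" by blast
    have "\<one> \<in> C" unfolding k F_def
      using subgroup.one_closed[OF H] k(1) Kc by (intro image_eqI[of _ _ \<one>]) simp_all
    then show "card (C - {\<one>}) = card H - 1" using cardF k by simp
  qed
  also have "\<dots> = card (F ` K) * card H - card (F ` K)"
    by (simp add: diff_mult_distrib2)
  finally have "card K - 1 \<le> card (F ` K) * card H - card (F ` K)"
    using subgroup.one_closed[OF K] by simp
  moreover have "0 < card H" "0 < card K" using H K by (simp_all add: card_pos)
  moreover have "card (F ` K) \<noteq> 0"
    using fK subgroup.one_closed[OF K] by auto
  moreover have "card (F ` K) \<le> card (F ` K) * card H" using \<open>0 < card H\<close> by simp
  \<comment> \<open>With \<open>c\<close> conjugates, the bounds \<open>c |H| \<le> |K|\<close> and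
    \<open>|K| - 1 \<le> c |H| - c\<close> leave only \<open>c = 1\<close>.\<close>
  ultimately have "card (F ` K) = 1" using le by linarith
  then have "card K \<le> card H"
    using \<open>card K - 1 \<le> _\<close> \<open>0 < card H\<close> \<open>0 < card K\<close> by simp
  then show ?thesis using fK HK by (simp add: card_seteq)
qed

end

section \<open>Quotients and covering series\<close>

locale quotient_map =
  G: finite_group G + H: finite_group H + group_hom G H \<phi>
  for G (structure) and H (structure) and \<phi> +
  assumes surj: "\<phi> ` carrier G = carrier H"
begin

lemma hom_cj: "g \<in> carrier G \<Longrightarrow> x \<in> carrier G \<Longrightarrow> \<phi> (G.cj g x) = H.cj (\<phi> g) (\<phi> x)"
  by (simp add: G.cj_def H.cj_def)

lemma lift: "y \<in> carrier H \<Longrightarrow> \<exists>x\<in>carrier G. y = \<phi> x"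
  using surj by blast

lemma hom_pel: "G.pel p x \<Longrightarrow> H.pel p (\<phi> x)"
  unfolding G.pel_def H.pel_def by (metis hom_closed hom_nat_pow hom_one)

lemma hom_subgroup: "subgroup K G \<Longrightarrow> subgroup (\<phi> ` K) H"
  by (rule subgroup_img_is_subgroup)

lemma hom_normal: "K \<lhd> G \<Longrightarrow> \<phi> ` K \<lhd> H"
  by (rule normal.surj_hom_normal_subgroup[OF _ group_hom_axioms surj])

lemma vimage_subgroup:
  assumes "subgroup K H" shows "subgroup {x \<in> carrier G. \<phi> x \<in> K} G"
proof (rule G.subgroupI)
  have "\<one> \<in> {x \<in> carrier G. \<phi> x \<in> K}" using assms by (simp add: subgroup.one_closed)
  then show "{x \<in> carrier G. \<phi> x \<in> K} \<noteq> {}" by blast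
qed (use assms in \<open>auto simp: subgroup.m_closed subgroup.m_inv_closed\<close>)

lemma vimage_normal:
  assumes "K \<lhd> H" shows "{x \<in> carrier G. \<phi> x \<in> K} \<lhd> G"
proof (rule G.normalI_cj)
  show "subgroup {x \<in> carrier G. \<phi> x \<in> K} G"
    using assms by (intro vimage_subgroup normal_imp_subgroup)
  show "G.cj g n \<in> {x \<in> carrier G. \<phi> x \<in> K}"
    if "g \<in> carrier G" "n \<in> {x \<in> carrier G. \<phi> x \<in> K}" for g n
    using that assms by (auto simp: hom_cj H.normal_cj)
qed

text \<open>Conjugation permutes the fibres of the class over its image transitively, so they all
  have the same size.\<close>

lemma class_size_hom_dvd:
  assumes x: "x \<in> carrier G"
  shows "class_size H (\<phi> x) dvd class_size G x"
proof -
  let ?O = "G.orb (carrier G) x"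
  have Oc: "?O \<subseteq> carrier G" using x G.orb_carrier G.subgroup_self by blast
  have fin: "finite ?O" using Oc G.finite_carrier finite_subset by blast
  have "card (\<phi> ` ?O) * card {y \<in> ?O. \<phi> y = \<phi> x} = card ?O"
  proof (rule card_equal_fibres[OF fin])
    fix z assume "z \<in> ?O"
    then obtain g where g: "g \<in> carrier G" "z = G.cj g x" by (auto simp: G.orb_def)
    have "bij_betw (G.cj g) {y \<in> ?O. \<phi> y = \<phi> x} {y \<in> ?O. \<phi> y = \<phi> z}"
    proof (rule bij_betwI[where g = "G.cj (inv g)"])
      show "G.cj g \<in> {y \<in> ?O. \<phi> y = \<phi> x} \<rightarrow> {y \<in> ?O. \<phi> y = \<phi> z}"
        using g x by (auto simp: G.orb_def hom_cj G.cj_mult[symmetric] H.cj_mult)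
      show "G.cj (inv g) \<in> {y \<in> ?O. \<phi> y = \<phi> z} \<rightarrow> {y \<in> ?O. \<phi> y = \<phi> x}"
      proof
        fix y assume y: "y \<in> {y \<in> ?O. \<phi> y = \<phi> z}"
        then obtain k where k: "k \<in> carrier G" "y = G.cj k x" by (auto simp: G.orb_def)
        have "\<phi> (G.cj (inv g) y) = \<phi> (G.cj (inv g) z)"
          using y g x k by (simp add: hom_cj)
        also have "\<dots> = \<phi> x" using g x by simp
        finally show "G.cj (inv g) y \<in> {y \<in> ?O. \<phi> y = \<phi> x}"
          using g x k by (auto simp: G.orb_def G.cj_mult[symmetric])
      qed
      show "G.cj (inv g) (G.cj g y) = y" if "y \<in> {y \<in> ?O. \<phi> y = \<phi> x}" for y
        using that g Oc by auto
      show "G.cj g (G.cj (inv g) y) = y" if "y \<in> {y \<in> ?O. \<phi> y = \<phi> z}" for y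
        using that g Oc by auto
    qed
    from bij_betw_same_card[OF this]
    show "card {y \<in> ?O. \<phi> y = \<phi> z} = card {y \<in> ?O. \<phi> y = \<phi> x}" by (rule sym)
  qed
  moreover have "\<phi> ` ?O = H.orb (carrier H) (\<phi> x)"
    unfolding G.orb_def H.orb_def surj[symmetric] image_image
    using x by (intro image_cong) (simp_all add: hom_cj)
  ultimately show ?thesis
    using x by (simp add: G.class_size_orb H.class_size_orb) (metis dvd_triv_left)
qed

end

context finite_group
begin

text \<open>The quotient is realised on coset representatives, hence on the same type as \<open>G\<close>: this is
  what allows inductions that pass to quotients.\<close>

lemma quotient_exists:
  assumes N: "N \<lhd> G"
  shows "\<exists>(H :: ('a, 'b) monoid_scheme) \<phi>. quotient_map G H \<phi> \<and> (\<forall>x\<in>carrier G. \<phi> x = \<one>\<^bsub>H\<^esub> \<longleftrightarrow> x \<in> N)"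
proof -
  have sN: "subgroup N G" using N by (rule normal_imp_subgroup)
  \<comment> \<open>The choice is made from the coset as a set, hence \<open>r\<close> takes the
    same value on all of its elements.\<close>
  define r where "r x = (SOME z. z \<in> N #> x)" for x
  have r: "r x \<in> N #> x" if "x \<in> carrier G" for x
    unfolding r_def using rcos_self[OF that sN] by (rule someI)
  have rc: "r x \<in> carrier G" if "x \<in> carrier G" for x
    using r[OF that] that r_coset_subset_G[OF subgroup.subset[OF sN]] by blast
  have Nr: "N #> r x = N #> x" if "x \<in> carrier G" for x
    using repr_independence[OF r[OF that] that sN] by simp
  have req: "r x = r y \<longleftrightarrow> N #> x = N #> y" if "x \<in> carrier G" "y \<in> carrier G" for x y
    using Nr that unfolding r_def by metis
  have rm: "r (r x \<otimes> r y) = r (x \<otimes> y)" if "x \<in> carrier G" "y \<in> carrier G" for x y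
    using that rc Nr by (simp add: req normal.rcos_sum[OF N, symmetric])
  define H' where "H' = G\<lparr>mult := \<lambda>x y. r (x \<otimes> y)\<rparr>"
  define H where "H = H'\<lparr>carrier := r ` carrier G, one := r \<one>\<rparr>"
  have "r \<in> hom G H'"
    unfolding hom_def H'_def using rc rm by auto
  then have gH: "group H"
    unfolding H_def by (rule hom_imp_img_group)
  have hom: "r \<in> hom G H"
    unfolding hom_def H_def H'_def using rm by auto
  have cH: "carrier H = r ` carrier G" by (simp add: H_def)
  have "quotient_map G H r"
    using gH hom cH finite_carrier
    by (simp add: quotient_map_def quotient_map_axioms_def finite_group_def finite_group_axioms_def
        group_hom_def group_hom_axioms_def)
  moreover have "r x = \<one>\<^bsub>H\<^esub> \<longleftrightarrow> x \<in> N" if "x \<in> carrier G" for x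
    using that sN by (simp add: H_def req)
      (metis coset_join1 coset_join2 subgroup.subset coset_mult_one one_closed subgroup.one_closed)
  ultimately show ?thesis by blast
qed

lemma eq_mod_normal:
  assumes q: "quotient_map G H \<phi>" "\<forall>x\<in>carrier G. \<phi> x = \<one>\<^bsub>H\<^esub> \<longleftrightarrow> x \<in> N"
    and xy: "x \<in> carrier G" "y \<in> carrier G" "\<phi> x = \<phi> y"
  shows "\<exists>n\<in>N. x = y \<otimes> n"
proof -
  interpret Q: quotient_map G H \<phi> by (rule q(1))
  have "\<phi> (inv y \<otimes> x) = \<one>\<^bsub>H\<^esub>" using xy by simp
  then have "inv y \<otimes> x \<in> N" using q(2) xy(1,2) by (metis inv_closed m_closed)
  moreover have "x = y \<otimes> (inv y \<otimes> x)" using xy by simp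
  ultimately show ?thesis by blast
qed

end

text \<open>Inclusions are not strict, because terms may collapse in a quotient, and chief factors
  are not demanded. In this form the property survives every surjection; minimality is kept apart in
  \<open>minimal_series\<close>.\<close>

definition covering_series :: "('a, 'b) monoid_scheme \<Rightarrow> 'a set \<Rightarrow> 'a set \<Rightarrow> (nat \<Rightarrow> 'a set) \<Rightarrow> nat \<Rightarrow> bool" where
  "covering_series G A B S n \<longleftrightarrow> S 0 = {\<one>\<^bsub>G\<^esub>} \<and> S n = carrier G \<and> (\<forall>i\<le>n. S i \<lhd> G) \<and>
     (\<forall>i<n. S i \<subseteq> S (Suc i) \<and>
        (S (Suc i) \<subseteq> S i <#>\<^bsub>G\<^esub> (A \<inter> S (Suc i)) \<or> S (Suc i) \<subseteq> S i <#>\<^bsub>G\<^esub> (B \<inter> S (Suc i))))"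

lemma (in quotient_map) covering_series_image:
  assumes "covering_series G A B S n"
  shows "covering_series H (\<phi> ` A) (\<phi> ` B) (\<lambda>i. \<phi> ` S i) n"
proof -
  have *: "\<phi> ` S (Suc i) \<subseteq> \<phi> ` S i <#>\<^bsub>H\<^esub> (\<phi> ` U \<inter> \<phi> ` S (Suc i))"
    if cov: "S (Suc i) \<subseteq> S i <#> (U \<inter> S (Suc i))" and nrm: "S i \<lhd> G" "S (Suc i) \<lhd> G" for i U
  proof
    fix y assume "y \<in> \<phi> ` S (Suc i)"
    then obtain x where x: "x \<in> S (Suc i)" "y = \<phi> x" by blast
    then obtain s u where su: "s \<in> S i" "u \<in> U" "u \<in> S (Suc i)" "x = s \<otimes> u"
      using cov unfolding set_mult_def by blast
    then have "s \<in> carrier G" "u \<in> carrier G"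
      using nrm normal_imp_subgroup subgroup.mem_carrier by metis+
    then have "y = \<phi> s \<otimes>\<^bsub>H\<^esub> \<phi> u" using x su by simp
    then show "y \<in> \<phi> ` S i <#>\<^bsub>H\<^esub> (\<phi> ` U \<inter> \<phi> ` S (Suc i))"
      using su unfolding set_mult_def by blast
  qed
  show ?thesis
    unfolding covering_series_def
  proof (intro conjI allI impI)
    show "\<phi> ` S 0 = {\<one>\<^bsub>H\<^esub>}" using assms by (simp add: covering_series_def)
    show "\<phi> ` S n = carrier H" using assms surj by (simp add: covering_series_def)
    show "\<phi> ` S i \<lhd> H" if "i \<le> n" for i
      using that assms by (simp add: covering_series_def hom_normal)
    show "\<phi> ` S i \<subseteq> \<phi> ` S (Suc i)" if "i < n" for i
      using that assms by (simp add: covering_series_def image_mono)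
    fix i assume i: "i < n"
    then have n: "S i \<lhd> G" "S (Suc i) \<lhd> G" using assms by (simp_all add: covering_series_def)
    have "S (Suc i) \<subseteq> S i <#> (A \<inter> S (Suc i)) \<or> S (Suc i) \<subseteq> S i <#> (B \<inter> S (Suc i))"
      using assms i by (simp add: covering_series_def)
    then show "\<phi> ` S (Suc i) \<subseteq> \<phi> ` S i <#>\<^bsub>H\<^esub> (\<phi> ` A \<inter> \<phi> ` S (Suc i)) \<or>
        \<phi> ` S (Suc i) \<subseteq> \<phi> ` S i <#>\<^bsub>H\<^esub> (\<phi> ` B \<inter> \<phi> ` S (Suc i))"
      using *[OF _ n] by blast
  qed
qed

lemma covering_series_Suc:
  "covering_series G A B S (Suc n) \<Longrightarrow> S (Suc 0) = {\<one>\<^bsub>G\<^esub>} \<Longrightarrow> covering_series G A B (\<lambda>i. S (Suc i)) n"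
  unfolding covering_series_def by auto

lemma (in quotient_map) set_mult_image:
  assumes "A \<subseteq> carrier G" "B \<subseteq> carrier G" "A <#> B = carrier G"
  shows "\<phi> ` A <#>\<^bsub>H\<^esub> \<phi> ` B = carrier H"
  using set_mult_hom[OF homh assms(1,2)] assms(3) surj by simp

text \<open>Since \<open>S 0\<close> is trivial, covering the bottom factor means containing it.
  This is how a core-factorisation gives control over the class sizes of elements of a normal
  subgroup.\<close>

lemma (in finite_group) first_factor_covered:
  assumes "covering_series G A B S (Suc n)"
  shows "S (Suc 0) \<subseteq> A \<or> S (Suc 0) \<subseteq> B"
proof -
  have *: "{\<one>} <#> (U \<inter> S (Suc 0)) \<subseteq> U" for U
  proof
    fix x assume "x \<in> {\<one>} <#> (U \<inter> S (Suc 0))"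
    then obtain u where u: "u \<in> U" "u \<in> S (Suc 0)" "x = \<one> \<otimes> u" by (auto simp: set_mult_def)
    have "S (Suc 0) \<lhd> G" using assms by (simp add: covering_series_def)
    then have "u \<in> carrier G" using u normal_imp_subgroup subgroup.mem_carrier by metis
    then show "x \<in> U" using u by simp
  qed
  have "S 0 = {\<one>}" using assms by (simp add: covering_series_def)
  then show ?thesis using assms * unfolding covering_series_def
    by (metis subset_trans zero_less_Suc)
qed

section \<open>Primes that divide no class size of the two factors\<close>

context finite_group
begin

text \<open>The \<open>R\<close>-component of the conjugating element \<open>l r\<close> can be
  removed: \<open>R\<close> fixes \<open>t\<close>, so conjugating by \<open>inv r\<close> changes
  nothing, and \<open>inv r \<otimes> l \<otimes> r\<close> lies in \<open>L\<close>.\<close>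

lemma in_orbit_product:
  assumes L: "L \<lhd> G" and R: "subgroup R G" and x: "x \<in> carrier G"
    and t: "t \<in> orb (L <#> R) x" "R \<subseteq> cent t"
  shows "\<exists>l\<in>L. R \<subseteq> cent (cj l x)"
proof -
  obtain l r where lr: "l \<in> L" "r \<in> R" "t = cj (l \<otimes> r) x"
    using t(1) by (auto simp: orb_def set_mult_def)
  have lc: "l \<in> carrier G" and rc: "r \<in> carrier G"
    using lr L R normal_imp_subgroup subgroup.mem_carrier by metis+
  have tc: "t \<in> carrier G" using lr lc rc x by simp
  have "inv r \<in> R" using R lr by (simp add: subgroup.m_inv_closed)
  then have "t = cj (inv r) t" using t(2) tc by (auto simp: mem_cent)
  also have "\<dots> = cj (inv r \<otimes> l \<otimes> r) x" using lr lc rc x by (simp add: cj_mult)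
  finally have "t = cj (cj (inv r) l) x" using rc by (simp add: cj_def)
  moreover have "cj (inv r) l \<in> L" using normal_cj[OF L] rc lr by simp
  ultimately show ?thesis using t(2) by blast
qed

lemma normal_product_normal:
  assumes L: "L \<lhd> G" and R: "subgroup R G"
    and c: "\<And>g h. g \<in> carrier G \<Longrightarrow> h \<in> R \<Longrightarrow> \<exists>l\<in>L. cj g h = l \<otimes> h"
  shows "L <#> R \<lhd> G"
proof (rule normalI_cj)
  show "subgroup (L <#> R) G" using L R by (rule normal_mult_subgroup)
  fix g n assume g: "g \<in> carrier G" and "n \<in> L <#> R"
  then obtain l h where lh: "l \<in> L" "h \<in> R" "n = l \<otimes> h" by (auto simp: set_mult_def)
  obtain m where m: "m \<in> L" "cj g h = m \<otimes> h" using c g lh by blast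
  have car: "l \<in> carrier G" "h \<in> carrier G" "m \<in> carrier G"
    using lh m L R normal_imp_subgroup subgroup.mem_carrier by metis+
  have "cj g n = (cj g l \<otimes> m) \<otimes> h"
    using g car m lh by (simp add: cj_hom m_assoc)
  moreover have "cj g l \<otimes> m \<in> L"
    using normal_cj[OF L g lh(1)] m L normal_imp_subgroup subgroup.m_closed by metis
  ultimately show "cj g n \<in> L <#> R" using lh(2) by (auto simp: set_mult_def)
qed

lemma commuting_product_subgroup:
  assumes Q: "subgroup Q G" and R: "subgroup R G"
    and c: "\<And>r y. r \<in> R \<Longrightarrow> y \<in> Q \<Longrightarrow> r \<otimes> y = y \<otimes> r"
  shows "subgroup (Q <#> R) G"
proof (rule subgroupI)
  note Qc = subgroup.mem_carrier[OF Q] and Rc = subgroup.mem_carrier[OF R]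
  show "Q <#> R \<subseteq> carrier G" using Q R by (simp add: setmult_subset_G subgroup.subset)
  show "Q <#> R \<noteq> {}"
    using subgroup.one_closed[OF Q] subgroup.one_closed[OF R] by (auto simp: set_mult_def)
  fix a assume "a \<in> Q <#> R"
  then obtain y r where a: "y \<in> Q" "r \<in> R" "a = y \<otimes> r" by (auto simp: set_mult_def)
  have iy: "inv y \<in> Q" "inv r \<in> R" using a Q R by (simp_all add: subgroup.m_inv_closed)
  have "inv a = inv y \<otimes> inv r" using a Qc Rc c[OF iy(2,1)] by (simp add: inv_mult_group)
  then show "inv a \<in> Q <#> R" using iy by (auto simp: set_mult_def)
  fix b assume "b \<in> Q <#> R"
  then obtain z s where b: "z \<in> Q" "s \<in> R" "b = z \<otimes> s" by (auto simp: set_mult_def)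
  have "a \<otimes> b = y \<otimes> (r \<otimes> z) \<otimes> s" using a b Qc Rc by (simp add: m_assoc)
  also have "\<dots> = (y \<otimes> z) \<otimes> (r \<otimes> s)" using c[OF a(2) b(1)] a b Qc Rc by (simp add: m_assoc)
  finally show "a \<otimes> b \<in> Q <#> R"
    using a b Q R by (auto simp: set_mult_def intro: subgroup.m_closed)
qed

lemma pel_mult:
  assumes "pel p x" "pel p y" "x \<otimes> y = y \<otimes> x"
  shows "pel p (x \<otimes> y)"
proof -
  obtain i j where ij: "x [^] (p ^ i) = \<one>" "y [^] (p ^ j) = \<one>"
    using assms by (auto simp: pel_def)
  have c: "x \<in> carrier G" "y \<in> carrier G" using assms by (simp_all add: pel_carrier)
  have "x [^] (p ^ (i + j)) = (x [^] (p ^ i)) [^] (p ^ j)"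
    using c by (simp add: nat_pow_pow power_add)
  moreover have "y [^] (p ^ (i + j)) = (y [^] (p ^ j)) [^] (p ^ i)"
    using c by (simp add: nat_pow_pow power_add mult.commute)
  ultimately have "(x \<otimes> y) [^] (p ^ (i + j)) = \<one>"
    using ij c by (simp add: pow_mult_distrib[OF assms(3)])
  then show ?thesis using c by (auto simp: pel_def)
qed

lemma central_if_centralises_factors:
  assumes A: "subgroup A G" and B: "subgroup B G" and AB: "A <#> B = carrier G"
    and x: "x \<in> carrier G" "A \<subseteq> cent x" "B \<subseteq> cent x"
  shows "cent x = carrier G"
proof
  show "cent x \<subseteq> carrier G" using cent_carrier by blast
  show "carrier G \<subseteq> cent x"
    unfolding AB[symmetric] set_mult_def
    using x subgroup.m_closed[OF cent_subgroup[OF x(1)]] by blast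
qed

text \<open>\<open>\<langle>h\<rangle>L\<close> is normal, so every \<open>l \<in> L\<close> has an \<open>L\<close>-conjugate centralised by \<open>h\<close>; as \<open>L\<close> is not a union of
  conjugates of a proper subgroup, \<open>h\<close> centralises \<open>L\<close>, and a Sylow \<open>q\<close>-subgroup turns out to be normal.\<close>

lemma p_elements_central_step:
  assumes q: "is_prime q" and L: "L \<lhd> G"
    and A: "subgroup A G" and B: "subgroup B G" and AB: "A <#> B = carrier G"
    and LAB: "L \<subseteq> A \<union> B"
    and nd: "\<And>r. r \<in> A \<union> B \<Longrightarrow> \<not> q dvd class_size G r"
    and modL: "\<And>g h. g \<in> carrier G \<Longrightarrow> pel q h \<Longrightarrow> \<exists>l\<in>L. cj g h = l \<otimes> h"
    and h: "pel q h"
  shows "cent h = carrier G"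
proof -
  have sL: "subgroup L G" using L by (rule normal_imp_subgroup)
  note Lc = subgroup.mem_carrier[OF sL]
  have Lh: "L \<subseteq> cent h" if h: "pel q h" for h
  proof -
    have hc: "h \<in> carrier G" using h by (rule pel_carrier)
    obtain R k where R: "subgroup R G" "card R = q ^ k" "h \<in> R"
      using pel_subgroup[OF q h] by blast
    have LR: "L <#> R \<lhd> G"
      using L R(1)
    proof (rule normal_product_normal)
      show "\<exists>l\<in>L. cj g x = l \<otimes> x" if "g \<in> carrier G" "x \<in> R" for g x
        using modL that p_subgroup_pel[OF R(1,2)] by blast
    qed
    have sLR: "subgroup (L <#> R) G" using LR by (rule normal_imp_subgroup)
    have "cent h \<inter> L = L"
    proof (rule subgroup_eq_if_conjugates_cover[OF inter_subgroup[OF cent_subgroup[OF hc] sL] sL])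
      show "cent h \<inter> L \<subseteq> L" by simp
      fix x assume x: "x \<in> L"
      then have xc: "x \<in> carrier G" by (rule Lc)
      have "\<not> q dvd class_size G x" using x LAB nd by blast
      \<comment> \<open>Divisibility needs a normal subgroup. \<open>L R\<close> is one, because
        conjugation changes elements of \<open>R\<close> only by factors from
        \<open>L\<close>.\<close>
      then have nd': "\<not> q dvd card (orb (L <#> R) x)"
        using class_in_normal_dvd[OF LR xc] dvd_trans by blast
      have RLR: "k \<in> L <#> R" if "k \<in> R" for k
        using subgroup.one_closed[OF sL] subgroup.mem_carrier[OF R(1) that] that
        unfolding set_mult_def by force
      have "cj k s \<in> orb (L <#> R) x" if "k \<in> R" "s \<in> orb (L <#> R) x" for k s
        using that(2) xc subgroup.m_closed[OF sLR RLR[OF that(1)]] subgroup.mem_carrier[OF sLR] RLR[OF that(1)]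
        by (auto simp: orb_def cj_mult[symmetric])
      then obtain t where t: "t \<in> orb (L <#> R) x" "R \<subseteq> cent t"
        using p_subgroup_fixed_point[OF q R(1,2) orb_carrier[OF sLR xc] _ nd'] by blast
      obtain l where l: "l \<in> L" "R \<subseteq> cent (cj l x)"
        using in_orbit_product[OF L R(1) xc t] by blast
      have "cj l x \<in> L" using normal_cj[OF L] Lc l x by blast
      moreover have "cj l x \<in> cent h" using l R(3) cent_sym Lc xc by auto
      moreover have "x = cj (inv l) (cj l x)" using l Lc xc by simp
      moreover have "inv l \<in> L" using l sL by (simp add: subgroup.m_inv_closed)
      ultimately show "\<exists>k\<in>L. \<exists>y\<in>cent h \<inter> L. x = cj k y" by blast
    qed
    then show ?thesis by blast
  qed
  obtain Q a m where Q: "subgroup Q G" "card Q = q ^ a" "card (carrier G) = q ^ a * m" "\<not> q dvd m"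
    using sylow_ex[OF q subgroup_self] by metis
  note Qc = subgroup.mem_carrier[OF Q(1)]
  \<comment> \<open>If a \<open>q\<close>-element \<open>x\<close> centralises the Sylow subgroup
    \<open>Q\<close>, then \<open>Q\<close> times the cyclic group of \<open>x\<close> is again a
    \<open>q\<close>-group, so it equals \<open>Q\<close>.\<close>
  have Qmax: "x \<in> Q" if x: "pel q x" "\<And>y. y \<in> Q \<Longrightarrow> x \<in> cent y" for x
  proof -
    have xc: "x \<in> carrier G" using x(1) by (rule pel_carrier)
    obtain R k where R: "subgroup R G" "card R = q ^ k" "x \<in> R"
      and Rmin: "\<And>H. subgroup H G \<Longrightarrow> x \<in> H \<Longrightarrow> R \<subseteq> H"
      using pel_subgroup[OF q x(1)] by blast
    have "R \<subseteq> cent y" if "y \<in> Q" for y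
      using Rmin cent_subgroup x(2) that Qc by blast
    then have comm: "\<And>r y. r \<in> R \<Longrightarrow> y \<in> Q \<Longrightarrow> r \<otimes> y = y \<otimes> r" by (auto simp: cent_def)
    have QR: "subgroup (Q <#> R) G"
      using Q(1) R(1) comm by (rule commuting_product_subgroup)
    have QQR: "Q \<subseteq> Q <#> R"
    proof
      fix y assume "y \<in> Q"
      then show "y \<in> Q <#> R"
        using subgroup.one_closed[OF R(1)] Qc unfolding set_mult_def by force
    qed
    have "card (Q <#> R) * card (Q \<inter> R) = q ^ (a + k)"
      using card_set_mult[OF Q(1) R(1)] Q(2) R(2) by (simp add: power_add)
    then have "card (Q <#> R) dvd q ^ (a + k)" by (metis dvd_triv_left)
    then obtain j where j: "card (Q <#> R) = q ^ j" using q divides_primepow_nat by blast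
    have "q ^ j dvd q ^ a * m"
      using card_subgroup_dvd[OF QR subgroup_self subgroup.subset[OF QR]] j Q(3) by simp
    moreover have "coprime (q ^ j) m" using q Q(4) by (simp add: prime_imp_coprime)
    ultimately have "q ^ j dvd q ^ a" by (simp add: coprime_dvd_mult_left_iff)
    then have "card (Q <#> R) \<le> card Q"
      using j Q(2) q by (simp add: dvd_imp_le prime_gt_0_nat)
    then have "Q <#> R = Q" using QQR card_seteq[OF finite_subgroup[OF QR]] by blast
    moreover have "x = \<one> \<otimes> x" using xc by simp
    then have "x \<in> Q <#> R"
      using R(3) subgroup.one_closed[OF Q(1)] unfolding set_mult_def by blast
    ultimately show ?thesis by simp
  qed
  have Qpel: "pel q y" if "y \<in> Q" for y using p_subgroup_pel[OF Q(1,2) that] .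
  \<comment> \<open>Write the conjugate as \<open>l y\<close>. The factor \<open>l \<in> L\<close>
    commutes with all \<open>q\<close>-elements, hence is itself a \<open>q\<close>-element
    centralising \<open>Q\<close>, and maximality puts it into \<open>Q\<close>.\<close>
  have Qn: "cj g y \<in> Q" if g: "g \<in> carrier G" and y: "y \<in> Q" for g y
  proof -
    have yc: "y \<in> carrier G" using y by (rule Qc)
    obtain l where l: "l \<in> L" "cj g y = l \<otimes> y" using modL[OF g Qpel[OF y]] by blast
    then have lc: "l \<in> carrier G" by (simp add: Lc)
    have ly: "l \<in> cent z" if "z \<in> Q" for z using Lh[OF Qpel[OF that]] l by blast
    have "pel q (inv y)" using Qpel y Q(1) by (simp add: subgroup.m_inv_closed)
    moreover have "pel q (cj g y)" using g Qpel[OF y] by (rule pel_cj)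
    moreover have "cj g y \<otimes> inv y = inv y \<otimes> cj g y"
    proof -
      have "inv y \<otimes> (l \<otimes> y) = l" using lc yc ly[OF y] by (simp add: cent_def)
      then show ?thesis using l lc yc by (simp add: m_assoc)
    qed
    ultimately have "pel q (cj g y \<otimes> inv y)" using pel_mult by blast
    moreover have "cj g y \<otimes> inv y = l" using l lc yc by (simp add: m_assoc)
    ultimately have "l \<in> Q" using Qmax ly by simp
    then show ?thesis using l y Q(1) by (simp add: subgroup.m_closed)
  qed
  \<comment> \<open>\<open>Q\<close> centralises some conjugate of \<open>r\<close>; being normal,
    it then centralises \<open>r\<close> itself.\<close>
  have Qr: "y \<in> cent r" if y: "y \<in> Q" and r: "r \<in> A \<union> B" for y r
  proof -
    have rc: "r \<in> carrier G" using r subgroup.subset[OF A] subgroup.subset[OF B] by blast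
    obtain g where g: "g \<in> carrier G" "Q \<subseteq> cent (cj g r)"
      using p_subgroup_centralises_conjugate[OF q Q(1,2) rc nd[OF r]] by blast
    have "cj g y \<in> cent (cj g r)" using Qn g y by blast
    then show ?thesis
      using cent_cj[of "inv g" "cj g r" "cj g y"] g rc Qc[OF y] by simp
  qed
  have Qz: "cent y = carrier G" if y: "y \<in> Q" for y
  proof (rule central_if_centralises_factors[OF A B AB Qc[OF y]])
    show "A \<subseteq> cent y" "B \<subseteq> cent y"
      using Qr[OF y] cent_sym subgroup.subset[OF A] subgroup.subset[OF B] by blast+
  qed
  \<comment> \<open>Now \<open>Q\<close> is central, so every \<open>q\<close>-element centralises
    it and the maximality of \<open>Q\<close> applies to \<open>h\<close>.\<close>
  have "h \<in> Q"
    using Qmax[OF h] Qz pel_carrier[OF h] by blast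
  then show ?thesis by (rule Qz)
qed

end

text \<open>Induction on the length of the series: modulo the bottom term \<open>L\<close> class
  sizes only shrink to divisors, and centrality in the quotient says that a conjugate of a
  \<open>q\<close>-element differs from it by a factor in \<open>L\<close>.\<close>

lemma p_elements_central:
  assumes "finite_group G" "subgroup A G" "subgroup B G" "A <#>\<^bsub>G\<^esub> B = carrier G"
    and "covering_series G A B S n" "is_prime q"
    and "\<And>r. r \<in> A \<union> B \<Longrightarrow> \<not> q dvd class_size G r"
    and "finite_group.pel G q h"
  shows "finite_group.cent G h = carrier G"
  using assms
proof (induction n arbitrary: G A B S h)
  case 0
  interpret finite_group G by (rule 0(1))
  have "carrier G = {\<one>\<^bsub>G\<^esub>}" using 0(5) unfolding covering_series_def by argo
  moreover have "h \<in> carrier G" using 0(8) by (rule pel_carrier)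
  ultimately show ?case by (auto simp: cent_def)
next
  case (Suc n)
  interpret finite_group G by (rule Suc(2))
  define L where "L = S (Suc 0)"
  have L: "L \<lhd> G" using Suc(6) by (simp add: L_def covering_series_def)
  then have sL: "subgroup L G" by (rule normal_imp_subgroup)
  obtain H \<phi> where Q: "quotient_map G (H :: ('a, 'b) monoid_scheme) \<phi>"
    and ker: "\<forall>x\<in>carrier G. \<phi> x = \<one>\<^bsub>H\<^esub> \<longleftrightarrow> x \<in> L"
    using quotient_exists[OF L] by blast
  interpret Q: quotient_map G H \<phi> by (rule Q)
  have Ac: "A \<subseteq> carrier G" and Bc: "B \<subseteq> carrier G" using Suc(3,4) by (simp_all add: subgroup.subset)
  have "\<phi> ` S (Suc 0) = {\<one>\<^bsub>H\<^esub>}"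
    using ker subgroup.mem_carrier[OF sL] subgroup.one_closed[OF sL] unfolding L_def by force
  then have ser: "covering_series H (\<phi> ` A) (\<phi> ` B) (\<lambda>i. \<phi> ` S (Suc i)) n"
    using covering_series_Suc[OF Q.covering_series_image[OF Suc(6)]] by simp
  have IH: "Q.H.cent (\<phi> h) = carrier H" if "pel q h" for h
  proof (rule Suc.IH[OF Q.H.finite_group_axioms _ _ _ ser Suc(7)])
    show "subgroup (\<phi> ` A) H" "subgroup (\<phi> ` B) H"
      using Suc(3,4) by (simp_all add: Q.hom_subgroup)
    show "\<phi> ` A <#>\<^bsub>H\<^esub> \<phi> ` B = carrier H" using Ac Bc Suc(5) by (rule Q.set_mult_image)
    show "\<not> q dvd class_size H r" if r: "r \<in> \<phi> ` A \<union> \<phi> ` B" for r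
    proof -
      obtain x where x: "x \<in> A \<union> B" "r = \<phi> x" using r by blast
      then show ?thesis using Suc(8)[OF x(1)] Q.class_size_hom_dvd[of x] Ac Bc dvd_trans by blast
    qed
    show "Q.H.pel q (\<phi> h)" using that by (rule Q.hom_pel)
  qed
  show ?case
  proof (rule p_elements_central_step[OF Suc(7) L Suc(3,4,5) _ Suc(8) _ Suc(9)])
    show "L \<subseteq> A \<union> B" using first_factor_covered[OF Suc(6)] by (auto simp: L_def)
    fix g h assume g: "g \<in> carrier G" and h: "pel q h"
    have hc: "h \<in> carrier G" using h by (rule pel_carrier)
    have "\<phi> g \<in> Q.H.cent (\<phi> h)" using IH[OF h] g by simp
    then have "Q.H.cj (\<phi> g) (\<phi> h) = \<phi> h" using hc by (simp add: Q.H.mem_cent)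
    then have "\<phi> (cj g h) = \<phi> h" using g hc by (simp add: Q.hom_cj)
    then have "\<phi> (cj g h \<otimes>\<^bsub>G\<^esub> inv\<^bsub>G\<^esub> h) = \<one>\<^bsub>H\<^esub>" using g hc by simp
    then have "cj g h \<otimes>\<^bsub>G\<^esub> inv\<^bsub>G\<^esub> h \<in> L" using ker g hc by (metis cj_closed inv_closed m_closed)
    moreover have "cj g h = (cj g h \<otimes>\<^bsub>G\<^esub> inv\<^bsub>G\<^esub> h) \<otimes>\<^bsub>G\<^esub> h" using g hc by (simp add: m_assoc)
    ultimately show "\<exists>l\<in>L. cj g h = l \<otimes>\<^bsub>G\<^esub> h" by blast
  qed auto
qed

section \<open>Classes of coprime sizes\<close>

context finite_group
begin

text \<open>Centralisers of coprime index factorise \<open>G\<close>. Splitting a conjugating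
  element in this way lets \<open>x\<close> and \<open>y\<close> be moved simultaneously.\<close>

lemma coprime_cent_product:
  assumes x: "x \<in> carrier G" and y: "y \<in> carrier G"
    and co: "coprime (class_size G x) (class_size G y)" and g: "g \<in> carrier G"
  shows "\<exists>c\<in>cent x. \<exists>d\<in>cent y. g = c \<otimes> d"
proof -
  have "cent x <#> cent y = carrier G"
    using class_size_cent[OF x] class_size_cent[OF y]
    by (intro coprime_index_product[OF cent_subgroup[OF x] cent_subgroup[OF y] _ _ co]) simp_all
  then show ?thesis using g unfolding set_mult_def by blast
qed

text \<open>Some conjugate of \<open>r\<close> by \<open>g\<close> commutes with \<open>x\<close>.
  Writing \<open>g = c d\<close> with \<open>c \<in> cent x\<close> and
  \<open>d \<in> cent r\<close>, the part \<open>d\<close> does not move \<open>r\<close>, and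
  undoing \<open>c\<close> does not move \<open>x\<close>.\<close>

lemma coprime_classes_commute:
  assumes \<pi>: "complementary \<pi> \<rho>" and p: "is_prime p" "p \<in> \<pi>"
    and x: "pel p x" "pi_number \<pi> (class_size G x)"
    and r: "r \<in> carrier G" "pi_number \<rho> (class_size G r)"
  shows "x \<in> cent r"
proof -
  have xc: "x \<in> carrier G" using x(1) by (rule pel_carrier)
  have "\<not> p dvd class_size G r"
    using pi_number_not_dvd[OF complementary_sym[OF \<pi>] r(2)] p by blast
  then obtain g where g: "g \<in> carrier G" "x \<in> cent (cj g r)"
    using p_element_commutes_conjugate[OF p(1) x(1) r(1)] by blast
  obtain c d where cd: "c \<in> cent x" "d \<in> cent r" "g = c \<otimes> d"
    using coprime_cent_product[OF xc r(1) pi_number_coprime[OF \<pi> x(2) r(2)] g(1)] by blast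
  have cc: "c \<in> carrier G" "d \<in> carrier G" using cd cent_carrier by blast+
  have "cj g r = cj c r" using cd cc r(1) by (simp add: cj_mult mem_cent)
  then have "cj (inv c) x \<in> cent r"
    using cent_cj[of "inv c" "cj c r" x] g cc r(1) by simp
  moreover have "inv c \<in> cent x"
    using cd cent_subgroup[OF xc] by (simp add: subgroup.m_inv_closed)
  ultimately show ?thesis using xc by (simp add: mem_cent)
qed

lemma class_centraliser_normal:
  assumes x: "x \<in> carrier G"
  shows "{g \<in> carrier G. \<forall>k\<in>carrier G. g \<in> cent (cj k x)} \<lhd> G" (is "?I \<lhd> G")
proof (rule normalI_cj)
  show "subgroup ?I G"
  proof (rule subgroupI)
    have "\<one> \<in> ?I" using x by (simp add: cent_def)
    then show "?I \<noteq> {}" by blast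
    show "inv a \<in> ?I" if "a \<in> ?I" for a
      using that x subgroup.m_inv_closed[OF cent_subgroup] by simp
    show "a \<otimes> b \<in> ?I" if "a \<in> ?I" "b \<in> ?I" for a b
      using that x subgroup.m_closed[OF cent_subgroup] by simp
  qed auto
  fix g n assume g: "g \<in> carrier G" and n: "n \<in> ?I"
  have "cj g n \<in> cent (cj k x)" if k: "k \<in> carrier G" for k
  proof -
    have "n \<in> cent (cj (inv g \<otimes> k) x)" using n g k by simp
    then have "cj g n \<in> cent (cj g (cj (inv g \<otimes> k) x))"
      using g k x by (intro cent_cj) simp_all
    then show ?thesis using g k x by (simp add: cj_mult)
  qed
  then show "cj g n \<in> ?I" using g n by simp
qed

text \<open>The normal subgroup \<open>I = C\<^sub>G(x\<^sup>G)\<close> contains every element of \<open>A \<union> B\<close> whose class size is a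
  \<open>\<rho>\<close>-number, so all elements of the two factors of \<open>G/I\<close> have class sizes prime to \<open>q\<close>; hence
  \<open>h\<close> is central modulo \<open>I\<close>, and every conjugate of \<open>h\<close> lies in \<open>h C\<^sub>G(x)\<close>.\<close>

lemma pi_class_commutes_rho_elements:
  assumes \<pi>: "complementary \<pi> \<rho>"
    and A: "subgroup A G" and B: "subgroup B G" and AB: "A <#> B = carrier G"
    and ser: "covering_series G A B S n"
    and good: "\<And>r. r \<in> A \<union> B \<Longrightarrow> pi_number \<pi> (class_size G r) \<or> pi_number \<rho> (class_size G r)"
    and p: "is_prime p" "p \<in> \<pi>" and x: "pel p x" "pi_number \<pi> (class_size G x)"
    and q: "is_prime q" "q \<in> \<rho>" and h: "pel q h"
  shows "h \<in> cent x"
proof -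
  have xc: "x \<in> carrier G" using x(1) by (rule pel_carrier)
  have hc: "h \<in> carrier G" using h by (rule pel_carrier)
  define I where "I = {g \<in> carrier G. \<forall>k\<in>carrier G. g \<in> cent (cj k x)}"
  have I: "I \<lhd> G" unfolding I_def using xc by (rule class_centraliser_normal)
  have Ix: "I \<subseteq> cent x" unfolding I_def using xc by (auto dest: bspec[of _ _ \<one>])
  obtain H \<phi> where Q: "quotient_map G (H :: ('a, 'b) monoid_scheme) \<phi>"
    and ker: "\<forall>x\<in>carrier G. \<phi> x = \<one>\<^bsub>H\<^esub> \<longleftrightarrow> x \<in> I"
    using quotient_exists[OF I] by blast
  interpret Q: quotient_map G H \<phi> by (rule Q)
  have Ac: "A \<subseteq> carrier G" and Bc: "B \<subseteq> carrier G" using A B by (simp_all add: subgroup.subset)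
  have "Q.H.cent (\<phi> h) = carrier H"
  proof (rule p_elements_central[OF Q.H.finite_group_axioms _ _ _ Q.covering_series_image[OF ser] q(1)])
    show "subgroup (\<phi> ` A) H" "subgroup (\<phi> ` B) H" using A B by (simp_all add: Q.hom_subgroup)
    show "\<phi> ` A <#>\<^bsub>H\<^esub> \<phi> ` B = carrier H" using Ac Bc AB by (rule Q.set_mult_image)
    show "Q.H.pel q (\<phi> h)" using h by (rule Q.hom_pel)
    fix s assume "s \<in> \<phi> ` A \<union> \<phi> ` B"
    then obtain r where r: "r \<in> A \<union> B" "s = \<phi> r" by blast
    then have rc: "r \<in> carrier G" using Ac Bc by blast
    show "\<not> q dvd class_size H s"
    proof (cases "pi_number \<pi> (class_size G r)")
      case True
      then show ?thesis
        using pi_number_not_dvd[OF \<pi> True q] Q.class_size_hom_dvd[OF rc] r(2) dvd_trans by blast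
    next
      case False
      then have \<rho>: "pi_number \<rho> (class_size G r)" using good[OF r(1)] by blast
      \<comment> \<open>The conjugates of \<open>x\<close> are \<open>p\<close>-elements of the same
        class size, so coprimality applies to each of them.\<close>
      have "r \<in> cent (cj k x)" if k: "k \<in> carrier G" for k
      proof (rule cent_sym[OF rc])
        show "cj k x \<in> cent r"
          using coprime_classes_commute[OF \<pi> p pel_cj[OF k x(1)] _ rc \<rho>] x(2)
          by (simp only: class_size_cj[OF k xc])
      qed
      then have "r \<in> I" using rc by (simp add: I_def)
      then have "s = \<one>\<^bsub>H\<^esub>" using r ker rc by blast
      then have "Q.H.cent s = carrier H" by (auto simp: Q.H.cent_def)
      then have "class_size H s = 1"
        using \<open>s = \<one>\<^bsub>H\<^esub>\<close> Q.H.class_size_1_iff by blast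
      then show ?thesis using q(1) by (simp add: prime_nat_iff)
    qed
  qed
  moreover obtain g where g: "g \<in> carrier G" "h \<in> cent (cj g x)"
    using p_element_commutes_conjugate[OF q(1) h xc pi_number_not_dvd[OF \<pi> x(2) q]] by blast
  ultimately have "Q.H.cj (\<phi> (inv g)) (\<phi> h) = \<phi> h"
    using hc by (metis Q.H.mem_cent Q.hom_closed inv_closed)
  then have "\<phi> (cj (inv g) h) = \<phi> h" using g hc by (simp only: Q.hom_cj inv_closed)
  then obtain i where i: "i \<in> I" "cj (inv g) h = h \<otimes> i"
    using eq_mod_normal[OF Q ker _ hc] g hc by (metis cj_closed inv_closed)
  have "cj (inv g) h \<in> cent x"
    using cent_cj[of "inv g" "cj g x" h] g xc by simp
  then have "h \<otimes> i \<in> cent x" using i by simp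
  moreover have "inv i \<in> cent x"
    using i Ix subgroup.m_inv_closed[OF cent_subgroup[OF xc]] by blast
  ultimately have "h \<otimes> i \<otimes> inv i \<in> cent x"
    by (rule subgroup.m_closed[OF cent_subgroup[OF xc]])
  moreover have "i \<in> carrier G" using i by (simp add: I_def)
  ultimately show ?thesis using hc by (simp add: m_assoc)
qed

text \<open>The \<open>K\<close>-orbit of \<open>r\<close> has a length dividing both
  \<open>|K|\<close> and the class size of \<open>r\<close>, which are coprime.\<close>

lemma normal_pi_centralised:
  assumes \<pi>: "complementary \<pi> \<rho>" and K: "K \<lhd> G" "pi_number \<pi> (card K)"
    and r: "r \<in> carrier G" "pi_number \<rho> (class_size G r)"
  shows "K \<subseteq> cent r"
proof -
  have sK: "subgroup K G" using K(1) by (rule normal_imp_subgroup)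
  have "card (orb K r) dvd card K" using card_orb[OF sK r(1)] by (metis dvd_triv_left)
  then have "pi_number \<pi> (card (orb K r))" using K(2) pi_number_dvd by blast
  moreover have "pi_number \<rho> (card (orb K r))"
    using class_in_normal_dvd[OF K(1) r(1)] r(2) pi_number_dvd by blast
  ultimately have "coprime (card (orb K r)) (card (orb K r))" using pi_number_coprime[OF \<pi>] by blast
  then have "card (orb K r) = 1" by simp
  then obtain s where s: "orb K r = {s}" using card_1_singletonE by blast
  then have "orb K r = {r}" using orb_self[OF sK r(1)] by simp
  then have "cj k r = r" if "k \<in> K" for k using that unfolding orb_def by blast
  then show ?thesis using r(1) subgroup.mem_carrier[OF sK] by (auto simp: mem_cent)
qed

text \<open>By coprimality \<open>cent x \<inter> cent y\<close> has index equal to the product of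
  the two class sizes, and it is contained in \<open>cent (x \<otimes> y)\<close>.\<close>

lemma class_size_mult_dvd:
  assumes x: "x \<in> carrier G" and y: "y \<in> carrier G"
    and co: "coprime (class_size G x) (class_size G y)"
  shows "class_size G (x \<otimes> y) dvd class_size G x * class_size G y"
proof -
  let ?D = "cent x \<inter> cent y"
  have sx: "subgroup (cent x) G" and sy: "subgroup (cent y) G" using x y by (simp_all add: cent_subgroup)
  have sD: "subgroup ?D G" using sx sy by (rule inter_subgroup)
  have "cent x <#> cent y = carrier G"
    using class_size_cent[OF x] class_size_cent[OF y]
    by (intro coprime_index_product[OF sx sy _ _ co]) simp_all
  then have 1: "card (carrier G) * card ?D = card (cent x) * card (cent y)"
    using card_set_mult[OF sx sy] by simp
  have "?D \<subseteq> cent (x \<otimes> y)" using x y by (auto simp: mem_cent cj_hom)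
  then obtain e where e: "card (cent (x \<otimes> y)) = card ?D * e"
    using card_subgroup_dvd[OF sD cent_subgroup] x y by (metis dvdE m_closed)
  have "class_size G x * class_size G y * (card (cent x) * card (cent y)) = card (carrier G) * card (carrier G)"
    using class_size_cent[OF x] class_size_cent[OF y] by (metis mult.assoc mult.left_commute)
  then have "class_size G x * class_size G y * card ?D * card (carrier G) = card (carrier G) * card (carrier G)"
    using 1 by (simp add: ac_simps)
  then have "class_size G x * class_size G y * card ?D = card (carrier G)"
    using card_pos[OF subgroup_self] by simp
  also have "\<dots> = class_size G (x \<otimes> y) * e * card ?D"
    using class_size_cent[of "x \<otimes> y"] x y e by (simp add: ac_simps)
  finally have "class_size G x * class_size G y = class_size G (x \<otimes> y) * e"
    using card_pos[OF sD] by simp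
  then show ?thesis by simp
qed

text \<open>If \<open>x\<^sup>G y\<^sup>G = (xy)\<^sup>G\<close> has as many elements as \<open>x\<^sup>G\<close>, then it equals \<open>x\<^sup>G b\<close> for each \<open>b \<in> y\<^sup>G\<close>, so that
  the quotients \<open>b' b\<^sup>-\<^sup>1\<close> lie in the right stabiliser of \<open>x\<^sup>G\<close>, whose order divides \<open>|x\<^sup>G|\<close>.\<close>

lemma commutators_in_normal_pi_subgroup:
  assumes \<pi>: "complementary \<pi> \<rho>"
    and x: "x \<in> carrier G" "pi_number \<pi> (class_size G x)"
    and y: "y \<in> carrier G" "pi_number \<rho> (class_size G y)"
    and xy: "pi_number \<pi> (class_size G (x \<otimes> y)) \<or> pi_number \<rho> (class_size G (x \<otimes> y))"
    and less: "class_size G y < class_size G x"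
  shows "\<exists>K. K \<lhd> G \<and> pi_number \<pi> (card K) \<and> (\<forall>g\<in>carrier G. \<exists>k\<in>K. cj g y = k \<otimes> y)"
proof -
  have sG: "subgroup (carrier G) G" by (rule subgroup_self)
  define U where "U = orb (carrier G) x"
  define V where "V = orb (carrier G) y"
  define Z where "Z = orb (carrier G) (x \<otimes> y)"
  have Xc: "U \<subseteq> carrier G" and Yc: "V \<subseteq> carrier G" and Zc: "Z \<subseteq> carrier G"
    using x y by (simp_all add: U_def V_def Z_def orb_carrier[OF sG])
  have fin: "finite U" "finite Z" using Xc Zc finite_carrier finite_subset by blast+
  have co: "coprime (class_size G x) (class_size G y)" using pi_number_coprime[OF \<pi> x(2) y(2)] .
  \<comment> \<open>Splitting \<open>inv g \<otimes> g' = c \<otimes> d\<close> along the two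
    centralisers yields the common conjugating element \<open>g \<otimes> c\<close> for both
    factors.\<close>
  have XYZ: "a \<otimes> b \<in> Z" if ab: "a \<in> U" "b \<in> V" for a b
  proof -
    obtain g g' where g: "g \<in> carrier G" "a = cj g x" "g' \<in> carrier G" "b = cj g' y"
      using ab by (auto simp: U_def V_def orb_def)
    obtain c d where cd: "c \<in> cent x" "d \<in> cent y" "inv g \<otimes> g' = c \<otimes> d"
      using coprime_cent_product[OF x(1) y(1) co] g by (metis inv_closed m_closed)
    have cc: "c \<in> carrier G" "d \<in> carrier G" using cd cent_carrier by blast+
    have "g' = g \<otimes> (inv g \<otimes> g')" using g by simp
    also have "\<dots> = (g \<otimes> c) \<otimes> d" using cd g cc by (simp add: m_assoc)
    finally have "b = cj (g \<otimes> c) y" using g cd cc y(1) by (simp add: cj_mult mem_cent)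
    moreover have "a = cj (g \<otimes> c) x" using g cd cc x(1) by (simp add: cj_mult mem_cent)
    ultimately have "a \<otimes> b = cj (g \<otimes> c) (x \<otimes> y)" using g cc x(1) y(1) by (simp add: cj_hom)
    then show ?thesis using g cc by (auto simp: Z_def orb_def)
  qed
  define k where "k = class_size G (x \<otimes> y)"
  have cX: "card U = class_size G x" and cZ: "card Z = k"
    using x y by (simp_all add: U_def Z_def k_def class_size_orb)
  have card_shift: "card ((\<lambda>a. a \<otimes> b) ` U) = card U" if "b \<in> carrier G" for b
    using Xc that by (intro card_image inj_onI) (auto simp: subset_iff)
  have yY: "y \<in> V" unfolding V_def using sG y(1) by (rule orb_self)
  have "card U \<le> k"
    using card_mono[OF fin(2), of "(\<lambda>a. a \<otimes> y) ` U"] XYZ yY card_shift[OF y(1)] cZ by auto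
  moreover have kdvd: "k dvd class_size G x * class_size G y"
    unfolding k_def using x(1) y(1) co by (rule class_size_mult_dvd)
  \<comment> \<open>Were \<open>k\<close> a \<open>\<rho>\<close>-number, it would divide the class
    size of \<open>y\<close>, which is smaller than \<open>|U| \<le> k\<close>. This is where the
    comparison of the two sizes enters.\<close>
  moreover have "pi_number \<pi> k"
  proof (rule ccontr)
    assume "\<not> pi_number \<pi> k"
    then have "pi_number \<rho> k" using xy by (simp add: k_def)
    then have "coprime k (class_size G x)"
      using pi_number_coprime[OF \<pi> x(2)] by (simp add: coprime_commute)
    then have "k dvd class_size G y" using kdvd by (simp add: coprime_dvd_mult_right_iff)
    then have "k \<le> class_size G y" using class_size_pos[OF y(1)] by (rule dvd_imp_le)
    then show False using less \<open>card U \<le> k\<close> cX by simp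
  qed
  then have "coprime k (class_size G y)" using pi_number_coprime[OF \<pi> _ y(2)] by blast
  then have "k dvd class_size G x" using kdvd by (simp add: coprime_dvd_mult_left_iff)
  then have "k \<le> card U" using class_size_pos[OF x(1)] cX by (simp add: dvd_imp_le)
  ultimately have kX: "k = card U" by simp
  have shift: "(\<lambda>a. a \<otimes> b) ` U = Z" if b: "b \<in> V" for b
  proof (rule card_subset_eq[OF fin(2)])
    show "(\<lambda>a. a \<otimes> b) ` U \<subseteq> Z" using XYZ b by blast
    show "card ((\<lambda>a. a \<otimes> b) ` U) = card Z" using card_shift Yc b kX cZ by auto
  qed
  define K where "K = {d \<in> carrier G. (\<lambda>a. a \<otimes> d) ` U = U}"
  have KI: "d \<in> K" if d: "d \<in> carrier G" "\<And>a. a \<in> U \<Longrightarrow> a \<otimes> d \<in> U" for d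
    using d card_shift[OF d(1)] card_subset_eq[OF fin(1), of "(\<lambda>a. a \<otimes> d) ` U"]
    by (auto simp: K_def)
  have KD: "a \<otimes> d \<in> U" if "d \<in> K" "a \<in> U" for a d
    using that by (auto simp: K_def)
  have Kc: "d \<in> carrier G" if "d \<in> K" for d using that by (simp add: K_def)
  have sK: "subgroup K G"
  proof (rule subgroupI)
    show "K \<subseteq> carrier G" using Kc by blast
    have "\<one> \<in> K" using Xc by (intro KI) (auto simp: subset_iff)
    then show "K \<noteq> {}" by blast
    show "inv d \<in> K" if d: "d \<in> K" for d
    proof (rule KI)
      show "inv d \<in> carrier G" using Kc d by simp
      fix a assume "a \<in> U"
      then obtain b where b: "b \<in> U" "a = b \<otimes> d" using d unfolding K_def by blast
      then have "a \<otimes> inv d = b" using Xc Kc[OF d] by (auto simp: m_assoc)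
      then show "a \<otimes> inv d \<in> U" using b by simp
    qed
    show "d \<otimes> e \<in> K" if "d \<in> K" "e \<in> K" for d e
    proof (rule KI)
      show "d \<otimes> e \<in> carrier G" using that Kc by simp
      fix a assume a: "a \<in> U"
      have "a \<otimes> d \<otimes> e \<in> U" using KD that a by blast
      then show "a \<otimes> (d \<otimes> e) \<in> U" using a Xc that Kc by (auto simp: m_assoc)
    qed
  qed
  have Xcj: "cj g a \<in> U" if "g \<in> carrier G" "a \<in> U" for g a
    using that x(1) by (auto simp: U_def orb_def cj_mult[symmetric])
  have nK: "K \<lhd> G"
  proof (rule normalI_cj[OF sK])
    fix g d assume g: "g \<in> carrier G" and d: "d \<in> K"
    show "cj g d \<in> K"
    proof (rule KI)
      show "cj g d \<in> carrier G" using g Kc[OF d] by simp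
      fix a assume a: "a \<in> U"
      have "cj g (cj (inv g) a \<otimes> d) \<in> U"
        using KD[OF d] Xcj g a by simp
      then show "a \<otimes> cj g d \<in> U"
        using g a Xc Kc[OF d] by (auto simp: cj_hom subset_iff)
    qed
  qed
  \<comment> \<open>\<open>U\<close> is stable under right multiplication by \<open>K\<close>, hence
    a disjoint union of cosets \<open>a K\<close>; so \<open>|K|\<close> inherits being a
    \<open>\<pi>\<close>-number.\<close>
  have "card ((\<lambda>a. (\<lambda>d. a \<otimes> d) ` K) ` U) * card K = card U"
  proof (rule card_equal_fibres[OF fin(1)])
    fix a assume a: "a \<in> U"
    then have ac: "a \<in> carrier G" using Xc by blast
    have "{b \<in> U. (\<lambda>d. b \<otimes> d) ` K = (\<lambda>d. a \<otimes> d) ` K} = (\<lambda>d. a \<otimes> d) ` K"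
    proof
      show "{b \<in> U. (\<lambda>d. b \<otimes> d) ` K = (\<lambda>d. a \<otimes> d) ` K} \<subseteq> (\<lambda>d. a \<otimes> d) ` K"
      proof
        fix b assume "b \<in> {b \<in> U. (\<lambda>d. b \<otimes> d) ` K = (\<lambda>d. a \<otimes> d) ` K}"
        then have b: "b \<in> U" "(\<lambda>d. b \<otimes> d) ` K = (\<lambda>d. a \<otimes> d) ` K" by auto
        have "b = b \<otimes> \<one>" using b Xc by auto
        then show "b \<in> (\<lambda>d. a \<otimes> d) ` K" using b(2) subgroup.one_closed[OF sK] by blast
      qed
      show "(\<lambda>d. a \<otimes> d) ` K \<subseteq> {b \<in> U. (\<lambda>d. b \<otimes> d) ` K = (\<lambda>d. a \<otimes> d) ` K}"
      proof
        fix b assume "b \<in> (\<lambda>d. a \<otimes> d) ` K"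
        then obtain d where d: "d \<in> K" "b = a \<otimes> d" by blast
        have "(\<lambda>e. b \<otimes> e) ` K = (\<lambda>e. a \<otimes> e) ` ((\<lambda>e. d \<otimes> e) ` K)"
          unfolding image_image using d ac Kc by (intro image_cong) (simp_all add: m_assoc)
        also have "(\<lambda>e. d \<otimes> e) ` K = K"
        proof
          show "(\<lambda>e. d \<otimes> e) ` K \<subseteq> K" using d sK by (auto simp: subgroup.m_closed)
          show "K \<subseteq> (\<lambda>e. d \<otimes> e) ` K"
          proof
            fix e assume e: "e \<in> K"
            have "e = d \<otimes> (inv d \<otimes> e)" using e d Kc by simp
            moreover have "inv d \<otimes> e \<in> K" using e d sK by (simp add: subgroup.m_closed subgroup.m_inv_closed)
            ultimately show "e \<in> (\<lambda>e. d \<otimes> e) ` K" by blast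
          qed
        qed
        finally show "b \<in> {b \<in> U. (\<lambda>d. b \<otimes> d) ` K = (\<lambda>d. a \<otimes> d) ` K}"
          using d a KD by simp
      qed
    qed
    then show "card {b \<in> U. (\<lambda>d. b \<otimes> d) ` K = (\<lambda>d. a \<otimes> d) ` K} = card K"
      using ac Kc by (simp add: card_image inj_on_def)
  qed
  then have "card K dvd class_size G x" using cX by (metis dvd_triv_right)
  then have "pi_number \<pi> (card K)" using x(2) pi_number_dvd by blast
  moreover have "\<exists>k\<in>K. cj g y = k \<otimes> y" if g: "g \<in> carrier G" for g
  proof
    let ?b = "cj g y"
    have bY: "?b \<in> V" using g by (auto simp: V_def orb_def)
    have bc: "?b \<in> carrier G" using g y(1) by simp
    show "?b \<otimes> inv y \<in> K"
    proof (rule KI)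
      show "?b \<otimes> inv y \<in> carrier G" using bc y(1) by simp
      fix a assume a: "a \<in> U"
      then have "a \<otimes> ?b \<in> Z" using XYZ bY by blast
      then obtain a' where a': "a' \<in> U" "a \<otimes> ?b = a' \<otimes> y" using shift[OF yY] by blast
      have "a \<otimes> (?b \<otimes> inv y) = (a \<otimes> ?b) \<otimes> inv y" using a Xc bc y(1) by (auto simp: m_assoc)
      also have "\<dots> = a'" using a' Xc y(1) by (auto simp: m_assoc)
      finally show "a \<otimes> (?b \<otimes> inv y) \<in> U" using a' by simp
    qed
    show "?b = ?b \<otimes> inv y \<otimes> y" using bc y(1) by (simp add: m_assoc)
  qed
  ultimately show ?thesis using nK by blast
qed

lemma pel_coprime_card:
  assumes q: "is_prime q" and K: "subgroup K G" "\<not> q dvd card K" and k: "k \<in> K" "pel q k"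
  shows "k = \<one>"
proof -
  have kc: "k \<in> carrier G" using k(2) by (rule pel_carrier)
  obtain e where "k [^] (q ^ e) = \<one>" using k(2) by (auto simp: pel_def)
  then have "ord k dvd q ^ e" using kc pow_eq_id by blast
  moreover have "ord k dvd card K" using subgroup_card_pow_eq_one[OF K(1) k(1)] kc pow_eq_id by blast
  moreover have "coprime (q ^ e) (card K)" using q K(2) by (simp add: prime_imp_coprime)
  ultimately have "ord k = 1" using coprime_common_divisor_nat by blast
  then show ?thesis using kc ord_eq_1 by simp
qed

text \<open>Let \<open>K\<close> be the normal \<open>\<pi>\<close>-subgroup holding the commutators
  with \<open>y\<close>; it centralises \<open>y\<close>. A commutator with a \<open>q\<close>-part
  of \<open>y\<close> is then both a \<open>q\<close>-element and an element of \<open>K\<close>,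
  hence trivial. A part \<open>z\<close> of \<open>y\<close> at a prime of \<open>\<pi>\<close>
  generates with \<open>K\<close> a normal \<open>\<pi>\<close>-subgroup, which every
  \<open>r\<close> of \<open>\<rho>\<close>-class size centralises.\<close>

lemma smaller_class:
  assumes \<pi>: "complementary \<pi> \<rho>"
    and x: "x \<in> carrier G" "pi_number \<pi> (class_size G x)"
    and y: "y \<in> carrier G" "pi_number \<rho> (class_size G y)"
    and xy: "pi_number \<pi> (class_size G (x \<otimes> y)) \<or> pi_number \<rho> (class_size G (x \<otimes> y))"
    and less: "class_size G y < class_size G x"
  shows smaller_class_rho_parts_central:
      "\<And>q n. is_prime q \<Longrightarrow> q \<in> \<rho> \<Longrightarrow> pel q (y [^] (n::nat)) \<Longrightarrow> cent (y [^] n) = carrier G"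
    and smaller_class_commutes: "\<And>r. r \<in> carrier G \<Longrightarrow> pi_number \<rho> (class_size G r) \<Longrightarrow> y \<in> cent r"
proof -
  obtain K where K: "K \<lhd> G" "pi_number \<pi> (card K)"
    and cK: "\<And>g. g \<in> carrier G \<Longrightarrow> \<exists>k\<in>K. cj g y = k \<otimes> y"
    using commutators_in_normal_pi_subgroup[OF \<pi> x y xy less] by blast
  have sK: "subgroup K G" using K(1) by (rule normal_imp_subgroup)
  note Kc = subgroup.mem_carrier[OF sK]
  have Kr: "K \<subseteq> cent r" if "r \<in> carrier G" "pi_number \<rho> (class_size G r)" for r
    using normal_pi_centralised[OF \<pi> K that] .
  have cKn: "\<exists>k\<in>K. cj g (y [^] n) = k \<otimes> y [^] n" if g: "g \<in> carrier G" for g and n :: nat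
  proof -
    obtain k where k: "k \<in> K" "cj g y = k \<otimes> y" using cK[OF g] by blast
    have "k \<otimes> y = y \<otimes> k" using Kr[OF y] k(1) by (auto simp: cent_def)
    then have "(k \<otimes> y) [^] n = k [^] n \<otimes> y [^] n"
      using y(1) Kc[OF k(1)] pow_mult_distrib by blast
    then have "cj g (y [^] n) = k [^] n \<otimes> y [^] n"
      using g y(1) k(2) by (simp add: cj_pow)
    then show ?thesis using subgroup_pow[OF sK k(1)] by blast
  qed
  show 1: "cent (y [^] n) = carrier G" if q: "is_prime q" "q \<in> \<rho>" and n: "pel q (y [^] n)" for q and n :: nat
  proof -
    let ?z = "y [^] n"
    have zc: "?z \<in> carrier G" using y(1) by simp
    have "cj g ?z = ?z" if g: "g \<in> carrier G" for g
    proof -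
      obtain k where k: "k \<in> K" "cj g ?z = k \<otimes> ?z" using cKn[OF g] by blast
      have kc: "k \<in> carrier G" using k(1) by (rule Kc)
      have "k \<in> cent ?z" using Kr[OF y] k(1) cent_pow[OF y(1)] by blast
      then have kz: "k \<otimes> ?z = ?z \<otimes> k" by (simp add: cent_def)
      have keq: "k = cj g ?z \<otimes> inv ?z" using k zc kc by (simp add: m_assoc)
      have "pel q (inv ?z)"
        using n unfolding pel_def by (auto simp: nat_pow_inv)
      moreover have "cj g ?z \<otimes> inv ?z = inv ?z \<otimes> cj g ?z"
      proof -
        have "inv ?z \<otimes> cj g ?z = k" using k(2) kz kc zc by simp
        then show ?thesis using keq by simp
      qed
      ultimately have "pel q k" using pel_mult[OF pel_cj[OF g n]] keq by metis
      then have "k = \<one>"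
        using pel_coprime_card[OF q(1) sK pi_number_not_dvd[OF \<pi> K(2) q] k(1)] by blast
      then show ?thesis using k zc by simp
    qed
    then show ?thesis using zc by (auto simp: mem_cent)
  qed
  show "y \<in> cent r" if r: "r \<in> carrier G" "pi_number \<rho> (class_size G r)" for r
  proof (rule mem_subgroup_if_primary_parts[OF cent_subgroup[OF r(1)] y(1)])
    fix n :: nat and p assume p: "is_prime p" and n: "pel p (y [^] n)"
    let ?z = "y [^] n"
    have zc: "?z \<in> carrier G" using y(1) by simp
    show "?z \<in> cent r"
    proof (cases "p \<in> \<rho>")
      case True
      then show ?thesis using 1[OF p True n] r(1) cent_sym[OF zc] by simp
    next
      case False
      then have "p \<in> \<pi>" using \<pi> p by (auto simp: complementary_def)
      obtain R k where R: "subgroup R G" "card R = p ^ k" "?z \<in> R"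
        and Rmin: "\<And>H. subgroup H G \<Longrightarrow> ?z \<in> H \<Longrightarrow> R \<subseteq> H"
        using pel_subgroup[OF p n] by blast
      \<comment> \<open>The powers of \<open>y\<close>: these are the elements whose conjugates are
        known modulo \<open>K\<close>, and the cyclic group \<open>R\<close> consists of such
        powers.\<close>
      define T where "T = {h. \<exists>m::nat. h = y [^] m}"
      have "subgroup (generate G {y}) G" using y(1) by (simp add: generate_is_subgroup)
      moreover have gen: "generate G {y} = T"
        using generate_pow_nat[OF y(1)] ord_ge_1[OF finite_carrier y(1)] unfolding T_def by auto
      moreover have "?z \<in> T" by (auto simp: T_def)
      ultimately have "R \<subseteq> T" using Rmin by metis
      have KR: "K <#> R \<lhd> G"
      proof (rule normal_product_normal[OF K(1) R(1)])
        show "\<exists>l\<in>K. cj g h = l \<otimes> h" if "g \<in> carrier G" "h \<in> R" for g h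
          using cKn[OF that(1)] that(2) \<open>R \<subseteq> T\<close> by (auto simp: T_def)
      qed
      have "card (K <#> R) dvd card K * card R"
        using card_set_mult[OF sK R(1)] by (metis dvd_triv_left)
      moreover have "pi_number \<pi> (card K * card R)"
        using K(2) R(2) pi_number_prime_power[OF p \<open>p \<in> \<pi>\<close>] by (simp add: pi_number_mult)
      ultimately have "K <#> R \<subseteq> cent r"
        using normal_pi_centralised[OF \<pi> KR _ r] pi_number_dvd by blast
      moreover have "?z = \<one> \<otimes> ?z" using zc by simp
      then have "?z \<in> K <#> R"
        using subgroup.one_closed[OF sK] R(3) unfolding set_mult_def by blast
      ultimately show ?thesis by blast
    qed
  qed
qed

end

lemma pi_factorisation:
  assumes \<pi>: "complementary \<pi> \<rho>" and n: "0 < (n :: nat)"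
  shows "\<exists>a b. n = a * b \<and> pi_number \<pi> a \<and> pi_number \<rho> b"
  using n
proof (induction n rule: less_induct)
  case (less n)
  show ?case
  proof (cases "n = 1")
    case True
    then show ?thesis by (intro exI[of _ 1]) simp
  next
    case False
    then obtain p where p: "is_prime p" "p dvd n" using prime_factor_nat by blast
    then obtain m where m: "n = p * m" by blast
    then have "0 < m" "m < n" using less.prems prime_gt_1_nat[OF p(1)] by auto
    then obtain a b where ab: "m = a * b" "pi_number \<pi> a" "pi_number \<rho> b" using less.IH by blast
    have pp: "pi_number \<sigma> p" if "p \<in> \<sigma>" for \<sigma>
      using pi_number_prime_power[OF p(1) that, of 1] by simp
    show ?thesis
    proof (cases "p \<in> \<pi>")
      case True
      then have "pi_number \<pi> (p * a)" using ab pp by (simp add: pi_number_mult)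
      then show ?thesis using m ab by (intro exI[of _ "p * a"] exI[of _ b]) simp
    next
      case False
      then have "p \<in> \<rho>" using \<pi> p(1) by (auto simp: complementary_def)
      then have "pi_number \<rho> (p * b)" using ab pp by (simp add: pi_number_mult)
      then show ?thesis using m ab by (intro exI[of _ a] exI[of _ "p * b"]) simp
    qed
  qed
qed

lemma subgroup_group_facts:
  assumes "finite_group G" and N: "subgroup N G" and x: "x \<in> N"
  shows "finite_group (G\<lparr>carrier := N\<rparr>)"
    and "class_size (G\<lparr>carrier := N\<rparr>) x = card (finite_group.orb G N x)"
    and "finite_group.pel (G\<lparr>carrier := N\<rparr>) p x \<longleftrightarrow> finite_group.pel G p x"
    and "finite_group.cent (G\<lparr>carrier := N\<rparr>) x = N \<inter> finite_group.cent G x"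
proof -
  interpret finite_group G by (rule assms(1))
  have xc: "x \<in> carrier G" using N x by (rule subgroup.mem_carrier)
  show fg: "finite_group (G\<lparr>carrier := N\<rparr>)"
    using subgroup_imp_group[OF N] finite_subgroup[OF N]
    by (simp add: finite_group_def finite_group_axioms_def)
  interpret N: finite_group "G\<lparr>carrier := N\<rparr>" by (rule fg)
  have "N.cj g x = cj g x" if "g \<in> N" for g
    using that N unfolding N.cj_def cj_def by simp
  then have "N.orb N x = orb N x" unfolding N.orb_def orb_def by simp
  then show "class_size (G\<lparr>carrier := N\<rparr>) x = card (orb N x)" using N.class_size_orb[of x] x by simp
  show "N.pel p x \<longleftrightarrow> pel p x"
    unfolding N.pel_def pel_def using x xc by (simp add: nat_pow_consistent[symmetric])
  show "N.cent x = N \<inter> cent x"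
    unfolding N.cent_def cent_def using subgroup.mem_carrier[OF N] by auto
qed

section \<open>Minimal normal subgroups and commutators\<close>

context finite_group
begin

lemma p_subgroup_card:
  assumes q: "is_prime q" and R: "subgroup R G" and pel: "\<And>h. h \<in> R \<Longrightarrow> pel q h"
  obtains k where "card R = q ^ k"
proof -
  have c0: "card R \<noteq> 0" using card_pos[OF R] by simp
  obtain m where m: "card R = q ^ multiplicity q (card R) * m" "\<not> q dvd m"
    using multiplicity_decompose'[OF c0, of q] q by (metis not_prime_unit)
  have "m = 1"
  proof (rule ccontr)
    assume "m \<noteq> 1"
    then obtain p where p: "is_prime p" "p dvd m" using prime_factor_nat by blast
    obtain P a k where P: "subgroup P G" "P \<subseteq> R" "card P = p ^ a" "card R = p ^ a * k" "\<not> p dvd k"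
      using sylow_ex[OF p(1) R] by blast
    have pq: "p \<noteq> q" using p m(2) by blast
    have "x = \<one>" if x: "x \<in> P" for x
    proof -
      have "\<not> q dvd card P" using P(3) pq p(1) q by (metis prime_dvd_power primes_dvd_imp_eq)
      then show ?thesis using pel_coprime_card[OF q P(1)] x pel P(2) by blast
    qed
    then have "P = {\<one>}" using subgroup.one_closed[OF P(1)] by blast
    then have "card R = k" using P(3,4) by simp
    moreover have "p dvd card R" using m(1) p(2) by (metis dvd_mult)
    ultimately show False using P(5) by simp
  qed
  then show ?thesis using m(1) that by simp
qed

text \<open>The criterion for central \<open>q\<close>-elements is applied to the trivial
  factorisation \<open>L = L L\<close> with a one-step series; class sizes in \<open>L\<close>
  divide those in \<open>G\<close> because \<open>L\<close> is normal.\<close>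

lemma p_elements_of_center:
  assumes q: "is_prime q" and L: "L \<lhd> G"
    and nd: "\<And>l. l \<in> L \<Longrightarrow> \<not> q dvd class_size G l"
    and h: "h \<in> L" "pel q h"
  shows "L \<subseteq> cent h"
proof -
  have sL: "subgroup L G" using L by (rule normal_imp_subgroup)
  note facts = subgroup_group_facts[OF finite_group_axioms sL]
  interpret L: finite_group "G\<lparr>carrier := L\<rparr>" using facts(1)[OF h(1)] .
  have "L.cent h = carrier (G\<lparr>carrier := L\<rparr>)"
  proof (rule p_elements_central[OF L.finite_group_axioms L.subgroup_self L.subgroup_self])
    show "is_prime q" by (rule q)
    show "L.pel q h" using facts(3)[OF h(1)] h(2) by simp
    have LL: "L <#> L = L" using sL by (rule subgroup_mult_id)
    then show "carrier (G\<lparr>carrier := L\<rparr>) <#>\<^bsub>G\<lparr>carrier := L\<rparr>\<^esub> carrier (G\<lparr>carrier := L\<rparr>) = carrier (G\<lparr>carrier := L\<rparr>)"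
      by (simp add: set_mult_def)
    have "{\<one>} <#> L = L"
      using subgroup.mem_carrier[OF sL] by (force simp: set_mult_def)
    then show "covering_series (G\<lparr>carrier := L\<rparr>) (carrier (G\<lparr>carrier := L\<rparr>)) (carrier (G\<lparr>carrier := L\<rparr>))
       (\<lambda>i. if i = 0 then {\<one>} else L) 1"
      using L.one_is_normal L.normal_self sL
      unfolding covering_series_def by (auto simp: set_mult_def subgroup.one_closed le_Suc_eq)
    fix r assume "r \<in> carrier (G\<lparr>carrier := L\<rparr>) \<union> carrier (G\<lparr>carrier := L\<rparr>)"
    then have r: "r \<in> L" by simp
    then show "\<not> q dvd class_size (G\<lparr>carrier := L\<rparr>) r"
      using facts(2)[OF r] class_in_normal_dvd[OF L, of r] subgroup.mem_carrier[OF sL r] nd[OF r]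
        dvd_trans by metis
  qed
  then show ?thesis using facts(4)[OF h(1)] by auto
qed

definition minimal_normal :: "'a set \<Rightarrow> bool" where
  "minimal_normal L \<longleftrightarrow> L \<lhd> G \<and> (\<forall>N. N \<lhd> G \<longrightarrow> N \<subseteq> L \<longrightarrow> N = {\<one>} \<or> N = L)"

lemma normal_centre:
  assumes L: "L \<lhd> G"
  shows "{z \<in> L. L \<subseteq> cent z} \<lhd> G"
proof (rule normalI_cj)
  have sL: "subgroup L G" using L by (rule normal_imp_subgroup)
  note Lc = subgroup.mem_carrier[OF sL]
  show "subgroup {z \<in> L. L \<subseteq> cent z} G"
  proof (rule subgroupI)
    show "{z \<in> L. L \<subseteq> cent z} \<subseteq> carrier G" using Lc by blast
    have "\<one> \<in> {z \<in> L. L \<subseteq> cent z}" using subgroup.one_closed[OF sL] Lc by (auto simp: cent_def)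
    then show "{z \<in> L. L \<subseteq> cent z} \<noteq> {}" by blast
    have sym: "L \<subseteq> cent z \<longleftrightarrow> (\<forall>l\<in>L. z \<in> cent l)" if "z \<in> L" for z
      using that Lc cent_sym by blast
    show "inv a \<in> {z \<in> L. L \<subseteq> cent z}" if "a \<in> {z \<in> L. L \<subseteq> cent z}" for a
      using that sym subgroup.m_inv_closed[OF sL] subgroup.m_inv_closed[OF cent_subgroup[OF Lc]] by auto
    show "a \<otimes> b \<in> {z \<in> L. L \<subseteq> cent z}"
      if "a \<in> {z \<in> L. L \<subseteq> cent z}" "b \<in> {z \<in> L. L \<subseteq> cent z}" for a b
      using that sym subgroup.m_closed[OF sL] subgroup.m_closed[OF cent_subgroup[OF Lc]] by auto
  qed
  fix g z assume g: "g \<in> carrier G" and z: "z \<in> {z \<in> L. L \<subseteq> cent z}"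
  have "l \<in> cent (cj g z)" if l: "l \<in> L" for l
  proof -
    have "cj (inv g) l \<in> cent z" using z normal_cj[OF L] g l by blast
    then have "cj g (cj (inv g) l) \<in> cent (cj g z)" using cent_cj g z Lc by blast
    then show ?thesis using g Lc[OF l] by simp
  qed
  then show "cj g z \<in> {z \<in> L. L \<subseteq> cent z}" using normal_cj[OF L g] z by blast
qed

text \<open>The centre of \<open>L\<close> is normal in \<open>G\<close>, so it is either all of
  \<open>L\<close> or trivial.\<close>

lemma minimal_normal_cases:
  assumes L: "minimal_normal L"
  obtains "\<And>a. a \<in> L \<Longrightarrow> L \<subseteq> cent a" | "\<And>z. z \<in> L \<Longrightarrow> L \<subseteq> cent z \<Longrightarrow> z = \<one>"
proof -
  have "{z \<in> L. L \<subseteq> cent z} = {\<one>} \<or> {z \<in> L. L \<subseteq> cent z} = L"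
    using L normal_centre unfolding minimal_normal_def by blast
  then show ?thesis using that by blast
qed

text \<open>In an abelian \<open>L\<close> the \<open>q\<close>-elements form a subgroup, which is
  normal in \<open>G\<close> and non-trivial when \<open>q\<close> divides
  \<open>|L|\<close>.\<close>

lemma abelian_minimal_normal:
  assumes L: "minimal_normal L" and ab: "\<And>a. a \<in> L \<Longrightarrow> L \<subseteq> cent a"
  obtains q where "is_prime q" "\<And>l. l \<in> L \<Longrightarrow> pel q l"
proof (cases "L = {\<one>}")
  case True
  \<comment> \<open>For trivial \<open>L\<close> any prime serves; 2 is an arbitrary choice.\<close>
  then show ?thesis using that[of 2] by (auto simp: pel_def)
next
  case False
  have nL: "L \<lhd> G" using L by (simp add: minimal_normal_def)
  then have sL: "subgroup L G" by (rule normal_imp_subgroup)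
  note Lc = subgroup.mem_carrier[OF sL]
  have "card L \<noteq> 1" using False subgroup.one_closed[OF sL] card_1_singletonE by (metis singletonD)
  then obtain q where q: "is_prime q" "q dvd card L" using prime_factor_nat by blast
  define T where "T = {l \<in> L. pel q l}"
  have "T \<lhd> G"
  proof (rule normalI_cj)
    show "subgroup T G"
    proof (rule subgroupI)
      show "T \<subseteq> carrier G" using Lc by (auto simp: T_def)
      have "\<one> \<in> T" using subgroup.one_closed[OF sL] by (simp add: T_def pel_def)
      then show "T \<noteq> {}" by blast
      show "inv a \<in> T" if "a \<in> T" for a
        using that subgroup.m_inv_closed[OF sL] Lc
        by (auto simp: T_def pel_def nat_pow_inv)
      show "a \<otimes> b \<in> T" if "a \<in> T" "b \<in> T" for a b
      proof -
        have "a \<otimes> b = b \<otimes> a" using that ab[of b] by (auto simp: T_def cent_def)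
        then show ?thesis using that pel_mult subgroup.m_closed[OF sL] by (auto simp: T_def)
      qed
    qed
    show "cj g a \<in> T" if "g \<in> carrier G" "a \<in> T" for g a
      using that normal_cj[OF nL] pel_cj by (simp add: T_def)
  qed
  moreover have "T \<noteq> {\<one>}"
  proof
    assume T1: "T = {\<one>}"
    obtain P a m where P: "subgroup P G" "P \<subseteq> L" "card P = q ^ a" "card L = q ^ a * m" "\<not> q dvd m"
      using sylow_ex[OF q(1) sL] by blast
    have "P \<subseteq> T" using P p_subgroup_pel[OF P(1,3)] by (auto simp: T_def)
    then have "P = {\<one>}" using T1 subgroup.one_closed[OF P(1)] by blast
    then have "card L = m" using P(3,4) by simp
    then show False using P(5) q(2) by simp
  qed
  ultimately have "T = L" using L unfolding minimal_normal_def T_def by blast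
  then show ?thesis using that[OF q(1)] by (auto simp: T_def)
qed

text \<open>All conjugates of \<open>y\<close> have \<open>\<rho>\<close>-class size, so
  \<open>y\<close> commutes with them. Hence \<open>y\<close> lies in the normal subgroup of
  \<open>L\<close> centralising its class; by minimality this is \<open>L\<close>, and
  \<open>y\<close> itself is the required central element.\<close>

lemma abelian_if_smaller_class:
  assumes \<pi>: "complementary \<pi> \<rho>" and L: "minimal_normal L"
    and x: "x \<in> L" "pi_number \<pi> (class_size G x)"
    and y: "y \<in> L" "pi_number \<rho> (class_size G y)"
    and xy: "pi_number \<pi> (class_size G (x \<otimes> y)) \<or> pi_number \<rho> (class_size G (x \<otimes> y))"
    and less: "class_size G y < class_size G x" and ny: "y \<noteq> \<one>"
  shows "\<exists>z\<in>L. z \<noteq> \<one> \<and> L \<subseteq> cent z"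
proof -
  have nL: "L \<lhd> G" using L by (simp add: minimal_normal_def)
  then have sL: "subgroup L G" by (rule normal_imp_subgroup)
  note Lc = subgroup.mem_carrier[OF sL]
  let ?I = "{g \<in> carrier G. \<forall>k\<in>carrier G. g \<in> cent (cj k y)}"
  have "?I \<inter> L \<lhd> G"
    using normal_Int_subgroup class_centraliser_normal[OF Lc[OF y(1)]] nL normal_subgroup_intersect by blast
  moreover have "y \<in> cent (cj k y)" if "k \<in> carrier G" for k
    using smaller_class_commutes[OF \<pi> Lc[OF x(1)] x(2) Lc[OF y(1)] y(2) xy less, of "cj k y"]
      that Lc[OF y(1)] y(2) by (simp add: class_size_cj)
  then have "y \<in> ?I \<inter> L" using y(1) Lc by simp
  ultimately have "?I \<inter> L = L" using L ny unfolding minimal_normal_def by blast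
  then have "L \<subseteq> ?I" by blast
  then have "L \<subseteq> cent (cj \<one> y)" by blast
  then have "L \<subseteq> cent y" using Lc[OF y(1)] by simp
  then show ?thesis using y ny by blast
qed

text \<open>If both types occurred, whichever of the two classes is smaller would supply a
  non-trivial element of the centre of \<open>L\<close>.\<close>

lemma nonabelian_minimal_normal:
  assumes \<pi>: "complementary \<pi> \<rho>" and L: "minimal_normal L"
    and centre: "\<And>z. z \<in> L \<Longrightarrow> L \<subseteq> cent z \<Longrightarrow> z = \<one>"
    and good: "\<And>r. r \<in> L \<Longrightarrow> pi_number \<pi> (class_size G r) \<or> pi_number \<rho> (class_size G r)"
  shows "(\<forall>l\<in>L. pi_number \<pi> (class_size G l)) \<or> (\<forall>l\<in>L. pi_number \<rho> (class_size G l))"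
proof (rule ccontr)
  assume "\<not> ?thesis"
  then obtain x y where x: "x \<in> L" "\<not> pi_number \<rho> (class_size G x)"
    and y: "y \<in> L" "\<not> pi_number \<pi> (class_size G y)" by blast
  then have x\<pi>: "pi_number \<pi> (class_size G x)" and y\<rho>: "pi_number \<rho> (class_size G y)"
    using good by blast+
  have sL: "subgroup L G" using L by (simp add: minimal_normal_def normal_imp_subgroup)
  have gxy: "pi_number \<pi> (class_size G (x \<otimes> y)) \<or> pi_number \<rho> (class_size G (x \<otimes> y))"
    and gyx: "pi_number \<rho> (class_size G (y \<otimes> x)) \<or> pi_number \<pi> (class_size G (y \<otimes> x))"
    using good x y subgroup.m_closed[OF sL] by blast+
  have "cent \<one> = carrier G" by (auto simp: cent_def)
  then have one: "class_size G \<one> = 1" using class_size_1_iff[OF one_closed] by blast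
  have ne: "x \<noteq> \<one>" "y \<noteq> \<one>" using x(2) y(2) one by auto
  have "class_size G x \<noteq> class_size G y" using x(2) y\<rho> by auto
  then consider "class_size G y < class_size G x" | "class_size G x < class_size G y" by linarith
  then have "\<exists>z\<in>L. z \<noteq> \<one> \<and> L \<subseteq> cent z"
  proof cases
    case 1
    then show ?thesis using abelian_if_smaller_class[OF \<pi> L x(1) x\<pi> y(1) y\<rho> gxy] ne by blast
  next
    case 2
    then show ?thesis
      using abelian_if_smaller_class[OF complementary_sym[OF \<pi>] L y(1) y\<rho> x(1) x\<pi> gyx] ne by blast
  qed
  then show False using centre by blast
qed

text \<open>With \<open>\<Gamma> = {g \<in> C\<^sub>G(L). [g, x] \<in> L}\<close>, the map \<open>g \<mapsto> [g, x]\<close> is a homomorphism from \<open>\<Gamma>\<close> into the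
  \<open>q\<close>-group \<open>L\<close> with kernel \<open>C\<^sub>\<Gamma>(x)\<close>, whereas \<open>|\<Gamma> : C\<^sub>\<Gamma>(x)|\<close> divides \<open>|x\<^sup>G|\<close>, which is prime to \<open>q\<close>.\<close>

lemma commutes_if_commutator_in_central:
  assumes q: "is_prime q" and L: "L \<lhd> G" and ab: "\<And>a. a \<in> L \<Longrightarrow> L \<subseteq> cent a"
    and Lq: "\<And>l. l \<in> L \<Longrightarrow> pel q l"
    and x: "x \<in> carrier G" "\<not> q dvd class_size G x"
    and h: "h \<in> carrier G" "\<And>l. l \<in> L \<Longrightarrow> h \<in> cent l" "cj h x \<otimes> inv x \<in> L"
  shows "h \<in> cent x"
proof -
  have sL: "subgroup L G" using L by (rule normal_imp_subgroup)
  note Lc = subgroup.mem_carrier[OF sL]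
  define C where "C = {g \<in> carrier G. \<forall>l\<in>L. g \<in> cent l}"
  define \<Gamma> where "\<Gamma> = {g \<in> C. cj g x \<otimes> inv x \<in> L}"
  have sC: "subgroup C G"
  proof (rule subgroupI)
    show "C \<subseteq> carrier G" by (auto simp: C_def)
    have "\<one> \<in> C" using Lc by (auto simp: C_def cent_def)
    then show "C \<noteq> {}" by blast
    show "inv a \<in> C" if "a \<in> C" for a
      using that subgroup.m_inv_closed[OF cent_subgroup[OF Lc]] by (auto simp: C_def)
    show "a \<otimes> b \<in> C" if "a \<in> C" "b \<in> C" for a b
      using that subgroup.m_closed[OF cent_subgroup[OF Lc]] by (auto simp: C_def)
  qed
  have nC: "C \<lhd> G"
  proof (rule normalI_cj[OF sC])
    fix g c assume g: "g \<in> carrier G" and c: "c \<in> C"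
    have "cj g c \<in> cent l" if l: "l \<in> L" for l
    proof -
      have "c \<in> cent (cj (inv g) l)" using c normal_cj[OF L _ l] g by (simp add: C_def)
      then show ?thesis using cent_cj[of g "cj (inv g) l" c] g Lc[OF l] by simp
    qed
    then show "cj g c \<in> C" using g c by (simp add: C_def)
  qed
  have Cc: "c \<in> carrier G" if "c \<in> C" for c using that by (simp add: C_def)
  have Ccj: "cj c l = l" if "c \<in> C" "l \<in> L" for c l
    using that Lc by (auto simp: C_def mem_cent)
  \<comment> \<open>The factors come out in reverse order: \<open>a\<close> centralises
    \<open>L\<close> and so passes over the commutator of \<open>b\<close>. Only the fact that the
    image is a subgroup is drawn from this.\<close>
  have prod: "cj (a \<otimes> b) x \<otimes> inv x = (cj b x \<otimes> inv x) \<otimes> (cj a x \<otimes> inv x)"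
    if a: "a \<in> \<Gamma>" and b: "b \<in> \<Gamma>" for a b
  proof -
    define d where "d = cj b x \<otimes> inv x"
    have ac: "a \<in> carrier G" and bc: "b \<in> carrier G" using a b Cc by (auto simp: \<Gamma>_def)
    have d: "d \<in> L" using b by (simp add: d_def \<Gamma>_def)
    have "cj b x = d \<otimes> x" using bc x(1) by (simp add: d_def m_assoc)
    then have "cj (a \<otimes> b) x = d \<otimes> cj a x"
      using ac bc x(1) d Lc Ccj[OF _ d, of a] a by (simp add: cj_mult cj_hom \<Gamma>_def)
    then show ?thesis using ac x(1) Lc[OF d] by (simp add: d_def[symmetric] m_assoc)
  qed
  have s\<Gamma>: "subgroup \<Gamma> G"
  proof (rule subgroupI)
    show "\<Gamma> \<subseteq> carrier G" using Cc by (auto simp: \<Gamma>_def)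
    have "\<one> \<in> \<Gamma>" using subgroup.one_closed[OF sC] subgroup.one_closed[OF sL] x(1) by (simp add: \<Gamma>_def)
    then show "\<Gamma> \<noteq> {}" by blast
    show "inv a \<in> \<Gamma>" if a: "a \<in> \<Gamma>" for a
    proof -
      define d where "d = cj a x \<otimes> inv x"
      have ac: "a \<in> carrier G" and iC: "inv a \<in> C"
        using a Cc subgroup.m_inv_closed[OF sC] by (auto simp: \<Gamma>_def)
      have d: "d \<in> L" using a by (simp add: d_def \<Gamma>_def)
      have "cj a x = d \<otimes> x" using ac x(1) by (simp add: d_def m_assoc)
      then have "cj (inv a) (cj a x) = cj (inv a) (d \<otimes> x)" by simp
      then have "x = d \<otimes> cj (inv a) x"
        using ac x(1) Lc[OF d] Ccj[OF iC d] by (simp add: cj_hom)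
      then have "inv d \<otimes> x = inv d \<otimes> (d \<otimes> cj (inv a) x)" by simp
      then have "inv d \<otimes> x = cj (inv a) x" using ac x(1) Lc[OF d] by simp
      then have "cj (inv a) x \<otimes> inv x = inv d" using x(1) Lc[OF d] by (simp add: m_assoc flip: \<open>inv d \<otimes> x = cj (inv a) x\<close>)
      then show ?thesis using iC subgroup.m_inv_closed[OF sL d] by (simp add: \<Gamma>_def)
    qed
    show "a \<otimes> b \<in> \<Gamma>" if a: "a \<in> \<Gamma>" and b: "b \<in> \<Gamma>" for a b
      using prod[OF a b] a b subgroup.m_closed[OF sC] subgroup.m_closed[OF sL]
      by (simp add: \<Gamma>_def)
  qed
  define D where "D = (\<lambda>g. cj g x \<otimes> inv x) ` \<Gamma>"
  have sD: "subgroup D G"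
  proof -
    have DL: "D \<subseteq> L" by (auto simp: D_def \<Gamma>_def)
    have "finite D" using DL finite_subgroup[OF sL] finite_subset by blast
    show ?thesis
    proof (rule subgroupI)
      show "D \<subseteq> carrier G" using DL Lc by blast
      show "D \<noteq> {}" using subgroup.one_closed[OF s\<Gamma>] by (auto simp: D_def)
      show mult: "a \<otimes> b \<in> D" if ab: "a \<in> D" "b \<in> D" for a b
      proof -
        obtain g k where gk: "g \<in> \<Gamma>" "k \<in> \<Gamma>" "a = cj g x \<otimes> inv x" "b = cj k x \<otimes> inv x"
          using ab by (auto simp: D_def)
        have "a \<otimes> b = cj (k \<otimes> g) x \<otimes> inv x" using prod[OF gk(2,1)] gk by simp
        then show ?thesis using subgroup.m_closed[OF s\<Gamma> gk(2,1)] by (auto simp: D_def)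
      qed
      show "inv a \<in> D" if a: "a \<in> D" for a
      proof -
        obtain g where g: "g \<in> \<Gamma>" "a = cj g x \<otimes> inv x" using a by (auto simp: D_def)
        have ig: "inv g \<in> \<Gamma>" using g subgroup.m_inv_closed[OF s\<Gamma>] by blast
        then have b: "cj (inv g) x \<otimes> inv x \<in> D" by (auto simp: D_def)
        have gc: "g \<in> carrier G" using g subgroup.mem_carrier[OF s\<Gamma>] by blast
        have "(cj (inv g) x \<otimes> inv x) \<otimes> a = cj (g \<otimes> inv g) x \<otimes> inv x"
          using prod[OF g(1) ig] g by simp
        also have "\<dots> = \<one>" using gc x(1) by simp
        finally have "inv a = cj (inv g) x \<otimes> inv x"
          using a b DL Lc by (intro inv_equality) auto
        then show ?thesis using b by simp
      qed
    qed
  qed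
  obtain k where k: "card D = q ^ k"
  proof (rule p_subgroup_card[OF q sD])
    show "pel q d" if "d \<in> D" for d using that Lq by (auto simp: D_def \<Gamma>_def)
  qed
  have oD: "orb \<Gamma> x = (\<lambda>d. d \<otimes> x) ` D"
    unfolding D_def orb_def image_image
    using subgroup.mem_carrier[OF s\<Gamma>] x(1) by (intro image_cong) (simp_all add: m_assoc)
  have "card (orb \<Gamma> x) = card D"
    unfolding oD using x(1) subgroup.mem_carrier[OF sD] by (intro card_image inj_onI) simp
  moreover have "\<not> q dvd card (orb \<Gamma> x)"
  proof
    assume qd: "q dvd card (orb \<Gamma> x)"
    have sx: "subgroup (cent x) G" using x(1) by (rule cent_subgroup)
    \<comment> \<open>Elements commuting with \<open>x\<close> satisfy the condition defining
      \<open>\<Gamma>\<close>, so \<open>\<Gamma>\<close> and \<open>C\<close> have the same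
      stabiliser of \<open>x\<close>. The orbit length under \<open>\<Gamma>\<close> thus divides
      that under \<open>C\<close>, and normality of \<open>C\<close> carries it on to the class
      size.\<close>
    have eq: "\<Gamma> \<inter> cent x = C \<inter> cent x"
      using x(1) subgroup.one_closed[OF sL] by (auto simp: \<Gamma>_def mem_cent)
    have "card \<Gamma> dvd card C"
      using card_subgroup_dvd[OF s\<Gamma> sC] by (auto simp: \<Gamma>_def)
    then have "card (orb \<Gamma> x) * card (C \<inter> cent x) dvd card (orb C x) * card (C \<inter> cent x)"
      using card_orb[OF s\<Gamma> x(1)] card_orb[OF sC x(1)] eq by simp
    then have "card (orb \<Gamma> x) dvd card (orb C x)"
      using card_pos[OF inter_subgroup[OF sC sx]] by simp
    then have "q dvd class_size G x"
      using qd class_in_normal_dvd[OF nC x(1)] dvd_trans by blast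
    then show False using x(2) by blast
  qed
  ultimately have "card D = 1" using k by (cases k) auto
  then obtain e where "D = {e}" using card_1_singletonE by blast
  then have "D = {\<one>}" using subgroup.one_closed[OF sD] by blast
  moreover have "h \<in> \<Gamma>" using h by (simp add: \<Gamma>_def C_def)
  then have "cj h x \<otimes> inv x \<in> D" by (auto simp: D_def)
  ultimately have "cj h x \<otimes> inv x = \<one>" by blast
  then have "cj h x = x" using h(1) x(1) by (metis cj_closed inv_closed inv_equality inv_inv)
  then show ?thesis using h(1) x(1) by (simp add: mem_cent)
qed

text \<open>By Bezout both \<open>x\<close> and \<open>y\<close> are powers of
  \<open>x \<otimes> y\<close>.\<close>

lemma cent_mult_coprime:
  assumes c: "x \<otimes> y = y \<otimes> x" "x \<in> carrier G" "y \<in> carrier G"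
    and m: "x [^] (m::nat) = \<one>" "y [^] (k::nat) = \<one>" "coprime m k"
  shows "cent (x \<otimes> y) \<subseteq> cent x" "cent (x \<otimes> y) \<subseteq> cent y"
proof -
  have *: "cent (x \<otimes> y) \<subseteq> cent y"
    if c: "x \<otimes> y = y \<otimes> x" "x \<in> carrier G" "y \<in> carrier G"
      and m: "x [^] (m::nat) = \<one>" "y [^] (k::nat) = \<one>" "coprime m k" for x y m k
  proof -
    show ?thesis
    proof (cases "m = 0")
      case True
      \<comment> \<open>For \<open>m = 0\<close>, coprimality leaves only
        \<open>k = 1\<close>.\<close>
      then have "y = \<one>" using m(2,3) c(3) by simp
      then show ?thesis using cent_carrier by (auto simp: cent_def)
    next
      case False
      then obtain d u v where "d dvd m" "d dvd k" "m * u = k * v + d"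
        using bezout_add_strong_nat by blast
      then have u: "m * u = k * v + 1" using m(3) coprime_common_divisor_nat by metis
      have "(x \<otimes> y) [^] (m * u) = x [^] (m * u) \<otimes> y [^] (m * u)"
        using c(1) c(2,3) by (rule pow_mult_distrib)
      also have "x [^] (m * u) = \<one>" using m(1) c(2) by (simp flip: nat_pow_pow)
      also have "y [^] (m * u) = y [^] (k * v) \<otimes> y" using c(3) by (simp add: u)
      also have "y [^] (k * v) = \<one>" using m(2) c(3) by (simp flip: nat_pow_pow)
      finally have "(x \<otimes> y) [^] (m * u) = y" using c by simp
      then show ?thesis using cent_pow[of "x \<otimes> y" "m * u"] c by simp
    qed
  qed
  show "cent (x \<otimes> y) \<subseteq> cent y" using *[OF c m] .
  have "cent (y \<otimes> x) \<subseteq> cent x"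
    using *[OF c(1)[symmetric] c(3,2) m(2,1)] m(3) by (simp add: coprime_commute)
  then show "cent (x \<otimes> y) \<subseteq> cent x" using c(1) by simp
qed

end

section \<open>Class sizes in a factor\<close>

lemma coprime_prime_power: "is_prime p \<Longrightarrow> \<not> p dvd m \<Longrightarrow> coprime m (p ^ j)"
  by (metis prime_imp_coprime coprime_commute coprime_power_right_iff)

context finite_group
begin

lemma commute_if_commutator_trivial:
  "h \<in> carrier G \<Longrightarrow> x \<in> carrier G \<Longrightarrow> cj h x \<otimes> inv x = \<one> \<Longrightarrow> h \<in> cent x"
  by (metis cj_closed inv_closed inv_equality inv_inv mem_cent)

text \<open>As \<open>h\<close> fixes \<open>d = [h, x]\<close>, conjugating \<open>x\<close> by
  \<open>h^n\<close> gives \<open>d^n x\<close>. The order of \<open>d\<close> therefore divides a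
  power of \<open>q\<close> as well as one of \<open>p\<close>.\<close>

lemma commute_if_coprime_commutator:
  assumes q: "is_prime q" "pel q h" and p: "is_prime p" "p \<noteq> q" and x: "x \<in> carrier G"
    and d: "pel p (cj h x \<otimes> inv x)" "h \<in> cent (cj h x \<otimes> inv x)"
  shows "h \<in> cent x"
proof -
  define d where "d = cj h x \<otimes> inv x"
  have hc: "h \<in> carrier G" using q(2) by (rule pel_carrier)
  have dc: "d \<in> carrier G" using hc x by (simp add: d_def)
  have cjx: "cj h x = d \<otimes> x" using hc x by (simp add: d_def m_assoc)
  have hd: "cj h d = d" using d(2) dc by (simp add: d_def mem_cent)
  have pow: "cj (h [^] n) x = d [^] n \<otimes> x" for n :: nat
  proof (induction n)
    case 0
    then show ?case using x by simp
  next
    case (Suc n)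
    have "cj (h [^] Suc n) x = cj h (cj (h [^] n) x)"
      using hc x by (simp only: nat_pow_Suc2 cj_mult nat_pow_closed)
    also have "\<dots> = cj h (d [^] n) \<otimes> cj h x" using Suc hc dc x by (simp add: cj_hom)
    also have "\<dots> = d [^] n \<otimes> (d \<otimes> x)" using hc dc hd cjx by (simp add: cj_pow)
    finally show ?case using dc x by (simp add: m_assoc)
  qed
  obtain k where k: "h [^] (q ^ k) = \<one>" using q(2) by (auto simp: pel_def)
  obtain j where j: "d [^] (p ^ j) = \<one>" using d(1) by (auto simp: d_def pel_def)
  have "d [^] (q ^ k) \<otimes> x = x" using pow[of "q ^ k"] k x by simp
  then have "d [^] (q ^ k) = \<one>" using dc x by simp
  then have "ord d dvd q ^ k" "ord d dvd p ^ j" using dc j pow_eq_id by blast+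
  moreover have "coprime (q ^ k) (p ^ j)"
    using q(1) p by (simp add: primes_coprime)
  ultimately have "ord d = 1" using coprime_common_divisor_nat by blast
  then have "d = \<one>" using dc ord_eq_1 by simp
  then show ?thesis using commute_if_commutator_trivial hc x by (simp add: d_def)
qed

lemma rho_centralised_normal:
  "{l \<in> carrier G. \<forall>q h. is_prime q \<and> q \<in> \<rho> \<and> pel q h \<longrightarrow> l \<in> cent h} \<lhd> G" (is "?W \<lhd> G")
proof (rule normalI_cj)
  show "subgroup ?W G"
  proof (rule subgroupI)
    have "\<one> \<in> ?W" using pel_carrier by (auto simp: cent_def)
    then show "?W \<noteq> {}" by blast
    show "inv a \<in> ?W" if "a \<in> ?W" for a
      using that subgroup.m_inv_closed[OF cent_subgroup[OF pel_carrier]] by auto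
    show "a \<otimes> b \<in> ?W" if "a \<in> ?W" "b \<in> ?W" for a b
      using that subgroup.m_closed[OF cent_subgroup[OF pel_carrier]] by auto
  qed blast
  fix g l assume g: "g \<in> carrier G" and l: "l \<in> ?W"
  have "cj g l \<in> cent h" if "is_prime q" "q \<in> \<rho>" "pel q h" for q h
  proof -
    have "l \<in> cent (cj (inv g) h)" using l that pel_cj g by blast
    then show ?thesis using cent_cj[of g "cj (inv g) h" l] g pel_carrier[OF that(3)] by simp
  qed
  note c = this
  have "cj g l \<in> carrier G" using g l by simp
  then show "cj g l \<in> ?W" using c by blast
qed

text \<open>When \<open>L\<close> is an abelian \<open>p\<close>-group with \<open>p \<in> \<pi>\<close> on which the \<open>\<rho>\<close>-elements act non-trivially, \<open>x\<close> acts on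
  \<open>L \<inter> A\<close> without fixed points, since a fixed point \<open>l\<close> would make the class size of \<open>x l \<in> A\<close> mixed. Hence
  \<open>x (L \<inter> A)\<close> is a single \<open>L \<inter> A\<close>-orbit of \<open>p\<close>-power length, on which the \<open>q\<close>-group \<open>R\<close> has a fixed point.\<close>

lemma centralised_conjugate_step:
  assumes \<pi>: "complementary \<pi> \<rho>" and q: "is_prime q" "q \<in> \<rho>"
    and A: "subgroup A G" and L: "minimal_normal L"
    and good: "\<And>r. r \<in> A \<union> L \<Longrightarrow> pi_number \<pi> (class_size G r) \<or> pi_number \<rho> (class_size G r)"
    and commute: "\<And>p y s h. is_prime p \<Longrightarrow> p \<in> \<pi> \<Longrightarrow> pel p y \<Longrightarrow> pi_number \<pi> (class_size G y) \<Longrightarrow>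
      is_prime s \<Longrightarrow> s \<in> \<rho> \<Longrightarrow> pel s h \<Longrightarrow> h \<in> cent y"
    and x: "x \<in> A" "pi_number \<pi> (class_size G x)" and m: "x [^] (m::nat) = \<one>" "pi_number \<rho> m"
    and R: "subgroup R G" "R \<subseteq> A" "\<And>h. h \<in> R \<Longrightarrow> pel q h"
    and d: "\<And>h. h \<in> R \<Longrightarrow> cj h x \<otimes> inv x \<in> L"
  shows "\<exists>a\<in>A. \<forall>h\<in>R. cj a h \<in> cent x"
proof -
  note Ac = subgroup.mem_carrier[OF A]
  have xc: "x \<in> carrier G" using x(1) by (rule Ac)
  have Rc: "h \<in> carrier G" if "h \<in> R" for h using R(1) that by (rule subgroup.mem_carrier)
  have nL: "L \<lhd> G" using L by (simp add: minimal_normal_def)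
  then have sL: "subgroup L G" by (rule normal_imp_subgroup)
  note Lc = subgroup.mem_carrier[OF sL]
  have \<rho>\<pi>: "complementary \<rho> \<pi>" using \<pi> by (rule complementary_sym)
  have key: ?thesis if "\<And>h. h \<in> R \<Longrightarrow> h \<in> cent x"
    using that subgroup.one_closed[OF A] Rc by (intro bexI[of _ \<one>]) auto
  \<comment> \<open>Members of \<open>R\<close> of \<open>\<rho>\<close>-class size commute with
    \<open>x\<close> by coprimality, so only those of \<open>\<pi>\<close>-class size need
    attention.\<close>
  have key': ?thesis if *: "\<And>h. h \<in> R \<Longrightarrow> pi_number \<pi> (class_size G h) \<Longrightarrow> h \<in> cent x"
  proof (rule key)
    fix h assume h: "h \<in> R"
    show "h \<in> cent x"
    proof (cases "pi_number \<pi> (class_size G h)")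
      case True
      then show ?thesis using * h by blast
    next
      case False
      then have "pi_number \<rho> (class_size G h)" using good h R(2) by blast
      then show ?thesis using coprime_classes_commute[OF \<rho>\<pi> q R(3)[OF h] _ xc x(2)] by blast
    qed
  qed
  \<comment> \<open>By \<open>m\<close>, the parts of \<open>x\<close> at primes of
    \<open>\<pi>\<close> are trivial; so \<open>x\<close> lies in the centraliser of anything that
    all \<open>\<rho>\<close>-elements of prime power order centralise.\<close>
  have xl: "x \<in> cent l"
    if l: "l \<in> carrier G" "\<And>s h. is_prime s \<Longrightarrow> s \<in> \<rho> \<Longrightarrow> pel s h \<Longrightarrow> h \<in> cent l" for l
  proof (rule mem_subgroup_if_primary_parts[OF cent_subgroup[OF l(1)] xc])
    fix n :: nat and p assume p: "is_prime p" and n: "pel p (x [^] n)"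
    show "x [^] n \<in> cent l"
    proof (cases "p \<in> \<rho>")
      case True
      then show ?thesis using l(2) p n by blast
    next
      case False
      then have pm: "\<not> p dvd m" using p m(2) \<pi> unfolding pi_number_def complementary_def by blast
      obtain j where j: "(x [^] n) [^] (p ^ j) = \<one>" using n by (auto simp: pel_def)
      have "(x [^] n) [^] m = \<one>"
        using m(1) xc by (metis mult.commute nat_pow_one nat_pow_pow)
      then have "ord (x [^] n) dvd m" "ord (x [^] n) dvd p ^ j"
        using j xc pow_eq_id by (metis nat_pow_closed)+
      moreover have "coprime m (p ^ j)" using p pm by (rule coprime_prime_power)
      ultimately have "ord (x [^] n) = 1" using coprime_common_divisor_nat by blast
      then have "x [^] n = \<one>" using xc ord_eq_1 by simp
      then show ?thesis using l(1) by (simp add: cent_def)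
    qed
  qed
  show ?thesis
  proof (rule minimal_normal_cases[OF L])
    assume centre: "\<And>z. z \<in> L \<Longrightarrow> L \<subseteq> cent z \<Longrightarrow> z = \<one>"
    \<comment> \<open>If \<open>L\<close> is centreless with \<open>\<sigma>\<close>-class sizes
      only, its \<open>s\<close>-elements with \<open>s \<in> \<tau>\<close> are central in
      \<open>L\<close>, hence trivial.\<close>
    have trivial: "l = \<one>"
      if "complementary \<sigma> \<tau>" "\<And>l. l \<in> L \<Longrightarrow> pi_number \<sigma> (class_size G l)"
        "is_prime s" "s \<in> \<tau>" "l \<in> L" "pel s l" for \<sigma> \<tau> s l
      using centre p_elements_of_center[OF that(3) nL _ that(5,6)] pi_number_not_dvd[OF that(1) that(2) that(3,4)] that(5)
      by blast
    \<comment> \<open>Once \<open>x\<close> and \<open>h\<close> both centralise \<open>L\<close>,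
      the commutator \<open>[h, x]\<close> lies in its trivial centre. If \<open>L\<close> has only
      \<open>\<pi>\<close>-class sizes, its elements commute with all
      \<open>\<rho>\<close>-elements; if only \<open>\<rho>\<close>-class sizes, coprimality to the
      classes of \<open>x\<close> and \<open>h\<close> suffices.\<close>
    have "l \<in> cent x \<and> l \<in> cent h"
      if l: "l \<in> L" and h: "h \<in> R" "pi_number \<pi> (class_size G h)" for l h
    proof -
      have lc: "l \<in> carrier G" using l by (rule Lc)
      have hc: "h \<in> carrier G" using h(1) by (rule Rc)
      have good': "\<And>r. r \<in> L \<Longrightarrow> pi_number \<pi> (class_size G r) \<or> pi_number \<rho> (class_size G r)"
        using good by blast
      show ?thesis
      proof (cases "\<forall>l\<in>L. pi_number \<pi> (class_size G l)")
        case True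
        have sl: "s' \<in> cent l" if s: "is_prime s" "s \<in> \<rho>" "pel s s'" for s s'
        proof (rule cent_sym[OF pel_carrier[OF s(3)]])
          have sc: "s' \<in> carrier G" using s(3) by (rule pel_carrier)
          show "l \<in> cent s'"
          proof (rule mem_subgroup_if_primary_parts[OF cent_subgroup[OF sc] lc])
            fix n :: nat and p assume p: "is_prime p" and n: "pel p (l [^] n)"
            have ln: "l [^] n \<in> L" using subgroup_pow[OF sL l] .
            show "l [^] n \<in> cent s'"
            proof (cases "p \<in> \<pi>")
              case True
              then show ?thesis
                using commute[OF p True n _ s] \<open>\<forall>l\<in>L. _\<close> ln cent_sym Lc by blast
            next
              case False
              then have "p \<in> \<rho>" using \<pi> p by (auto simp: complementary_def)
              then have "l [^] n = \<one>" using trivial[OF \<pi> _ p _ ln n] True by blast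
              then show ?thesis using sc by (simp add: cent_def)
            qed
          qed
        qed
        then have "x \<in> cent l" using xl lc by blast
        moreover have "h \<in> cent l" using sl q R(3) h by blast
        ultimately show ?thesis using cent_sym[OF lc] by blast
      next
        case False
        then have all: "\<forall>l\<in>L. pi_number \<rho> (class_size G l)"
          using nonabelian_minimal_normal[OF \<pi> L centre good'] by blast
        have "l \<in> cent y" if y: "y \<in> carrier G" "pi_number \<pi> (class_size G y)" for y
        proof (rule mem_subgroup_if_primary_parts[OF cent_subgroup[OF y(1)] lc])
          fix n :: nat and p assume p: "is_prime p" and n: "pel p (l [^] n)"
          have ln: "l [^] n \<in> L" using subgroup_pow[OF sL l] .
          show "l [^] n \<in> cent y"
          proof (cases "p \<in> \<rho>")
            case True
            then show ?thesis using coprime_classes_commute[OF \<rho>\<pi> p True n _ y] all ln by blast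
          next
            case False
            then have "p \<in> \<pi>" using \<pi> p by (auto simp: complementary_def)
            then have "l [^] n = \<one>" using trivial[OF \<rho>\<pi> _ p _ ln n] all by blast
            then show ?thesis using y by (simp add: cent_def)
          qed
        qed
        then show ?thesis using xc x(2) hc h(2) by blast
      qed
    qed
    note Lxh = this
    show ?thesis
    proof (rule key')
      fix h assume h: "h \<in> R" "pi_number \<pi> (class_size G h)"
      have hc: "h \<in> carrier G" using h(1) by (rule Rc)
      have "cj h x \<otimes> inv x \<in> cent l" if l: "l \<in> L" for l
      proof -
        have s: "subgroup (cent l) G" using Lc[OF l] by (rule cent_subgroup)
        have "h \<in> cent l" "x \<in> cent l" using Lxh[OF l h] cent_sym xc hc by blast+
        then show ?thesis unfolding cj_def
          using s by (simp add: subgroup.m_closed subgroup.m_inv_closed)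
      qed
      then have "L \<subseteq> cent (cj h x \<otimes> inv x)" using cent_sym Lc by blast
      then have "cj h x \<otimes> inv x = \<one>" using centre d[OF h(1)] by blast
      then show "h \<in> cent x" using commute_if_commutator_trivial hc xc by blast
    qed
  next
    assume ab: "\<And>a. a \<in> L \<Longrightarrow> L \<subseteq> cent a"
    obtain p where p: "is_prime p" and Lp: "\<And>l. l \<in> L \<Longrightarrow> pel p l"
      using abelian_minimal_normal[OF L ab] by blast
    show ?thesis
    proof (cases "p \<in> \<rho>")
      case True
      \<comment> \<open>Here \<open>L\<close> is a normal \<open>\<rho>\<close>-group. An
        \<open>h\<close> of \<open>\<pi>\<close>-class size therefore centralises it, which is what
        the commutator homomorphism into \<open>L\<close> requires.\<close>
      obtain k where "card L = p ^ k" using p_subgroup_card[OF p sL Lp] by blast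
      then have cL: "pi_number \<rho> (card L)" using pi_number_prime_power[OF p True] by simp
      show ?thesis
      proof (rule key')
        fix h assume h: "h \<in> R" "pi_number \<pi> (class_size G h)"
        have hc: "h \<in> carrier G" using h(1) by (rule Rc)
        have "L \<subseteq> cent h" using normal_pi_centralised[OF \<rho>\<pi> nL cL hc h(2)] .
        then have "\<And>l. l \<in> L \<Longrightarrow> h \<in> cent l" using cent_sym[OF hc] by blast
        then show "h \<in> cent x"
          using commutes_if_commutator_in_central[OF p nL ab Lp xc pi_number_not_dvd[OF \<pi> x(2) p True] hc _ d[OF h(1)]]
          by blast
      qed
    next
      case False
      then have p\<pi>: "p \<in> \<pi>" using \<pi> p by (auto simp: complementary_def)
      have pq: "p \<noteq> q" using False q(2) by blast
      define W where "W = {l \<in> carrier G. \<forall>s h. is_prime s \<and> s \<in> \<rho> \<and> pel s h \<longrightarrow> l \<in> cent h}"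
      have "W \<lhd> G" unfolding W_def by (rule rho_centralised_normal)
      then have "W \<inter> L \<lhd> G" using nL normal_subgroup_intersect by blast
      then have "W \<inter> L = {\<one>} \<or> W \<inter> L = L" using L by (simp add: minimal_normal_def)
      then show ?thesis
      proof
        assume "W \<inter> L = L"
        then have LW: "L \<subseteq> W" by blast
        show ?thesis
        proof (rule key)
          fix h assume h: "h \<in> R"
          \<comment> \<open>The commutator is a \<open>p\<close>-element fixed by the
            \<open>q\<close>-element \<open>h\<close>, and \<open>p \<noteq> q\<close>.\<close>
          have "cj h x \<otimes> inv x \<in> cent h" using LW d[OF h] R(3)[OF h] q by (auto simp: W_def)
          then have "h \<in> cent (cj h x \<otimes> inv x)" using cent_sym[OF Rc[OF h]] by blast
          then show "h \<in> cent x"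
            using commute_if_coprime_commutator[OF q(1) R(3)[OF h] p pq xc Lp[OF d[OF h]]] by blast
        qed
      next
        assume WL: "W \<inter> L = {\<one>}"
        show ?thesis
        proof (cases "class_size G x = 1")
          case True
          then have "cent x = carrier G" using class_size_1_iff[OF xc] by simp
          then show ?thesis using key Rc by blast
        next
          case False
          define L0 where "L0 = L \<inter> A"
          have sL0: "subgroup L0 G" unfolding L0_def using sL A by (rule inter_subgroup)
          have L0c: "l \<in> carrier G" if "l \<in> L0" for l using sL0 that by (rule subgroup.mem_carrier)
          have fixed: "l = \<one>" if l: "l \<in> L0" "l \<in> cent x" for l
          proof (rule ccontr)
            assume ne: "l \<noteq> \<one>"
            have lc: "l \<in> carrier G" using l(1) by (rule L0c)
            have lL: "l \<in> L" "l \<in> A" using l by (simp_all add: L0_def)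
            have n\<pi>: "\<not> pi_number \<pi> (class_size G l)"
            proof
              assume "pi_number \<pi> (class_size G l)"
              then have "h \<in> cent l" if "is_prime s" "s \<in> \<rho>" "pel s h" for s h
                using commute[OF p p\<pi> Lp[OF lL(1)] _ that] by blast
              then have "l \<in> cent h" if "is_prime s" "s \<in> \<rho>" "pel s h" for s h
                using cent_sym[OF lc] that by blast
              then have "l \<in> W" using lc unfolding W_def by blast
              then show False using WL lL ne by blast
            qed
            then have l\<rho>: "pi_number \<rho> (class_size G l)" using good lL by blast
            obtain j where j: "l [^] (p ^ j) = \<one>" using Lp[OF lL(1)] by (auto simp: pel_def)
            have "\<not> p dvd m" using pi_number_not_dvd[OF \<rho>\<pi> m(2) p p\<pi>] .
            with p have co: "coprime m (p ^ j)" by (rule coprime_prime_power)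
            have comm: "x \<otimes> l = l \<otimes> x" using l(2) by (simp add: cent_def)
            have xlA: "x \<otimes> l \<in> A" using A x(1) lL by (simp add: subgroup.m_closed)
            \<comment> \<open>\<open>x\<close> and \<open>l\<close> are commuting elements of
              coprime orders, so both are powers of \<open>x l\<close>. Its class size is divisible
              by a non-trivial \<open>\<pi>\<close>-number and by a number that is no
              \<open>\<pi>\<close>-number.\<close>
            have dx: "class_size G x dvd class_size G (x \<otimes> l)"
              and dl: "class_size G l dvd class_size G (x \<otimes> l)"
              using class_size_dvd_cent cent_mult_coprime[OF comm xc lc m(1) j co] xc lc by simp_all
            have "pi_number \<pi> (class_size G (x \<otimes> l)) \<or> pi_number \<rho> (class_size G (x \<otimes> l))"
              using good xlA by blast
            then show False
            proof
              assume "pi_number \<pi> (class_size G (x \<otimes> l))"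
              then show False using n\<pi> pi_number_dvd[OF _ dl] by blast
            next
              assume "pi_number \<rho> (class_size G (x \<otimes> l))"
              then have "pi_number \<rho> (class_size G x)" using pi_number_dvd[OF _ dx] by blast
              then have "coprime (class_size G x) (class_size G x)"
                using pi_number_coprime[OF \<pi> x(2)] by blast
              then show False using False by simp
            qed
          qed
          define U where "U = (\<lambda>l. l \<otimes> x) ` L0"
          have cardU: "card U = card L0"
            unfolding U_def using L0c xc by (intro card_image inj_onI) simp
          have sub: "orb L0 x \<subseteq> U"
          proof
            fix y assume "y \<in> orb L0 x"
            then obtain l where l: "l \<in> L0" "y = cj l x" by (auto simp: orb_def)
            have il: "inv l \<in> L0" using l sL0 by (simp add: subgroup.m_inv_closed)
            have "cj x (inv l) \<in> L" using normal_cj[OF nL xc] il by (simp add: L0_def)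
            moreover have "cj x (inv l) \<in> A"
              using il x(1) A by (simp add: L0_def cj_def subgroup.m_closed subgroup.m_inv_closed)
            ultimately have "l \<otimes> cj x (inv l) \<in> L0"
              using l(1) by (simp add: L0_def subgroup.m_closed[OF sL] subgroup.m_closed[OF A])
            moreover have "y = (l \<otimes> cj x (inv l)) \<otimes> x"
              using l L0c[OF l(1)] xc by (simp add: cj_def m_assoc)
            ultimately show "y \<in> U" by (auto simp: U_def)
          qed
          have "L0 \<inter> cent x = {\<one>}"
            using fixed subgroup.one_closed[OF sL0] subgroup.one_closed[OF cent_subgroup[OF xc]] by blast
          then have "card (orb L0 x) = card U" using card_orb[OF sL0 xc] cardU by simp
          then have UO: "orb L0 x = U"
            using sub finite_subgroup[OF sL0] by (intro card_subset_eq) (simp_all add: U_def)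
          obtain k where k: "card L0 = p ^ k"
            using p_subgroup_card[OF p sL0] Lp by (auto simp: L0_def)
          obtain e where e: "card R = q ^ e" using p_subgroup_card[OF q(1) R(1,3)] by blast
          have "\<exists>s\<in>U. R \<subseteq> cent s"
          proof (rule p_subgroup_fixed_point[OF q(1) R(1) e])
            show "U \<subseteq> carrier G" using L0c xc by (auto simp: U_def)
            show "\<not> q dvd card U"
              using cardU k pq p q(1) by (metis prime_dvd_power primes_dvd_imp_eq)
            fix h s assume h: "h \<in> R" and "s \<in> U"
            then obtain l where l: "l \<in> L0" "s = l \<otimes> x" by (auto simp: U_def)
            have hc: "h \<in> carrier G" using h by (rule Rc)
            have lc: "l \<in> carrier G" using l(1) by (rule L0c)
            have hA: "h \<in> A" using h R(2) by blast
            have 1: "cj h x \<otimes> inv x \<in> L0"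
              using d[OF h] hA x(1) A by (simp add: L0_def cj_def subgroup.m_closed subgroup.m_inv_closed)
            have 2: "cj h l \<in> L0"
              using normal_cj[OF nL hc] hA l A by (simp add: L0_def cj_def subgroup.m_closed subgroup.m_inv_closed)
            have "cj h s = cj h l \<otimes> (cj h x \<otimes> inv x) \<otimes> x"
              using l hc lc xc by (simp add: cj_hom m_assoc)
            then show "cj h s \<in> U" using subgroup.m_closed[OF sL0 2 1] by (auto simp: U_def)
          qed
          then obtain l where l: "l \<in> L0" "R \<subseteq> cent (cj l x)" unfolding UO[symmetric] orb_def by blast
          have lc: "l \<in> carrier G" using l(1) by (rule L0c)
          \<comment> \<open>The fixed point is the conjugate of \<open>x\<close> by
            \<open>l \<in> L \<inter> A\<close>; moving back by \<open>inv l\<close> keeps the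
            conjugating element inside \<open>A\<close>.\<close>
          have "cj (inv l) h \<in> cent x" if "h \<in> R" for h
            using cent_cj[of "inv l" "cj l x" h] l(2) lc xc that by auto
          moreover have "inv l \<in> A" using l A by (simp add: L0_def subgroup.m_inv_closed)
          ultimately show ?thesis by blast
        qed
      qed
    qed
  qed
qed

end

section \<open>Induction along a chief series\<close>

definition minimal_series :: "('a, 'b) monoid_scheme \<Rightarrow> (nat \<Rightarrow> 'a set) \<Rightarrow> nat \<Rightarrow> bool" where
  "minimal_series G S n \<longleftrightarrow>
     (\<forall>i<n. \<forall>N. N \<lhd> G \<longrightarrow> S i \<subseteq> N \<longrightarrow> N \<subseteq> S (Suc i) \<longrightarrow> N = S i \<or> N = S (Suc i))"

lemma covering_series_mono:
  assumes "covering_series G A B S n" "i \<le> j" "j \<le> n"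
  shows "S i \<subseteq> S j"
  using assms(2,3)
proof (induction j rule: dec_induct)
  case (step k)
  then have "S k \<subseteq> S (Suc k)" using assms(1) by (simp add: covering_series_def)
  then show ?case using step by simp
qed simp

text \<open>A normal subgroup between two images is replaced by its full preimage, which lies
  between the original terms because they contain the kernel \<open>S (Suc 0)\<close>.\<close>

lemma (in quotient_map) minimal_series_image:
  assumes ser: "covering_series G A B S (Suc n)" and min: "minimal_series G S (Suc n)"
    and ker: "\<forall>x\<in>carrier G. \<phi> x = \<one>\<^bsub>H\<^esub> \<longleftrightarrow> x \<in> S (Suc 0)"
  shows "minimal_series H (\<lambda>i. \<phi> ` S (Suc i)) n"
  unfolding minimal_series_def
proof (intro allI impI)
  fix i N assume i: "i < n" and N: "N \<lhd> H" "\<phi> ` S (Suc i) \<subseteq> N" "N \<subseteq> \<phi> ` S (Suc (Suc i))"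
  let ?P = "{x \<in> carrier G. \<phi> x \<in> N}"
  have nS: "S j \<lhd> G" if "j \<le> Suc n" for j using ser that by (simp add: covering_series_def)
  have Sc: "S j \<subseteq> carrier G" if "j \<le> Suc n" for j
    using subgroup.subset[OF normal_imp_subgroup[OF nS[OF that]]] .
  have "?P \<lhd> G" using N(1) by (rule vimage_normal)
  moreover have "S (Suc i) \<subseteq> ?P" using N(2) Sc[of "Suc i"] i by auto
  moreover have "?P \<subseteq> S (Suc (Suc i))"
  proof
    fix x assume x: "x \<in> ?P"
    then obtain s where s: "s \<in> S (Suc (Suc i))" "\<phi> x = \<phi> s" using N(3) by blast
    have sc: "s \<in> carrier G" using s Sc[of "Suc (Suc i)"] i by auto
    obtain l where l: "l \<in> S (Suc 0)" "x = s \<otimes> l"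
      using G.eq_mod_normal[OF quotient_map_axioms ker _ sc s(2)] x by blast
    have "l \<in> S (Suc (Suc i))" using covering_series_mono[OF ser, of "Suc 0" "Suc (Suc i)"] l i by auto
    then show "x \<in> S (Suc (Suc i))"
      using s l subgroup.m_closed[OF normal_imp_subgroup[OF nS]] i by simp
  qed
  ultimately have "?P = S (Suc i) \<or> ?P = S (Suc (Suc i))"
    using min i unfolding minimal_series_def by simp
  moreover have "\<phi> ` ?P = N"
  proof
    show "N \<subseteq> \<phi> ` ?P"
    proof
      fix y assume y: "y \<in> N"
      then have "y \<in> carrier H" using N(1) normal_imp_subgroup subgroup.mem_carrier by metis
      then show "y \<in> \<phi> ` ?P" using lift y by blast
    qed
  qed blast
  ultimately show "N = \<phi> ` S (Suc i) \<or> N = \<phi> ` S (Suc (Suc i))" by blast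
qed

text \<open>This replaces the missing divisibility between class sizes in \<open>A\<close> and in
  \<open>G\<close>. It concerns a \<open>\<rho>\<close>-element \<open>x\<close>, and the
  conjugating element is found within \<open>A\<close> by composing one element per factor of the
  series.\<close>

lemma centralised_conjugate:
  assumes "finite_group G" "subgroup A G" "subgroup B G" "A <#>\<^bsub>G\<^esub> B = carrier G"
    and "covering_series G A B S n" "minimal_series G S n"
    and "complementary \<pi> \<rho>" "is_prime q" "q \<in> \<rho>"
    and "\<And>r. r \<in> A \<union> B \<Longrightarrow> pi_number \<pi> (class_size G r) \<or> pi_number \<rho> (class_size G r)"
    and "x \<in> A" "pi_number \<pi> (class_size G x)"
    and "x [^]\<^bsub>G\<^esub> (m::nat) = \<one>\<^bsub>G\<^esub>" "pi_number \<rho> m"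
    and "subgroup R G" "R \<subseteq> A" "\<And>h. h \<in> R \<Longrightarrow> finite_group.pel G q h"
  shows "\<exists>a\<in>A. \<forall>h\<in>R. finite_group.cj G a h \<in> finite_group.cent G x"
  using assms
proof (induction n arbitrary: G A B S x R)
  case 0
  interpret finite_group G by (rule 0(1))
  have c1: "carrier G = {\<one>\<^bsub>G\<^esub>}" using 0(5) unfolding covering_series_def by argo
  have "y = \<one>\<^bsub>G\<^esub>" if "y \<in> A" for y using c1 subgroup.mem_carrier[OF 0(2) that] by blast
  then have h1: "\<And>h. h \<in> R \<Longrightarrow> h = \<one>\<^bsub>G\<^esub>" using 0(16) by blast
  have xc: "x \<in> carrier G" using subgroup.mem_carrier[OF 0(2,11)] .
  have "cj x h \<in> cent x" if "h \<in> R" for h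
    using h1[OF that] xc by (simp add: cent_def)
  then show ?case using 0(11) by blast
next
  case (Suc n)
  interpret finite_group G by (rule Suc(2))
  note A = Suc(3) and B = Suc(4) and AB = Suc(5) and ser = Suc(6) and min = Suc(7)
    and \<pi> = Suc(8) and q = Suc(9,10) and good = Suc(11) and x = Suc(12,13) and m = Suc(14,15)
    and R = Suc(16,17,18)
  define L where "L = S (Suc 0)"
  have L: "L \<lhd> G" using ser by (simp add: L_def covering_series_def)
  then have sL: "subgroup L G" by (rule normal_imp_subgroup)
  have mL: "minimal_normal L"
    unfolding minimal_normal_def
  proof (intro conjI allI impI L)
    fix N assume N: "N \<lhd> G" "N \<subseteq> L"
    have S0: "S 0 = {\<one>\<^bsub>G\<^esub>}" using ser by (simp add: covering_series_def)
    then have "S 0 \<subseteq> N" using subgroup.one_closed[OF normal_imp_subgroup[OF N(1)]] by simp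
    then show "N = {\<one>\<^bsub>G\<^esub>} \<or> N = L"
      using min N S0 unfolding minimal_series_def L_def by (metis zero_less_Suc)
  qed
  obtain H \<phi> where Q: "quotient_map G (H :: ('a, 'b) monoid_scheme) \<phi>"
    and ker: "\<forall>x\<in>carrier G. \<phi> x = \<one>\<^bsub>H\<^esub> \<longleftrightarrow> x \<in> L"
    using quotient_exists[OF L] by blast
  interpret Q: quotient_map G H \<phi> by (rule Q)
  have Ac: "A \<subseteq> carrier G" and Bc: "B \<subseteq> carrier G" using A B by (simp_all add: subgroup.subset)
  have xc: "x \<in> carrier G" using x(1) Ac by blast
  have "\<phi> ` S (Suc 0) = {\<one>\<^bsub>H\<^esub>}"
    using ker subgroup.mem_carrier[OF sL] subgroup.one_closed[OF sL] unfolding L_def by force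
  then have ser': "covering_series H (\<phi> ` A) (\<phi> ` B) (\<lambda>i. \<phi> ` S (Suc i)) n"
    using covering_series_Suc[OF Q.covering_series_image[OF ser]] by simp
  have "\<exists>a\<in>\<phi> ` A. \<forall>h\<in>\<phi> ` R. Q.H.cj a h \<in> Q.H.cent (\<phi> x)"
  proof (rule Suc.IH[OF Q.H.finite_group_axioms _ _ _ ser' _ \<pi> q])
    show "subgroup (\<phi> ` A) H" "subgroup (\<phi> ` B) H" "subgroup (\<phi> ` R) H"
      using A B R(1) by (simp_all add: Q.hom_subgroup)
    show "\<phi> ` A <#>\<^bsub>H\<^esub> \<phi> ` B = carrier H" using Ac Bc AB by (rule Q.set_mult_image)
    show "minimal_series H (\<lambda>i. \<phi> ` S (Suc i)) n"
      using Q.minimal_series_image[OF ser min] ker by (simp add: L_def)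
    show "pi_number \<pi> (class_size H r) \<or> pi_number \<rho> (class_size H r)" if r: "r \<in> \<phi> ` A \<union> \<phi> ` B" for r
    proof -
      obtain y where y: "y \<in> A \<union> B" "r = \<phi> y" using r by blast
      then have "class_size H r dvd class_size G y" using Q.class_size_hom_dvd Ac Bc by blast
      then show ?thesis using good[OF y(1)] pi_number_dvd by blast
    qed
    show "\<phi> x \<in> \<phi> ` A" using x by simp
    show "pi_number \<pi> (class_size H (\<phi> x))"
      using Q.class_size_hom_dvd[OF xc] x(2) pi_number_dvd by blast
    show "\<phi> x [^]\<^bsub>H\<^esub> m = \<one>\<^bsub>H\<^esub>" using m(1) xc by (metis Q.hom_nat_pow Q.hom_one)
    show "pi_number \<rho> m" by (rule m(2))
    show "\<phi> ` R \<subseteq> \<phi> ` A" using R(2) by blast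
    show "Q.H.pel q h" if "h \<in> \<phi> ` R" for h using that R(3) Q.hom_pel by blast
  qed
  then obtain a where a: "a \<in> A" "\<And>h. h \<in> R \<Longrightarrow> Q.H.cj (\<phi> a) (\<phi> h) \<in> Q.H.cent (\<phi> x)" by blast
  have ac: "a \<in> carrier G" using a Ac by blast
  have Rc: "h \<in> carrier G" if "h \<in> R" for h using R(2) Ac that by blast
  \<comment> \<open>Modulo \<open>L\<close> the conjugate \<open>R'\<close> centralises
    \<open>x\<close>, so its commutators with \<open>x\<close> lie in \<open>L\<close>, as the
    single step demands.\<close>
  define R' where "R' = cj a ` R"
  have sR': "subgroup R' G"
    unfolding R'_def using conjugate_subgroup[OF R(1) ac] .
  have step: "\<exists>b\<in>A. \<forall>h\<in>R'. cj b h \<in> cent x"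
  proof (rule centralised_conjugate_step[OF \<pi> q A mL _ _ x m sR'])
    show "pi_number \<pi> (class_size G r) \<or> pi_number \<rho> (class_size G r)" if "r \<in> A \<union> L" for r
      using that good first_factor_covered[OF ser] unfolding L_def by blast
    show "h \<in> cent y" if "is_prime p" "p \<in> \<pi>" "pel p y" "pi_number \<pi> (class_size G y)"
      "is_prime s" "s \<in> \<rho>" "pel s h" for p y s h
      using pi_class_commutes_rho_elements[OF \<pi> A B AB ser good that] .
    show "R' \<subseteq> A"
      using R(2) a(1) A by (auto simp: R'_def cj_def subgroup.m_closed subgroup.m_inv_closed)
    show "pel q h" if "h \<in> R'" for h using that R(3) pel_cj ac by (auto simp: R'_def)
    fix k assume "k \<in> R'"
    then obtain h where h: "h \<in> R" "k = cj a h" by (auto simp: R'_def)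
    have kc: "k \<in> carrier G" using h ac Rc by simp
    have "\<phi> k \<in> Q.H.cent (\<phi> x)" using a(2)[OF h(1)] h ac Rc by (simp add: Q.hom_cj)
    then have "Q.H.cj (\<phi> k) (\<phi> x) = \<phi> x" using xc by (simp add: Q.H.mem_cent)
    then have "\<phi> (cj k x) = \<phi> x" using kc xc by (simp add: Q.hom_cj)
    then have "\<phi> (cj k x \<otimes>\<^bsub>G\<^esub> inv\<^bsub>G\<^esub> x) = \<one>\<^bsub>H\<^esub>" using kc xc by simp
    then show "cj k x \<otimes>\<^bsub>G\<^esub> inv\<^bsub>G\<^esub> x \<in> L" using ker kc xc by (metis cj_closed inv_closed m_closed)
  qed
  then obtain b where b: "b \<in> A" "\<And>h. h \<in> R \<Longrightarrow> cj b (cj a h) \<in> cent x" by (auto simp: R'_def)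
  have "cj (b \<otimes>\<^bsub>G\<^esub> a) h \<in> cent x" if "h \<in> R" for h
    using b ac Rc[OF that] Ac that by (auto simp: cj_mult)
  moreover have "b \<otimes>\<^bsub>G\<^esub> a \<in> A" using a b A by (simp add: subgroup.m_closed)
  ultimately show ?case by blast
qed

context finite_group
begin

text \<open>Only the \<open>\<rho>\<close>-part \<open>y\<close> of \<open>x\<close> needs the
  induction: the parts of \<open>x\<close> at primes of \<open>\<pi>\<close> commute with all
  \<open>\<rho>\<close>-elements of prime power order. So a conjugate of any
  \<open>q\<close>-subgroup of \<open>A\<close> lies in \<open>A \<inter> cent x\<close>.\<close>

lemma class_size_in_factor:
  assumes \<pi>: "complementary \<pi> \<rho>"
    and A: "subgroup A G" and B: "subgroup B G" and AB: "A <#> B = carrier G"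
    and ser: "covering_series G A B S n" and min: "minimal_series G S n"
    and good: "\<And>r. r \<in> A \<union> B \<Longrightarrow> pi_number \<pi> (class_size G r) \<or> pi_number \<rho> (class_size G r)"
    and x: "x \<in> A" "pi_number \<pi> (class_size G x)"
  shows "pi_number \<pi> (class_size (G\<lparr>carrier := A\<rparr>) x)"
proof (rule pi_numberI[OF \<pi>])
  fix q assume q: "is_prime q" "q \<in> \<rho>"
  have xc: "x \<in> carrier G" using subgroup.mem_carrier[OF A x(1)] .
  note commute = pi_class_commutes_rho_elements[OF \<pi> A B AB ser]
  have "0 < ord x" using ord_ge_1[OF finite_carrier xc] by simp
  then obtain a b where ab: "ord x = a * b" "pi_number \<pi> a" "pi_number \<rho> b"
    using pi_factorisation[OF \<pi>] by blast
  \<comment> \<open>With \<open>ord x = a b\<close>, this power is killed by the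
    \<open>\<rho>\<close>-number \<open>b\<close>; it generates the \<open>\<rho>\<close>-part of
    \<open>x\<close>.\<close>
  define y where "y = x [^] a"
  have yc: "y \<in> carrier G" using xc by (simp add: y_def)
  have yA: "y \<in> A" using subgroup_pow[OF A x(1)] by (simp add: y_def)
  have y\<pi>: "pi_number \<pi> (class_size G y)"
    using class_size_pow_dvd[OF xc] x(2) pi_number_dvd unfolding y_def by blast
  have yb: "y [^] b = \<one>" using xc ab(1) pow_ord_eq_1[OF xc] by (simp add: y_def nat_pow_pow)
  have yx: "h \<in> cent x" if h: "pel q h" "h \<in> cent y" for h
  proof (rule cent_sym)
    show hc: "h \<in> carrier G" using h(1) by (rule pel_carrier)
    show "x \<in> cent h"
    proof (rule mem_subgroup_if_primary_parts[OF cent_subgroup[OF hc] xc])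
      fix k :: nat and p assume p: "is_prime p" and k: "pel p (x [^] k)"
      show "x [^] k \<in> cent h"
      proof (cases "p \<in> \<pi>")
        case True
        have "pi_number \<pi> (class_size G (x [^] k))"
          using class_size_pow_dvd[OF xc] x(2) pi_number_dvd by blast
        then have "h \<in> cent (x [^] k)" using commute[OF _ p True k _ q h(1)] good by blast
        then show ?thesis by (rule cent_sym[OF nat_pow_closed[OF xc]])
      next
        case False
        obtain j where "(x [^] k) [^] (p ^ j) = \<one>" using k by (auto simp: pel_def)
        \<comment> \<open>Since \<open>a\<close> is prime to \<open>p\<close>, it divides
          \<open>k\<close>; so this primary part of \<open>x\<close> is a power of
          \<open>y\<close>.\<close>
        then have "ord x dvd k * p ^ j" using xc pow_eq_id by (simp add: nat_pow_pow)
        then have "a dvd k * p ^ j" using ab(1) by (metis dvd_mult_left)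
        moreover have "\<not> p dvd a" using p False ab(2) by (auto simp: pi_number_def)
        with p have "coprime a (p ^ j)" by (rule coprime_prime_power)
        ultimately have "a dvd k" by (simp add: coprime_dvd_mult_left_iff)
        then obtain i where "k = a * i" by blast
        then have "x [^] k = y [^] i" using xc by (simp add: y_def nat_pow_pow)
        moreover have "y [^] i \<in> cent h"
          using subgroup_pow[OF cent_subgroup[OF hc]] cent_sym[OF yc h(2)] by blast
        ultimately show ?thesis by simp
      qed
    qed
  qed
  have sI: "subgroup (A \<inter> cent x) G" using A cent_subgroup[OF xc] by (rule inter_subgroup)
  have "\<not> q dvd card (orb A x)"
  proof (rule not_dvd_index[OF q(1) sI A])
    show "A \<inter> cent x \<subseteq> A" by simp
    show "card A = card (orb A x) * card (A \<inter> cent x)" using card_orb[OF A xc] by simp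
    fix R k assume R: "subgroup R G" "R \<subseteq> A" "card R = q ^ k"
    have Rq: "pel q h" if "h \<in> R" for h using p_subgroup_pel[OF R(1,3) that] .
    obtain a where a: "a \<in> A" "\<And>h. h \<in> R \<Longrightarrow> cj a h \<in> cent y"
      using centralised_conjugate[OF finite_group_axioms A B AB ser min \<pi> q good yA y\<pi> yb ab(3) R(1,2) Rq]
      by blast
    have ac: "a \<in> carrier G" using subgroup.mem_carrier[OF A a(1)] .
    have "cj a h \<in> A \<inter> cent x" if "h \<in> R" for h
    proof
      show "cj a h \<in> A" using that R(2) a(1) A
        by (auto simp: cj_def subgroup.m_closed subgroup.m_inv_closed)
      show "cj a h \<in> cent x" using yx[OF pel_cj[OF ac Rq[OF that]] a(2)[OF that]] .
    qed
    then show "\<exists>g\<in>carrier G. cj g ` R \<subseteq> A \<inter> cent x" using ac by blast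
  qed
  then show "\<not> q dvd class_size (G\<lparr>carrier := A\<rparr>) x"
    using subgroup_group_facts(2)[OF finite_group_axioms A x(1)] by simp
qed

section \<open>The structure of class-separable groups\<close>

definition cntr :: "'a set" where
  "cntr = {z \<in> carrier G. cent z = carrier G}"

lemma cntr_carrier: "z \<in> cntr \<Longrightarrow> z \<in> carrier G"
  by (simp add: cntr_def)

lemma cntr_iff: "z \<in> cntr \<longleftrightarrow> z \<in> carrier G \<and> (\<forall>g\<in>carrier G. cj g z = z)"
  unfolding cntr_def using cent_carrier mem_cent by blast

lemma cntr_subgroup: "subgroup cntr G"
proof (rule subgroupI)
  show "cntr \<subseteq> carrier G" using cntr_carrier by blast
  have "\<one> \<in> cntr" by (simp add: cntr_iff)
  then show "cntr \<noteq> {}" by blast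
  show "inv a \<in> cntr" if "a \<in> cntr" for a using that by (auto simp: cntr_iff cj_inv)
  show "a \<otimes> b \<in> cntr" if "a \<in> cntr" "b \<in> cntr" for a b
    using that by (auto simp: cntr_iff cj_hom)
qed

lemma cntr_normal: "cntr \<lhd> G"
  by (rule normalI_cj[OF cntr_subgroup]) (simp add: cntr_iff)

lemma cntr_cj: "z \<in> cntr \<Longrightarrow> g \<in> carrier G \<Longrightarrow> cj z g = g"
  by (metis cntr_iff cent_sym mem_cent)

lemma group_center_eq: "group_center G = cntr"
  by (auto simp: group_center_def cntr_iff cj_fix_iff)

section \<open>Transfer and central direct factors\<close>

lemma cauchy:
  assumes p: "is_prime p" and N: "subgroup N G" "p dvd card N"
  shows "\<exists>x\<in>N. pel p x \<and> x \<noteq> \<one>"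
proof (rule ccontr)
  assume c: "\<not> ?thesis"
  obtain P a m where P: "subgroup P G" "P \<subseteq> N" "card P = p ^ a" "card N = p ^ a * m" "\<not> p dvd m"
    using sylow_ex[OF p N(1)] by blast
  have "P = {\<one>}"
    using c P(2) p_subgroup_pel[OF P(1,3)] subgroup.one_closed[OF P(1)] by blast
  then have "card N = m" using P(3,4) by simp
  then show False using P(5) N(2) by simp
qed

text \<open>The transfer \<open>V\<close> into \<open>N\<close> maps \<open>g \<in> N\<close> to the product of its conjugates over a transversal, which is
  central in \<open>G\<close>. Hence \<open>V \<circ> V\<close> takes central values and restricts to a power map on \<open>N \<inter> Z(G)\<close>.\<close>

lemma transfer:
  assumes N: "N \<lhd> G" and ab: "\<And>a b. a \<in> N \<Longrightarrow> b \<in> N \<Longrightarrow> a \<otimes> b = b \<otimes> a"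
    and n: "card (carrier G) = n * card N"
  shows "\<exists>V. (\<forall>g\<in>carrier G. V g \<in> N) \<and> (\<forall>g\<in>carrier G. \<forall>h\<in>carrier G. V (g \<otimes> h) = V g \<otimes> V h) \<and>
    (\<forall>g\<in>N. V g \<in> cntr) \<and> (\<forall>z\<in>N \<inter> cntr. V z = z [^] n)"
proof -
  have sN: "subgroup N G" using N by (rule normal_imp_subgroup)
  note Nc = subgroup.mem_carrier[OF sN]
  obtain H \<phi> where Q: "quotient_map G (H :: ('a, 'b) monoid_scheme) \<phi>"
    and ker: "\<forall>x\<in>carrier G. \<phi> x = \<one>\<^bsub>H\<^esub> \<longleftrightarrow> x \<in> N"
    using quotient_exists[OF N] by blast
  interpret Q: quotient_map G H \<phi> by (rule Q)
  interpret A: comm_group "G\<lparr>carrier := N\<rparr>"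
    by (rule group.group_comm_groupI[OF subgroup_imp_group[OF sN]]) (simp add: ab)
  define s where "s c = (SOME x. x \<in> carrier G \<and> \<phi> x = c)" for c
  have s: "s c \<in> carrier G" "\<phi> (s c) = c" if "c \<in> carrier H" for c
    using someI_ex[of "\<lambda>x. x \<in> carrier G \<and> \<phi> x = c"] Q.lift[OF that] unfolding s_def by blast+
  \<comment> \<open>The \<open>N\<close>-component of \<open>x\<close> relative to the transversal
    \<open>s\<close>.\<close>
  define y where "y x = x \<otimes> inv (s (\<phi> x))" for x
  have y: "y x \<in> N" "x = y x \<otimes> s (\<phi> x)" if x: "x \<in> carrier G" for x
  proof -
    have sc: "s (\<phi> x) \<in> carrier G" and se: "\<phi> (s (\<phi> x)) = \<phi> x" using s[of "\<phi> x"] x by simp_all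
    have "\<phi> (y x) = \<one>\<^bsub>H\<^esub>" using x sc se by (simp add: y_def)
    moreover have "y x \<in> carrier G" using x sc by (simp add: y_def)
    ultimately show "y x \<in> N" using ker by blast
    show "x = y x \<otimes> s (\<phi> x)" using x sc by (simp add: y_def m_assoc)
  qed
  have y_mult: "y (a \<otimes> x) = a \<otimes> y x" if "a \<in> N" "x \<in> carrier G" for a x
  proof -
    have "\<phi> a = \<one>\<^bsub>H\<^esub>" using that ker Nc by blast
    then have "\<phi> (a \<otimes> x) = \<phi> x" using that Nc by simp
    then show ?thesis using that Nc s(1)[of "\<phi> x"] by (simp add: y_def m_assoc)
  qed
  define V where "V g = (\<Otimes>\<^bsub>G\<lparr>carrier := N\<rparr>\<^esub>c\<in>carrier H. y (s c \<otimes> g))" for g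
  have shift_r: "(\<Otimes>\<^bsub>G\<lparr>carrier := N\<rparr>\<^esub>c\<in>carrier H. f c) = (\<Otimes>\<^bsub>G\<lparr>carrier := N\<rparr>\<^esub>c\<in>carrier H. f (c \<otimes>\<^bsub>H\<^esub> b))"
    if "f \<in> carrier H \<rightarrow> N" "b \<in> carrier H" for f b
  proof -
    have im: "(\<lambda>c. c \<otimes>\<^bsub>H\<^esub> b) ` carrier H = carrier H"
    proof
      show "carrier H \<subseteq> (\<lambda>c. c \<otimes>\<^bsub>H\<^esub> b) ` carrier H"
      proof
        fix c assume c: "c \<in> carrier H"
        have "c = (c \<otimes>\<^bsub>H\<^esub> inv\<^bsub>H\<^esub> b) \<otimes>\<^bsub>H\<^esub> b" using c that(2) by (simp add: Q.H.m_assoc)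
        then show "c \<in> (\<lambda>c. c \<otimes>\<^bsub>H\<^esub> b) ` carrier H" using c that(2) by blast
      qed
    qed (use that(2) in auto)
    have "inj_on (\<lambda>c. c \<otimes>\<^bsub>H\<^esub> b) (carrier H)" using that(2) by (rule Q.H.inj_on_multc)
    then show ?thesis
      using A.finprod_reindex[of f "\<lambda>c. c \<otimes>\<^bsub>H\<^esub> b" "carrier H"] that(1) im by simp
  qed
  have shift_l: "(\<Otimes>\<^bsub>G\<lparr>carrier := N\<rparr>\<^esub>c\<in>carrier H. f c) = (\<Otimes>\<^bsub>G\<lparr>carrier := N\<rparr>\<^esub>c\<in>carrier H. f (b \<otimes>\<^bsub>H\<^esub> c))"
    if "f \<in> carrier H \<rightarrow> N" "b \<in> carrier H" for f b
    using A.finprod_reindex[of f "\<lambda>c. b \<otimes>\<^bsub>H\<^esub> c" "carrier H"] that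
      Q.H.inj_on_cmult[OF that(2)] Q.H.surj_const_mult[OF that(2)] by simp
  have yN: "y (s c \<otimes> g) \<in> N" if "c \<in> carrier H" "g \<in> carrier G" for c g
    using y(1) s(1) that by simp
  have VN: "V g \<in> N" if "g \<in> carrier G" for g
    using A.finprod_closed[of "\<lambda>c. y (s c \<otimes> g)" "carrier H"] yN[OF _ that] by (simp add: V_def Pi_def)
  have Vhom: "V (g \<otimes> h) = V g \<otimes> V h" if g: "g \<in> carrier G" and h: "h \<in> carrier G" for g h
  proof -
    \<comment> \<open>A cocycle identity: passing \<open>s c\<close> over \<open>g\<close> leaves
      the representative of \<open>c\<close> times \<open>\<phi> g\<close>. Right translation only
      reindexes the product over \<open>c\<close>, so the second factors multiply to
      \<open>V h\<close>.\<close>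
    have "y (s c \<otimes> (g \<otimes> h)) = y (s c \<otimes> g) \<otimes> y (s (c \<otimes>\<^bsub>H\<^esub> \<phi> g) \<otimes> h)" if c: "c \<in> carrier H" for c
    proof -
      have sc: "s c \<in> carrier G" "\<phi> (s c) = c" using s c by blast+
      have "s c \<otimes> g = y (s c \<otimes> g) \<otimes> s (\<phi> (s c \<otimes> g))" using y(2) sc g by blast
      then have e: "s c \<otimes> g = y (s c \<otimes> g) \<otimes> s (c \<otimes>\<^bsub>H\<^esub> \<phi> g)" using sc g by simp
      have "s c \<otimes> (g \<otimes> h) = (s c \<otimes> g) \<otimes> h" using sc g h by (simp add: m_assoc)
      also have "\<dots> = y (s c \<otimes> g) \<otimes> (s (c \<otimes>\<^bsub>H\<^esub> \<phi> g) \<otimes> h)"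
        using e Nc[OF yN[OF c g]] s(1)[of "c \<otimes>\<^bsub>H\<^esub> \<phi> g"] c g h by (metis Q.H.m_closed Q.hom_closed m_assoc)
      finally show ?thesis
        using y_mult[OF yN[OF c g]] s(1)[of "c \<otimes>\<^bsub>H\<^esub> \<phi> g"] c g h by simp
    qed
    then have "V (g \<otimes> h) = (\<Otimes>\<^bsub>G\<lparr>carrier := N\<rparr>\<^esub>c\<in>carrier H. y (s c \<otimes> g) \<otimes> y (s (c \<otimes>\<^bsub>H\<^esub> \<phi> g) \<otimes> h))"
      unfolding V_def using yN g h subgroup.m_closed[OF sN]
      by (intro A.finprod_cong') (auto simp: Pi_def)
    also have "\<dots> = V g \<otimes> (\<Otimes>\<^bsub>G\<lparr>carrier := N\<rparr>\<^esub>c\<in>carrier H. y (s (c \<otimes>\<^bsub>H\<^esub> \<phi> g) \<otimes> h))"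
      unfolding V_def
      using A.finprod_multf[of "\<lambda>c. y (s c \<otimes> g)" "carrier H" "\<lambda>c. y (s (c \<otimes>\<^bsub>H\<^esub> \<phi> g) \<otimes> h)"] yN g h
      by (simp add: Pi_def)
    also have "(\<Otimes>\<^bsub>G\<lparr>carrier := N\<rparr>\<^esub>c\<in>carrier H. y (s (c \<otimes>\<^bsub>H\<^esub> \<phi> g) \<otimes> h)) = V h"
      unfolding V_def using shift_r[of "\<lambda>c. y (s c \<otimes> h)" "\<phi> g"] yN g h by (simp add: Pi_def)
    finally show ?thesis .
  qed
  have Vcj: "V g = (\<Otimes>\<^bsub>G\<lparr>carrier := N\<rparr>\<^esub>c\<in>carrier H. cj (s c) g)" if g: "g \<in> N" for g
  proof -
    have "y (s c \<otimes> g) = cj (s c) g" if c: "c \<in> carrier H" for c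
    proof -
      have "\<phi> g = \<one>\<^bsub>H\<^esub>" using g ker Nc by blast
      then have "\<phi> (s c \<otimes> g) = c" using s[OF c] Nc[OF g] c by simp
      then show ?thesis by (simp add: y_def cj_def)
    qed
    then show ?thesis unfolding V_def using normal_cj[OF N] s g
      by (intro A.finprod_cong') (auto simp: Pi_def)
  qed
  have cjprod: "cj a (\<Otimes>\<^bsub>G\<lparr>carrier := N\<rparr>\<^esub>c\<in>C. f c) = (\<Otimes>\<^bsub>G\<lparr>carrier := N\<rparr>\<^esub>c\<in>C. cj a (f c))"
    if "finite C" "f \<in> C \<rightarrow> N" "a \<in> carrier G" for a C f
    using that
  proof (induction C rule: finite_induct)
    case empty
    then show ?case by simp
  next
    case (insert c C)
    have fc: "f c \<in> N" "f \<in> C \<rightarrow> N" using insert by auto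
    have p: "(\<Otimes>\<^bsub>G\<lparr>carrier := N\<rparr>\<^esub>c\<in>C. f c) \<in> N"
      using A.finprod_closed[of f C] fc by simp
    have cf: "cj a (f c) \<in> N" "(\<lambda>c. cj a (f c)) \<in> C \<rightarrow> N"
      using fc normal_cj[OF N insert.prems(2)] by auto
    have "(\<Otimes>\<^bsub>G\<lparr>carrier := N\<rparr>\<^esub>c\<in>insert c C. f c) = f c \<otimes> (\<Otimes>\<^bsub>G\<lparr>carrier := N\<rparr>\<^esub>c\<in>C. f c)"
      using A.finprod_insert[of C c f] insert fc by simp
    moreover have "(\<Otimes>\<^bsub>G\<lparr>carrier := N\<rparr>\<^esub>c\<in>insert c C. cj a (f c)) = cj a (f c) \<otimes> (\<Otimes>\<^bsub>G\<lparr>carrier := N\<rparr>\<^esub>c\<in>C. cj a (f c))"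
      using A.finprod_insert[of C c "\<lambda>c. cj a (f c)"] insert cf by simp
    ultimately show ?case using insert.IH fc insert.prems Nc fc(1) p by (simp add: cj_hom)
  qed
  have Vz: "V g \<in> cntr" if g: "g \<in> N" for g
    unfolding cntr_iff
  proof (intro conjI ballI)
    show "V g \<in> carrier G" using VN Nc g by blast
    fix a assume a: "a \<in> carrier G"
    have cjN: "(\<lambda>c. cj (s c) g) \<in> carrier H \<rightarrow> N" using normal_cj[OF N] s g by auto
    have "cj a (V g) = (\<Otimes>\<^bsub>G\<lparr>carrier := N\<rparr>\<^esub>c\<in>carrier H. cj a (cj (s c) g))"
      unfolding Vcj[OF g] using cjprod[OF Q.H.finite_carrier cjN a] .
    also have "\<dots> = (\<Otimes>\<^bsub>G\<lparr>carrier := N\<rparr>\<^esub>c\<in>carrier H. cj (s (\<phi> a \<otimes>\<^bsub>H\<^esub> c)) g)"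
    proof (rule A.finprod_cong'[OF refl])
      show "(\<lambda>c. cj (s (\<phi> a \<otimes>\<^bsub>H\<^esub> c)) g) \<in> carrier H \<rightarrow> carrier (G\<lparr>carrier := N\<rparr>)"
        using cjN a by (auto simp: Pi_def)
      fix c assume c: "c \<in> carrier H"
      have sc: "s c \<in> carrier G" "\<phi> (s c) = c" using s c by blast+
      let ?t = "s (\<phi> a \<otimes>\<^bsub>H\<^esub> c)"
      have t: "?t \<in> carrier G" using s a c by simp
      \<comment> \<open>\<open>a \<otimes> s c\<close> and the representative of its coset differ by
        a factor from the abelian \<open>N\<close>, so they act alike on \<open>g\<close>.
        Conjugation by \<open>a\<close> thus merely permutes the factors of the product.\<close>
      have "a \<otimes> s c = y (a \<otimes> s c) \<otimes> s (\<phi> (a \<otimes> s c))" using y(2) sc a by blast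
      then have e: "a \<otimes> s c = y (a \<otimes> s c) \<otimes> ?t" using sc a by simp
      have yn: "y (a \<otimes> s c) \<in> N" using y(1) sc a by simp
      have "cj a (cj (s c) g) = cj (a \<otimes> s c) g" using a sc Nc[OF g] by (simp add: cj_mult)
      also have "\<dots> = cj (y (a \<otimes> s c)) (cj ?t g)"
        using e cj_mult[OF Nc[OF yn] t Nc[OF g]] by simp
      also have "\<dots> = cj ?t g"
        using cj_fix_iff Nc[OF yn] ab[OF yn normal_cj[OF N t g]] t Nc[OF g] by simp
      finally show "cj a (cj (s c) g) = cj ?t g" .
    qed
    also have "\<dots> = V g" unfolding Vcj[OF g] using shift_l[OF cjN, of "\<phi> a"] a by simp
    finally show "cj a (V g) = V g" .
  qed
  have "card (carrier H) = n"
  proof -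
    have "card (\<phi> ` carrier G) * card N = card (carrier G)"
    proof (rule card_equal_fibres[OF finite_carrier])
      fix x assume x: "x \<in> carrier G"
      have "{z \<in> carrier G. \<phi> z = \<phi> x} = (\<lambda>a. x \<otimes> a) ` N"
      proof
        show "{z \<in> carrier G. \<phi> z = \<phi> x} \<subseteq> (\<lambda>a. x \<otimes> a) ` N"
          using eq_mod_normal[OF Q ker _ x] by blast
        show "(\<lambda>a. x \<otimes> a) ` N \<subseteq> {z \<in> carrier G. \<phi> z = \<phi> x}"
          using x Nc ker by auto
      qed
      then show "card {z \<in> carrier G. \<phi> z = \<phi> x} = card N"
        using x Nc by (simp add: card_image inj_on_def)
    qed
    then show ?thesis using n Q.surj card_pos[OF sN] by simp
  qed
  then have "V z = z [^] n" if z: "z \<in> N \<inter> cntr" for z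
  proof -
    have zN: "z \<in> N" using z by blast
    have "V z = (\<Otimes>\<^bsub>G\<lparr>carrier := N\<rparr>\<^esub>c\<in>carrier H. z)"
      unfolding Vcj[OF zN] using z s by (intro A.finprod_cong') (auto simp: cntr_iff)
    also have "\<dots> = z [^]\<^bsub>G\<lparr>carrier := N\<rparr>\<^esub> n"
      using A.finprod_const[of z "carrier H"] zN \<open>card (carrier H) = n\<close> by simp
    finally show ?thesis by (simp add: nat_pow_consistent[symmetric])
  qed
  then show ?thesis using VN Vhom Vz by blast
qed

text \<open>The double transfer \<open>W\<close> is the \<open>n^2\<close>-power map on
  \<open>N \<inter> cntr\<close>, whose order is prime to \<open>n\<close>; it is bijective there,
  and its kernel is a complement.\<close>

lemma central_direct_factor:
  assumes N: "N \<lhd> G" and ab: "\<And>a b. a \<in> N \<Longrightarrow> b \<in> N \<Longrightarrow> a \<otimes> b = b \<otimes> a"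
    and n: "card (carrier G) = n * card N" "coprime n (card N)"
  shows "\<exists>Y. internal_direct G (carrier G) Y (N \<inter> cntr)"
proof -
  have sN: "subgroup N G" using N by (rule normal_imp_subgroup)
  note Nc = subgroup.mem_carrier[OF sN]
  define Z where "Z = N \<inter> cntr"
  have sZ: "subgroup Z G" unfolding Z_def using sN cntr_subgroup by (rule inter_subgroup)
  note Zc = subgroup.mem_carrier[OF sZ]
  obtain V where VN: "\<And>g. g \<in> carrier G \<Longrightarrow> V g \<in> N"
    and Vhom: "\<And>g h. g \<in> carrier G \<Longrightarrow> h \<in> carrier G \<Longrightarrow> V (g \<otimes> h) = V g \<otimes> V h"
    and Vc: "\<And>g. g \<in> N \<Longrightarrow> V g \<in> cntr" and Vp: "\<And>z. z \<in> Z \<Longrightarrow> V z = z [^] n"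
    using transfer[OF N ab n(1)] unfolding Z_def by blast
  define W where "W g = V (V g)" for g
  define k where "k = n * n"
  have WZ: "W g \<in> Z" if "g \<in> carrier G" for g
    using VN[OF that] VN[OF Nc[OF VN[OF that]]] Vc by (simp add: W_def Z_def)
  have Whom: "W (g \<otimes> h) = W g \<otimes> W h" if "g \<in> carrier G" "h \<in> carrier G" for g h
    using that Vhom VN Nc by (simp add: W_def)
  have Wp: "W z = z [^] k" if z: "z \<in> Z" for z
    using Vp[OF z] Vp[OF subgroup_pow[OF sZ z]] Zc[OF z] by (simp add: W_def k_def nat_pow_pow)
  have "card Z dvd card N" using card_subgroup_dvd[OF sZ sN] by (auto simp: Z_def)
  then have cop: "coprime k (card Z)"
    using n(2) unfolding k_def by (metis coprime_divisors dvd_refl coprime_mult_left_iff)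
  have triv: "z = \<one>" if z: "z \<in> Z" "z [^] k = \<one>" for z
  proof -
    have "ord z dvd card Z" "ord z dvd k"
      using subgroup_card_pow_eq_one[OF sZ z(1)] z(2) Zc[OF z(1)] pow_eq_id by blast+
    then have "ord z = 1" using cop coprime_common_divisor_nat by blast
    then show ?thesis using Zc[OF z(1)] ord_eq_1 by simp
  qed
  have Zcomm: "a \<otimes> b = b \<otimes> a" if "a \<in> Z" "b \<in> Z" for a b using ab that by (simp add: Z_def)
  have "inj_on (\<lambda>z. z [^] k) Z"
  proof (rule inj_onI)
    fix z w assume zw: "z \<in> Z" "w \<in> Z" "z [^] k = w [^] k"
    have iw: "inv w \<in> Z" "z \<otimes> inv w \<in> Z"
      using zw sZ by (simp_all add: subgroup.m_inv_closed subgroup.m_closed)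
    have "(z \<otimes> inv w) [^] k = z [^] k \<otimes> inv w [^] k"
      using Zcomm[OF zw(1) iw(1)] Zc[OF zw(1)] Zc[OF iw(1)] by (rule pow_mult_distrib)
    also have "\<dots> = \<one>" using zw Zc by (simp add: nat_pow_inv)
    finally have "z \<otimes> inv w = \<one>" using triv iw by blast
    then show "z = w" using zw Zc by (metis inv_closed inv_equality inv_inv)
  qed
  then have surj: "(\<lambda>z. z [^] k) ` Z = Z"
    using subgroup_pow[OF sZ] finite_subgroup[OF sZ] by (intro card_subset_eq) (auto simp: card_image)
  define Y where "Y = {g \<in> carrier G. W g = \<one>}"
  have W1: "W \<one> = \<one>" using Wp[OF subgroup.one_closed[OF sZ]] by simp
  have sY: "subgroup Y G"
  proof (rule subgroupI)
    show "Y \<subseteq> carrier G" by (auto simp: Y_def)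
    have "\<one> \<in> Y" using W1 by (simp add: Y_def)
    then show "Y \<noteq> {}" by blast
    show "a \<otimes> b \<in> Y" if "a \<in> Y" "b \<in> Y" for a b using that Whom by (simp add: Y_def)
    show "inv a \<in> Y" if "a \<in> Y" for a
    proof -
      have a: "a \<in> carrier G" "W a = \<one>" using that by (auto simp: Y_def)
      have ic: "inv a \<in> carrier G" using a by simp
      have "W (inv a) \<in> carrier G" using WZ[OF ic] by (rule Zc)
      then have "W (inv a) = W (a \<otimes> inv a)" unfolding Whom[OF a(1) ic] a(2) by simp
      also have "\<dots> = \<one>" using W1 a(1) by simp
      finally show ?thesis using ic by (simp add: Y_def)
    qed
  qed
  have "internal_direct G (carrier G) Y Z"
    unfolding internal_direct_def
  proof (intro conjI sY sZ)
    show "Y <#> Z = carrier G"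
    proof
      show "Y <#> Z \<subseteq> carrier G" using sY sZ by (simp add: setmult_subset_G subgroup.subset)
      show "carrier G \<subseteq> Y <#> Z"
      proof
        fix g assume g: "g \<in> carrier G"
        \<comment> \<open>The central element with the same image as \<open>g\<close> under
          \<open>W\<close>; dividing by it moves \<open>g\<close> into the kernel.\<close>
        obtain z where z: "z \<in> Z" "W g = z [^] k" using surj WZ[OF g] by blast
        have iz: "inv z \<in> Z" using z sZ by (simp add: subgroup.m_inv_closed)
        have "W (g \<otimes> inv z) = W g \<otimes> inv z [^] k" using Whom Wp[OF iz] g Zc[OF iz] by simp
        also have "\<dots> = \<one>" using z Zc by (simp add: nat_pow_inv)
        finally have "g \<otimes> inv z \<in> Y" using g Zc[OF iz] by (simp add: Y_def)
        moreover have "g = (g \<otimes> inv z) \<otimes> z" using g Zc[OF z(1)] by (simp add: m_assoc)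
        ultimately show "g \<in> Y <#> Z" using z(1) unfolding set_mult_def by blast
      qed
    qed
    show "Y \<inter> Z = {\<one>}"
      using triv Wp subgroup.one_closed[OF sY] subgroup.one_closed[OF sZ] by (auto simp: Y_def)
    show "\<forall>a\<in>Y. \<forall>w\<in>Z. a \<otimes> w = w \<otimes> a"
      using cntr_cj by (auto simp: Z_def Y_def cntr_def cent_def)
  qed
  then show ?thesis unfolding Z_def by blast
qed

lemma normal_hall_centre_trivial:
  assumes noab: "no_abelian_direct_factor G (carrier G)"
    and N: "N \<lhd> G" and ab: "\<And>a b. a \<in> N \<Longrightarrow> b \<in> N \<Longrightarrow> a \<otimes> b = b \<otimes> a"
    and n: "card (carrier G) = n * card N" "coprime n (card N)"
  shows "N \<inter> cntr = {\<one>}"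
proof -
  have s: "subgroup (N \<inter> cntr) G"
    using inter_subgroup[OF normal_imp_subgroup[OF N] cntr_subgroup] .
  have "comm_group (G\<lparr>carrier := N \<inter> cntr\<rparr>)"
    by (rule group.group_comm_groupI[OF subgroup_imp_group[OF s]]) (simp add: ab)
  then show ?thesis
    using central_direct_factor[OF N ab n] noab unfolding no_abelian_direct_factor_def by blast
qed

text \<open>No class size is divisible by a prime of \<open>\<rho>\<close>, so all
  \<open>\<rho>\<close>-elements of prime power order are central. They make up a central Hall
  subgroup \<open>N\<close>, which splits off as a direct factor and must be trivial.\<close>

lemma one_class_type:
  assumes \<pi>: "complementary \<pi> \<rho>" and noab: "no_abelian_direct_factor G (carrier G)"
    and all: "\<And>x. x \<in> carrier G \<Longrightarrow> pi_number \<pi> (class_size G x)"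
  shows "pi_number \<pi> (card (carrier G))"
proof -
  define N where "N = {z \<in> cntr. \<exists>m::nat. pi_number \<rho> m \<and> z [^] m = \<one>}"
  have Nc: "z \<in> carrier G" if "z \<in> N" for z using that cntr_carrier by (simp add: N_def)
  have comm: "a \<otimes> b = b \<otimes> a" if "a \<in> N" "b \<in> N" for a b
    using that Nc[OF that(2)] unfolding N_def cntr_def cent_def by blast
  have sN: "subgroup N G"
  proof (rule subgroupI)
    show "N \<subseteq> carrier G" using Nc by blast
    have "pi_number \<rho> 1" by simp
    moreover have "\<one> [^] (1::nat) = \<one>" by simp
    ultimately have "\<one> \<in> N" using subgroup.one_closed[OF cntr_subgroup] unfolding N_def by blast
    then show "N \<noteq> {}" by blast
    show "inv a \<in> N" if a: "a \<in> N" for a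
    proof -
      obtain m :: nat where m: "pi_number \<rho> m" "a [^] m = \<one>" using a by (auto simp: N_def)
      have "inv a [^] m = \<one>" using m Nc[OF a] by (simp add: nat_pow_inv)
      moreover have "inv a \<in> cntr" using a subgroup.m_inv_closed[OF cntr_subgroup] by (simp add: N_def)
      ultimately show ?thesis using m by (auto simp: N_def)
    qed
    show "a \<otimes> b \<in> N" if a: "a \<in> N" and b: "b \<in> N" for a b
    proof -
      obtain m :: nat where m: "pi_number \<rho> m" "a [^] m = \<one>" using a by (auto simp: N_def)
      obtain k :: nat where k: "pi_number \<rho> k" "b [^] k = \<one>" using b by (auto simp: N_def)
      have "(a \<otimes> b) [^] (m * k) = a [^] (m * k) \<otimes> b [^] (m * k)"
        using comm[OF a b] Nc[OF a] Nc[OF b] by (rule pow_mult_distrib)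
      also have "a [^] (m * k) = \<one>" using m Nc[OF a] by (simp flip: nat_pow_pow)
      also have "b [^] (m * k) = (b [^] k) [^] m" using Nc[OF b] by (simp add: nat_pow_pow mult.commute)
      finally have "(a \<otimes> b) [^] (m * k) = \<one>" using k by simp
      moreover have "pi_number \<rho> (m * k)" using m k by (simp add: pi_number_mult)
      moreover have "a \<otimes> b \<in> cntr" using a b subgroup.m_closed[OF cntr_subgroup] by (simp add: N_def)
      ultimately show ?thesis unfolding N_def by blast
    qed
  qed
  have nN: "N \<lhd> G"
    by (rule normalI_cj[OF sN]) (auto simp: N_def cntr_iff)
  have cN: "pi_number \<rho> (card N)"
  proof (rule pi_numberI[OF complementary_sym[OF \<pi>]], rule notI)
    fix p assume p: "is_prime p" "p \<in> \<pi>" "p dvd card N"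
    obtain x where x: "x \<in> N" "pel p x" "x \<noteq> \<one>" using cauchy[OF p(1) sN p(3)] by blast
    obtain m :: nat where m: "pi_number \<rho> m" "x [^] m = \<one>" using x(1) by (auto simp: N_def)
    obtain j where j: "x [^] (p ^ j) = \<one>" using x(2) by (auto simp: pel_def)
    have "coprime m (p ^ j)"
      using coprime_prime_power[OF p(1)] pi_number_not_dvd[OF complementary_sym[OF \<pi>] m(1) p(1,2)] by blast
    moreover have "ord x dvd m" "ord x dvd p ^ j" using m j Nc[OF x(1)] pow_eq_id by blast+
    ultimately have "ord x = 1" using coprime_common_divisor_nat by blast
    then show False using x Nc ord_eq_1 by simp
  qed
  obtain n where n: "card (carrier G) = n * card N"
    using card_subgroup_dvd[OF sN subgroup_self] Nc by (metis dvdE mult.commute subsetI)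
  have n\<pi>: "pi_number \<pi> n"
  proof (rule pi_numberI[OF \<pi>])
    fix q assume q: "is_prime q" "q \<in> \<rho>"
    show "\<not> q dvd n"
    proof (rule not_dvd_index[OF q(1) sN subgroup_self _ n])
      show "N \<subseteq> carrier G" using Nc by blast
      fix R k assume R: "subgroup R G" "R \<subseteq> carrier G" "card R = q ^ k"
      have "h \<in> N" if h: "h \<in> R" for h
      proof -
        have hq: "pel q h" using p_subgroup_pel[OF R(1,3) h] .
        have hc: "h \<in> carrier G" using hq by (rule pel_carrier)
        have "carrier G \<subseteq> cent h"
          using p_elements_of_center[OF q(1) normal_self _ hc hq] pi_number_not_dvd[OF \<pi> all q] by blast
        then have "h \<in> cntr" using hc cent_carrier by (auto simp: cntr_def)
        moreover obtain j where "h [^] (q ^ j) = \<one>" using hq by (auto simp: pel_def)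
        moreover have "pi_number \<rho> (q ^ j)" using pi_number_prime_power q by blast
        ultimately show ?thesis by (auto simp: N_def)
      qed
      then have "cj \<one> ` R \<subseteq> N" using R(2) by auto
      then show "\<exists>g\<in>carrier G. cj g ` R \<subseteq> N" by blast
    qed
  qed
  have "N \<inter> cntr = {\<one>}"
    using normal_hall_centre_trivial[OF noab nN comm n] pi_number_coprime[OF \<pi> n\<pi> cN] by blast
  moreover have "N \<subseteq> cntr" by (auto simp: N_def)
  ultimately have "N = {\<one>}" by blast
  then show ?thesis using n n\<pi> by simp
qed

section \<open>Groups with class sizes of both types\<close>

lemma pow_coprime_one:
  assumes "x \<in> carrier G" "x [^] (m::nat) = \<one>" "x [^] (k::nat) = \<one>" "coprime m k"
  shows "x = \<one>"
proof -
  have "ord x dvd m" "ord x dvd k" using assms pow_eq_id by blast+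
  then have "ord x = 1" using assms(4) coprime_common_divisor_nat by blast
  then show ?thesis using assms(1) ord_eq_1 by simp
qed

lemma pel_coprime_one:
  assumes \<pi>: "complementary \<pi> \<rho>" and m: "x [^] (m::nat) = \<one>" "pi_number \<pi> m"
    and q: "is_prime q" "q \<in> \<rho>" "pel q x"
  shows "x = \<one>"
proof -
  obtain j where j: "x [^] (q ^ j) = \<one>" using q(3) by (auto simp: pel_def)
  have "coprime m (q ^ j)" using coprime_prime_power[OF q(1) pi_number_not_dvd[OF \<pi> m(2) q(1,2)]] .
  then show ?thesis using pow_coprime_one[OF pel_carrier[OF q(3)] m(1) j] by blast
qed

lemma subgroup_coprime_card_trivial:
  assumes "subgroup H G" "subgroup K G" "coprime (card H) (card K)"
  shows "H \<inter> K = {\<one>}"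
proof -
  have "x = \<one>" if "x \<in> H" "x \<in> K" for x
    using pow_coprime_one[OF subgroup.mem_carrier[OF assms(1) that(1)]
        subgroup_card_pow_eq_one[OF assms(1) that(1)] subgroup_card_pow_eq_one[OF assms(2) that(2)] assms(3)] .
  then show ?thesis using subgroup.one_closed[OF assms(1)] subgroup.one_closed[OF assms(2)] by blast
qed

text \<open>The \<open>M\<close>-orbit of \<open>h\<close> always stays in the coset
  \<open>M h\<close>; a trivial stabiliser gives it \<open>|M|\<close> elements.\<close>

lemma complement_orbit:
  assumes M: "M \<lhd> G" and h: "h \<in> carrier G" and triv: "M \<inter> cent h = {\<one>}"
  shows "orb M h = (\<lambda>m. m \<otimes> h) ` M"
proof (rule card_subset_eq)
  have sM: "subgroup M G" using M by (rule normal_imp_subgroup)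
  note Mc = subgroup.mem_carrier[OF sM]
  show "finite ((\<lambda>m. m \<otimes> h) ` M)" using finite_subgroup[OF sM] by simp
  show "orb M h \<subseteq> (\<lambda>m. m \<otimes> h) ` M"
  proof
    fix y assume "y \<in> orb M h"
    then obtain m where m: "m \<in> M" "y = cj m h" by (auto simp: orb_def)
    have "m \<otimes> cj h (inv m) \<in> M"
      using m normal_cj[OF M h] sM by (simp add: subgroup.m_closed subgroup.m_inv_closed)
    moreover have "y = m \<otimes> cj h (inv m) \<otimes> h" using m Mc[OF m(1)] h by (simp add: cj_def m_assoc)
    ultimately show "y \<in> (\<lambda>m. m \<otimes> h) ` M" by blast
  qed
  have "card ((\<lambda>m. m \<otimes> h) ` M) = card M"
    using Mc h by (intro card_image inj_onI) simp
  then show "card (orb M h) = card ((\<lambda>m. m \<otimes> h) ` M)"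
    using card_orb[OF sM h] triv by simp
qed

end

text \<open>The class of \<open>x0\<close> exceeds every class of \<open>\<rho>\<close>-size, and
  \<open>y0\<close> witnesses that non-central elements of \<open>\<rho>\<close>-class size exist.
  The opposite situation is the same locale with the two sets exchanged.\<close>

locale two_class_types = finite_group +
  fixes \<pi> \<rho> :: "nat set" and x0 y0 :: 'a
  assumes compl: "complementary \<pi> \<rho>"
    and good: "\<And>x. x \<in> carrier G \<Longrightarrow> pi_number \<pi> (class_size G x) \<or> pi_number \<rho> (class_size G x)"
    and noab: "no_abelian_direct_factor G (carrier G)"
    and x0: "x0 \<in> carrier G" "pi_number \<pi> (class_size G x0)"
    and y0: "y0 \<in> carrier G" "pi_number \<rho> (class_size G y0)" "\<not> pi_number \<pi> (class_size G y0)"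
    and less: "\<And>y. y \<in> carrier G \<Longrightarrow> pi_number \<rho> (class_size G y) \<Longrightarrow> class_size G y < class_size G x0"
begin

lemma compl': "complementary \<rho> \<pi>"
  using compl by (rule complementary_sym)

lemma in_one_set: "is_prime p \<Longrightarrow> p \<in> \<pi> \<or> p \<in> \<rho>"
  using compl by (auto simp: complementary_def)

lemma not_both: "x \<in> carrier G \<Longrightarrow> pi_number \<pi> (class_size G x) \<Longrightarrow> pi_number \<rho> (class_size G x) \<Longrightarrow> x \<in> cntr"
proof -
  assume x: "x \<in> carrier G" "pi_number \<pi> (class_size G x)" "pi_number \<rho> (class_size G x)"
  have "coprime (class_size G x) (class_size G x)" using pi_number_coprime[OF compl x(2,3)] .
  then have "class_size G x = 1" by simp
  then show ?thesis using x(1) class_size_1_iff by (simp add: cntr_def)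
qed

lemma cntr_both: "x \<in> cntr \<Longrightarrow> pi_number \<sigma> (class_size G x)"
  using class_size_1_iff[of x] by (simp add: cntr_def)

lemma rho_class_parts_central:
  assumes y: "y \<in> carrier G" "pi_number \<rho> (class_size G y)"
    and q: "is_prime q" "q \<in> \<rho>" "pel q (y [^] (n::nat))"
  shows "y [^] n \<in> cntr"
  using smaller_class_rho_parts_central[OF compl x0 y good[OF m_closed[OF x0(1) y(1)]] less[OF y] q] y(1)
  by (simp add: cntr_def)

lemma rho_class_commutes_rho_class:
  assumes "y \<in> carrier G" "pi_number \<rho> (class_size G y)" "r \<in> carrier G" "pi_number \<rho> (class_size G r)"
  shows "y \<in> cent r"
  using smaller_class_commutes[OF compl x0 assms(1,2) good[OF m_closed[OF x0(1) assms(1)]] less[OF assms(1,2)] assms(3,4)] .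

text \<open>Coprimality settles the case where \<open>w\<close> has \<open>\<pi>\<close>-class size;
  otherwise both have \<open>\<rho>\<close>-class size, and such elements commute because their
  classes are smaller than that of \<open>x0\<close>.\<close>

lemma pi_elements_centralise_rho_class:
  assumes p: "is_prime p" "p \<in> \<pi>" "pel p w" and y: "y \<in> carrier G" "pi_number \<rho> (class_size G y)"
  shows "w \<in> cent y"
proof (cases "pi_number \<pi> (class_size G w)")
  case True
  then show ?thesis using coprime_classes_commute[OF compl p _ y] by blast
next
  case False
  then have "pi_number \<rho> (class_size G w)" using good pel_carrier[OF p(3)] by blast
  then show ?thesis using rho_class_commutes_rho_class[OF pel_carrier[OF p(3)] _ y] by blast
qed

lemma rho_class_if_centralised:
  assumes x: "x \<in> carrier G" and c: "\<And>p w. is_prime p \<Longrightarrow> p \<in> \<pi> \<Longrightarrow> pel p w \<Longrightarrow> w \<in> cent x"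
  shows "pi_number \<rho> (class_size G x)"
proof (rule pi_numberI[OF compl'])
  fix p assume p: "is_prime p" "p \<in> \<pi>"
  show "\<not> p dvd class_size G x" using p(1) x c[OF p] by (rule class_size_not_dvd)
qed

text \<open>The trivial factorisation \<open>G = G G\<close> with a one-step series brings the
  result for factorised groups to bear on \<open>G\<close> itself.\<close>

lemma pi_class_commutes:
  assumes p: "is_prime p" "p \<in> \<pi>" "pel p w" "pi_number \<pi> (class_size G w)"
    and q: "is_prime q" "q \<in> \<rho>" "pel q h"
  shows "h \<in> cent w"
proof (rule pi_class_commutes_rho_elements[OF compl subgroup_self subgroup_self])
  show "carrier G <#> carrier G = carrier G" using subgroup_mult_id[OF subgroup_self] .
  have "carrier G \<subseteq> {\<one>} <#> carrier G" by (force simp: set_mult_def)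
  then show "covering_series G (carrier G) (carrier G) (\<lambda>i. if i = 0 then {\<one>} else carrier G) 1"
    using one_is_normal normal_self by (auto simp: covering_series_def)
  show "pi_number \<pi> (class_size G r) \<or> pi_number \<rho> (class_size G r)"
    if "r \<in> carrier G \<union> carrier G" for r using that good by blast
qed (use assms in auto)

lemma central_if_centralised:
  assumes x: "x \<in> carrier G" and c: "\<And>p w. is_prime p \<Longrightarrow> pel p w \<Longrightarrow> w \<in> cent x"
  shows "x \<in> cntr"
proof -
  have "g \<in> cent x" if g: "g \<in> carrier G" for g
    using mem_subgroup_if_primary_parts[OF cent_subgroup[OF x] g] c by blast
  then show ?thesis using x cent_carrier by (auto simp: cntr_def)
qed

text \<open>Some primary part of \<open>y0\<close> is non-central, and those at primes of
  \<open>\<rho>\<close> are central.\<close>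

lemma noncentral_pi_part:
  obtains p y where "is_prime p" "p \<in> \<pi>" "pel p y" "pi_number \<rho> (class_size G y)" "y \<notin> cntr"
proof -
  have "y0 \<notin> cntr" using cntr_both y0 by blast
  then obtain n :: nat and p where p: "is_prime p" "pel p (y0 [^] n)" "y0 [^] n \<notin> cntr"
    using mem_subgroup_if_primary_parts[OF cntr_subgroup y0(1)] by blast
  then have "p \<in> \<pi>" using rho_class_parts_central[OF y0(1,2) p(1) _ p(2)] in_one_set by blast
  moreover have "pi_number \<rho> (class_size G (y0 [^] n))"
    using class_size_pow_dvd[OF y0(1)] y0(2) pi_number_dvd by blast
  ultimately show ?thesis using that p by blast
qed

text \<open>If \<open>w\<close> were of \<open>\<pi>\<close>-class size only, then so would be \<open>wy\<close> for a non-central \<open>\<pi>\<close>-element \<open>y\<close> of \<open>\<rho>\<close>-class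
  size; both then commute with all \<open>\<rho>\<close>-elements, and hence so does \<open>y\<close>, which would be central.\<close>

lemma pi_element_rho_class:
  assumes p: "is_prime p" "p \<in> \<pi>" "pel p w"
  shows "pi_number \<rho> (class_size G w)"
proof (rule ccontr)
  assume nr: "\<not> pi_number \<rho> (class_size G w)"
  have wc: "w \<in> carrier G" using p(3) by (rule pel_carrier)
  have w\<pi>: "pi_number \<pi> (class_size G w)" using nr good wc by blast
  obtain p1 y where y: "is_prime p1" "p1 \<in> \<pi>" "pel p1 y" "pi_number \<rho> (class_size G y)" "y \<notin> cntr"
    by (rule noncentral_pi_part)
  have yc: "y \<in> carrier G" using y(3) by (rule pel_carrier)
  have sy: "u \<in> cent y" if "is_prime p" "p \<in> \<pi>" "pel p u" for p u
    using pi_elements_centralise_rho_class[OF that yc y(4)] .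
  have comm: "w \<otimes> y = y \<otimes> w" using sy[OF p] by (simp add: cent_def)
  have wyc: "w \<otimes> y \<in> carrier G" using wc yc by simp
  have weq: "w = (w \<otimes> y) \<otimes> inv y" and yeq: "y = inv w \<otimes> (w \<otimes> y)"
    using wc yc by (simp_all add: m_assoc)
  \<comment> \<open>Otherwise \<open>w y\<close> and \<open>y\<close> would both commute with all
    \<open>\<pi>\<close>-elements of prime power order, and so would \<open>w\<close>, making its
    class size a \<open>\<rho>\<close>-number.\<close>
  have wy\<pi>: "pi_number \<pi> (class_size G (w \<otimes> y))"
  proof (rule ccontr)
    assume "\<not> pi_number \<pi> (class_size G (w \<otimes> y))"
    then have wy: "pi_number \<rho> (class_size G (w \<otimes> y))" using good wyc by blast
    have "u \<in> cent w" if u: "is_prime p" "p \<in> \<pi>" "pel p u" for p u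
    proof -
      have uc: "u \<in> carrier G" using u(3) by (rule pel_carrier)
      have "w \<otimes> y \<in> cent u" "y \<in> cent u"
        using pi_elements_centralise_rho_class[OF u wyc wy] sy[OF u] cent_sym[OF wyc] cent_sym[OF yc] by blast+
      then have "(w \<otimes> y) \<otimes> inv y \<in> cent u"
        using cent_subgroup[OF uc] by (simp add: subgroup.m_closed subgroup.m_inv_closed)
      then show ?thesis using weq cent_sym[OF uc] by simp
    qed
    then show False using rho_class_if_centralised[OF wc] nr by blast
  qed
  obtain i where i: "w [^] (p ^ i) = \<one>" using p(3) by (auto simp: pel_def)
  obtain j where j: "y [^] (p1 ^ j) = \<one>" using y(3) by (auto simp: pel_def)
  let ?m = "p ^ i * p1 ^ j"
  have "(w \<otimes> y) [^] ?m = w [^] ?m \<otimes> y [^] ?m" using comm wc yc by (rule pow_mult_distrib)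
  also have "w [^] ?m = \<one>" using i wc by (simp flip: nat_pow_pow)
  also have "y [^] ?m = (y [^] (p1 ^ j)) [^] (p ^ i)" using yc by (simp add: nat_pow_pow mult.commute)
  finally have m: "(w \<otimes> y) [^] ?m = \<one>" using j by simp
  have m\<pi>: "pi_number \<pi> ?m"
    using pi_number_prime_power[OF p(1,2)] pi_number_prime_power[OF y(1,2)] by (simp add: pi_number_mult)
  have hy: "h \<in> cent y" if q: "is_prime q" "q \<in> \<rho>" "pel q h" for q h
  proof (rule cent_sym)
    show hc: "h \<in> carrier G" using q(3) by (rule pel_carrier)
    have "w \<otimes> y \<in> cent h"
    proof (rule mem_subgroup_if_primary_parts[OF cent_subgroup[OF hc] wyc])
      fix n :: nat and s assume s: "is_prime s" "pel s ((w \<otimes> y) [^] n)"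
      show "(w \<otimes> y) [^] n \<in> cent h"
      proof (cases "s \<in> \<pi>")
        case True
        have "pi_number \<pi> (class_size G ((w \<otimes> y) [^] n))"
          using class_size_pow_dvd[OF wyc] wy\<pi> pi_number_dvd by blast
        then have "h \<in> cent ((w \<otimes> y) [^] n)" using pi_class_commutes[OF s(1) True s(2) _ q] by blast
        then show ?thesis by (rule cent_sym[OF nat_pow_closed[OF wyc]])
      next
        case False
        then have s\<rho>: "s \<in> \<rho>" using in_one_set s by blast
        have "((w \<otimes> y) [^] n) [^] ?m = \<one>"
          using m wyc by (metis mult.commute nat_pow_one nat_pow_pow)
        then have "(w \<otimes> y) [^] n = \<one>" using pel_coprime_one[OF compl _ m\<pi> s(1) s\<rho> s(2)] by blast
        then show ?thesis using hc by (simp add: cent_def)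
      qed
    qed
    moreover have "w \<in> cent h" using pi_class_commutes[OF p w\<pi> q] by (rule cent_sym[OF wc])
    ultimately have "inv w \<otimes> (w \<otimes> y) \<in> cent h"
      using cent_subgroup[OF hc] by (simp add: subgroup.m_closed subgroup.m_inv_closed)
    then show "y \<in> cent h" using yeq by simp
  qed
  have "y \<in> cntr"
    using central_if_centralised[OF yc] sy hy in_one_set by blast
  then show False using y(5) by blast
qed

text \<open>The class size clause gives commutativity at once; by
  \<open>pi_element_rho_class\<close> every \<open>p\<close>-element with
  \<open>p \<in> \<pi>\<close> satisfies it.\<close>

definition hall :: "'a set" where
  "hall = {m \<in> carrier G. pi_number \<rho> (class_size G m) \<and> (\<exists>k::nat. pi_number \<pi> k \<and> m [^] k = \<one>)}"

lemma hall_carrier: "m \<in> hall \<Longrightarrow> m \<in> carrier G"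
  by (simp add: hall_def)

lemma hall_commute: "a \<in> hall \<Longrightarrow> b \<in> hall \<Longrightarrow> a \<otimes> b = b \<otimes> a"
  using rho_class_commutes_rho_class[of a b] by (simp add: hall_def cent_def)

lemma pel_hall: "is_prime p \<Longrightarrow> p \<in> \<pi> \<Longrightarrow> pel p w \<Longrightarrow> w \<in> hall"
  using pi_element_rho_class[of p w] pi_number_prime_power[of p \<pi>] by (auto simp: hall_def pel_def)

text \<open>Having \<open>\<rho>\<close>-class size amounts to being centralised by all
  \<open>p\<close>-elements with \<open>p \<in> \<pi>\<close>, and this is preserved by products and
  inverses.\<close>

lemma hall_subgroup: "subgroup hall G"
proof (rule subgroupI)
  show "hall \<subseteq> carrier G" using hall_carrier by blast
  have "\<one> \<in> cntr" by (rule subgroup.one_closed[OF cntr_subgroup])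
  then have "pi_number \<rho> (class_size G \<one>)" by (rule cntr_both)
  moreover have "pi_number \<pi> (1::nat)" "\<one> [^] (1::nat) = \<one>" by simp_all
  ultimately have "\<one> \<in> hall" unfolding hall_def by blast
  then show "hall \<noteq> {}" by blast
  have c: "w \<in> cent a" if "a \<in> hall" "is_prime p" "p \<in> \<pi>" "pel p w" for a p w
    using pi_elements_centralise_rho_class[OF that(2-4)] that(1) by (simp add: hall_def)
  show "inv a \<in> hall" if a: "a \<in> hall" for a
  proof -
    have ac: "a \<in> carrier G" using a by (rule hall_carrier)
    have "w \<in> cent (inv a)" if "is_prime p" "p \<in> \<pi>" "pel p w" for p w
    proof -
      have wc: "w \<in> carrier G" using that(3) by (rule pel_carrier)
      have "a \<in> cent w" using c[OF a that] by (rule cent_sym[OF ac])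
      then have "inv a \<in> cent w" using cent_subgroup[OF wc] by (simp add: subgroup.m_inv_closed)
      then show ?thesis by (rule cent_sym[OF wc])
    qed
    then have "pi_number \<rho> (class_size G (inv a))" using rho_class_if_centralised ac by blast
    moreover obtain k :: nat where k: "pi_number \<pi> k" "a [^] k = \<one>" using a by (auto simp: hall_def)
    then have "inv a [^] k = \<one>" using ac by (simp add: nat_pow_inv)
    ultimately show ?thesis using ac k unfolding hall_def by blast
  qed
  show "a \<otimes> b \<in> hall" if a: "a \<in> hall" and b: "b \<in> hall" for a b
  proof -
    have ac: "a \<in> carrier G" "b \<in> carrier G" using a b hall_carrier by blast+
    have "w \<in> cent (a \<otimes> b)" if "is_prime p" "p \<in> \<pi>" "pel p w" for p w
    proof -
      have wc: "w \<in> carrier G" using that(3) by (rule pel_carrier)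
      have "a \<in> cent w" "b \<in> cent w"
        using c[OF a that] c[OF b that] cent_sym[OF ac(1)] cent_sym[OF ac(2)] by blast+
      then have "a \<otimes> b \<in> cent w" using cent_subgroup[OF wc] by (simp add: subgroup.m_closed)
      then show ?thesis by (rule cent_sym[OF wc])
    qed
    then have "pi_number \<rho> (class_size G (a \<otimes> b))" using rho_class_if_centralised ac by blast
    moreover obtain k :: nat where k: "pi_number \<pi> k" "a [^] k = \<one>" using a by (auto simp: hall_def)
    moreover obtain l :: nat where l: "pi_number \<pi> l" "b [^] l = \<one>" using b by (auto simp: hall_def)
    have "(a \<otimes> b) [^] (k * l) = a [^] (k * l) \<otimes> b [^] (k * l)"
      using hall_commute[OF a b] ac by (rule pow_mult_distrib)
    moreover have "a [^] (k * l) = \<one>" using k ac by (simp flip: nat_pow_pow)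
    moreover have "b [^] (k * l) = (b [^] l) [^] k" using ac by (simp add: nat_pow_pow mult.commute)
    ultimately have "pi_number \<rho> (class_size G (a \<otimes> b))" "(a \<otimes> b) [^] (k * l) = \<one>" using l by simp_all
    then show ?thesis using ac pi_number_mult[OF k(1) l(1)] unfolding hall_def by (blast intro: m_closed)
  qed
qed

lemma hall_normal: "hall \<lhd> G"
proof (rule normalI_cj[OF hall_subgroup])
  fix g m assume g: "g \<in> carrier G" and m: "m \<in> hall"
  have mc: "m \<in> carrier G" using m by (rule hall_carrier)
  obtain k :: nat where k: "pi_number \<pi> k" "m [^] k = \<one>" using m by (auto simp: hall_def)
  have "cj g m [^] k = \<one>" using k g mc by (simp flip: cj_pow)
  then show "cj g m \<in> hall"
    using m g mc k(1) class_size_cj[OF g mc] unfolding hall_def by auto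
qed

lemma card_hall: "pi_number \<pi> (card hall)"
proof (rule pi_numberI[OF compl], rule notI)
  fix q assume q: "is_prime q" "q \<in> \<rho>" "q dvd card hall"
  obtain x where x: "x \<in> hall" "pel q x" "x \<noteq> \<one>" using cauchy[OF q(1) hall_subgroup q(3)] by blast
  then obtain k :: nat where "pi_number \<pi> k" "x [^] k = \<one>" by (auto simp: hall_def)
  then show False using pel_coprime_one[OF compl _ _ q(1,2) x(2)] x(3) by blast
qed

lemma index_hall:
  obtains n where "card (carrier G) = n * card hall" "pi_number \<rho> n" "0 < n"
proof -
  obtain n where n: "card (carrier G) = n * card hall"
    using card_subgroup_dvd[OF hall_subgroup subgroup_self subgroup.subset[OF hall_subgroup]]
    by (metis dvdE mult.commute)
  moreover have "pi_number \<rho> n"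
  proof (rule pi_numberI[OF compl'])
    fix p assume p: "is_prime p" "p \<in> \<pi>"
    show "\<not> p dvd n"
    proof (rule not_dvd_index[OF p(1) hall_subgroup subgroup_self _ n])
      show "hall \<subseteq> carrier G" using hall_carrier by blast
      fix R k assume R: "subgroup R G" "R \<subseteq> carrier G" "card R = p ^ k"
      have "cj \<one> ` R \<subseteq> hall" using pel_hall[OF p p_subgroup_pel[OF R(1,3)]] R(2) by auto
      then show "\<exists>g\<in>carrier G. cj g ` R \<subseteq> hall" by blast
    qed
  qed
  moreover have "0 < n" using n card_pos[OF subgroup_self] by (metis gr0I mult_0)
  ultimately show ?thesis using that by blast
qed

lemma hall_center: "hall \<inter> cntr = {\<one>}"
proof -
  obtain n where n: "card (carrier G) = n * card hall" "pi_number \<rho> n" by (rule index_hall)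
  then show ?thesis
    using normal_hall_centre_trivial[OF noab hall_normal hall_commute n(1)]
      pi_number_coprime[OF compl' n(2) card_hall] by blast
qed

lemma hall_nontrivial: "\<exists>m\<in>hall. m \<noteq> \<one>"
proof -
  obtain p y where "is_prime p" "p \<in> \<pi>" "pel p y" "y \<notin> cntr" by (rule noncentral_pi_part)
  then have "y \<in> hall" "y \<noteq> \<one>" using pel_hall subgroup.one_closed[OF cntr_subgroup] by blast+
  then show ?thesis by blast
qed

text \<open>With \<open>\<rho>\<close>-class size, all primary parts of \<open>g\<close> would be
  central. If \<open>m \<in> hall\<close> commutes with \<open>g\<close>, the class size of
  \<open>g m\<close> is a multiple of both class sizes, so that of \<open>m\<close> is a
  \<open>\<pi>\<close>-number as well as a \<open>\<rho>\<close>-number; then \<open>m\<close> is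
  central and hence trivial.\<close>

lemma noncentral_rho_element:
  assumes g: "g \<in> carrier G" "g [^] (k::nat) = \<one>" "pi_number \<rho> k" "g \<notin> cntr"
  shows "pi_number \<pi> (class_size G g)" "hall \<inter> cent g = {\<one>}"
proof -
  have nr: "\<not> pi_number \<rho> (class_size G g)"
  proof
    assume r: "pi_number \<rho> (class_size G g)"
    have "g \<in> cntr"
    proof (rule mem_subgroup_if_primary_parts[OF cntr_subgroup g(1)])
      fix n :: nat and p assume p: "is_prime p" "pel p (g [^] n)"
      show "g [^] n \<in> cntr"
      proof (cases "p \<in> \<rho>")
        case True
        then show ?thesis using rho_class_parts_central[OF g(1) r p(1) _ p(2)] by blast
      next
        case False
        then have "p \<in> \<pi>" using in_one_set p by blast
        moreover have "(g [^] n) [^] k = \<one>" using g by (metis mult.commute nat_pow_one nat_pow_pow)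
        ultimately have "g [^] n = \<one>" using pel_coprime_one[OF compl' _ g(3) p(1) _ p(2)] by blast
        then show ?thesis using subgroup.one_closed[OF cntr_subgroup] by simp
      qed
    qed
    then show False using g(4) by blast
  qed
  then show g\<pi>: "pi_number \<pi> (class_size G g)" using good g(1) by blast
  have "m = \<one>" if m: "m \<in> hall" "m \<in> cent g" for m
  proof -
    have mc: "m \<in> carrier G" using m(1) by (rule hall_carrier)
    obtain l :: nat where l: "pi_number \<pi> l" "m [^] l = \<one>" using m(1) by (auto simp: hall_def)
    have co: "coprime k l" using pi_number_coprime[OF compl' g(3) l(1)] .
    have comm: "g \<otimes> m = m \<otimes> g" using m(2) by (simp add: cent_def)
    have gm: "g \<otimes> m \<in> carrier G" using g(1) mc by simp
    have d: "class_size G g dvd class_size G (g \<otimes> m)" "class_size G m dvd class_size G (g \<otimes> m)"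
      using class_size_dvd_cent cent_mult_coprime[OF comm g(1) mc g(2) l(2) co] g(1) mc by simp_all
    have "pi_number \<pi> (class_size G (g \<otimes> m))" using good[OF gm] nr pi_number_dvd[OF _ d(1)] by blast
    then have "pi_number \<pi> (class_size G m)" using pi_number_dvd[OF _ d(2)] by blast
    then have "m \<in> cntr" using not_both[OF mc] m(1) by (simp add: hall_def)
    then show ?thesis using hall_center m(1) by blast
  qed
  then show "hall \<inter> cent g = {\<one>}"
    using subgroup.one_closed[OF hall_subgroup] subgroup.one_closed[OF cent_subgroup[OF g(1)]] by blast
qed

lemma hall_complement:
  assumes g: "g \<in> carrier G" "g [^] (k::nat) = \<one>" "pi_number \<rho> k" "g \<notin> cntr"
  shows "hall <#> cent g = carrier G"
proof -
  obtain n where n: "card (carrier G) = n * card hall" "pi_number \<rho> n" by (rule index_hall)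
  have "card (carrier G) = class_size G g * card (cent g)" using class_size_cent[OF g(1)] by simp
  then show ?thesis
    using coprime_index_product[OF hall_subgroup cent_subgroup[OF g(1)] n(1)]
      pi_number_coprime[OF compl' n(2) noncentral_rho_element(1)[OF g]] by blast
qed

text \<open>Otherwise a non-central element of \<open>hall\<close> would commute with all elements
  of prime power order, those at \<open>\<pi>\<close> by \<open>\<rho>\<close>-class size and those
  at \<open>\<rho>\<close> by centrality.\<close>

lemma noncentral_rho_exists:
  obtains g k where "g \<in> carrier G" "g [^] (k::nat) = \<one>" "pi_number \<rho> k" "g \<notin> cntr"
proof (rule ccontr)
  note goal = that
  assume c: "\<not> thesis"
  have r: "h \<in> cntr" if q: "is_prime q" "q \<in> \<rho>" "pel q h" for q h
  proof -
    obtain j where "h [^] (q ^ j) = \<one>" using q(3) by (auto simp: pel_def)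
    then show ?thesis using c goal[of h "q ^ j"] pel_carrier[OF q(3)] pi_number_prime_power[OF q(1,2)] by blast
  qed
  obtain p y where y: "is_prime p" "p \<in> \<pi>" "pel p y" "pi_number \<rho> (class_size G y)" "y \<notin> cntr"
    by (rule noncentral_pi_part)
  have yc: "y \<in> carrier G" using y(3) by (rule pel_carrier)
  have "w \<in> cent y" if w: "is_prime s" "pel s w" for s w
  proof (cases "s \<in> \<pi>")
    case True
    then show ?thesis using pi_elements_centralise_rho_class[OF w(1) _ w(2) yc y(4)] by blast
  next
    case False
    then have "w \<in> cntr" using r w in_one_set by blast
    then show ?thesis using yc cntr_cj cntr_carrier by (simp add: mem_cent)
  qed
  then show False using central_if_centralised[OF yc] y(5) by blast
qed

text \<open>The complement is the centraliser of any non-central \<open>\<rho>\<close>-element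
  \<open>g\<close>. Its order equals the index of \<open>hall\<close>, so all its elements are
  \<open>\<rho>\<close>-elements and the same analysis applies to each of them.\<close>

lemma frobenius_structure:
  shows "\<exists>H. subgroup H G \<and> hall <#> H = carrier G \<and> hall \<inter> H = {\<one>} \<and> pi_number \<rho> (card H) \<and>
     (\<forall>a\<in>H. \<forall>b\<in>H. a \<otimes> b = b \<otimes> a) \<and> cntr \<subset> H \<and>
     (\<forall>h\<in>H. h \<notin> cntr \<longrightarrow> hall \<inter> cent h = {\<one>}) \<and> card (carrier G) = card H * card hall"
proof -
  obtain g k where g: "g \<in> carrier G" "g [^] (k::nat) = \<one>" "pi_number \<rho> k" "g \<notin> cntr"
    by (rule noncentral_rho_exists)
  define H where "H = cent g"
  have sH: "subgroup H G" unfolding H_def using g(1) by (rule cent_subgroup)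
  note Hc = subgroup.mem_carrier[OF sH]
  have MH: "hall <#> H = carrier G" and triv: "hall \<inter> H = {\<one>}"
    unfolding H_def using hall_complement[OF g] noncentral_rho_element(2)[OF g] by blast+
  obtain n where n: "card (carrier G) = n * card hall" "pi_number \<rho> n" by (rule index_hall)
  have cG: "card (carrier G) = card H * card hall"
    using card_set_mult[OF hall_subgroup sH] MH triv by simp
  then have "card H = n" using n(1) card_pos[OF hall_subgroup] by simp
  then have cH: "pi_number \<rho> (card H)" using n(2) by simp
  have Hel: "h [^] card H = \<one>" if "h \<in> H" for h using subgroup_card_pow_eq_one[OF sH that] .
  have fr: "hall \<inter> cent h = {\<one>}" if "h \<in> H" "h \<notin> cntr" for h
    using noncentral_rho_element(2)[OF Hc[OF that(1)] Hel[OF that(1)] cH that(2)] .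
  have "a \<otimes> b = b \<otimes> a" if a: "a \<in> H" and b: "b \<in> H" for a b
  proof (cases "a \<in> cntr")
    case True
    then have "cj a b = b" using cntr_cj Hc[OF b] by blast
    then show ?thesis using cj_fix_iff Hc a b by blast
  next
    case False
    have ac: "a \<in> carrier G" and bc: "b \<in> carrier G" using Hc a b by blast+
    \<comment> \<open>The centraliser of \<open>a\<close> also complements \<open>hall\<close>, so
      \<open>b = m c\<close> with \<open>c\<close> commuting with \<open>a\<close>. Then
      \<open>[a, b] = [a, m]\<close> lies in \<open>hall \<inter> H = {\<one>}\<close>.\<close>
    have "b \<in> hall <#> cent a" using hall_complement[OF ac Hel[OF a] cH False] bc by simp
    then obtain m c where mc: "m \<in> hall" "c \<in> cent a" "b = m \<otimes> c" unfolding set_mult_def by blast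
    have cc: "m \<in> carrier G" "c \<in> carrier G" using mc hall_carrier cent_carrier by blast+
    have "cj a c = c" using cent_sym[OF ac] mc(2) cc ac by (metis cent_sym mem_cent)
    then have "cj a b \<otimes> inv b = cj a m \<otimes> inv m"
      using mc(3) cc ac by (simp add: cj_hom inv_mult_group m_assoc)
    also have "\<dots> \<in> hall"
      using normal_cj[OF hall_normal ac mc(1)] mc(1) hall_subgroup
      by (simp add: subgroup.m_closed subgroup.m_inv_closed)
    finally have "cj a b \<otimes> inv b \<in> hall" .
    moreover have "cj a b \<otimes> inv b \<in> H"
      using a b sH by (simp add: cj_def subgroup.m_closed subgroup.m_inv_closed)
    ultimately have "cj a b \<otimes> inv b = \<one>" using triv by blast
    then have "a \<in> cent b" using commute_if_commutator_trivial[OF ac bc] by blast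
    then show ?thesis by (simp add: cent_def)
  qed
  moreover have "cntr \<subseteq> H" using g(1) cntr_cj cntr_carrier by (auto simp: H_def mem_cent)
  moreover have "g \<in> H" using g(1) by (simp add: H_def)
  ultimately show ?thesis using sH MH triv cH fr cG g(4) by blast
qed

end

text \<open>Alternative (2) of the theorem for a group in its own right, so that the structure
  theory need not mention the ambient group. Below \<open>Xs\<close> is the complement
  \<open>H\<close> and \<open>Xs'\<close> is \<open>hall\<close>.\<close>

definition quasi_frobenius :: "nat set \<Rightarrow> ('a, 'b) monoid_scheme \<Rightarrow> bool" where
  "quasi_frobenius \<sigma> K \<longleftrightarrow> (\<exists>Xs Xs'.
     Xs <#>\<^bsub>K\<^esub> Xs' = carrier K \<and> hall_subgroup \<sigma> K Xs \<and> hall_subgroup (pi_compl \<sigma>) K Xs' \<and>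
     Xs' \<lhd> K \<and> comm_group (K\<lparr>carrier := Xs\<rparr>) \<and> comm_group (K\<lparr>carrier := Xs'\<rparr>) \<and>
     frobenius_group (K Mod O_sub \<sigma> K) \<and> O_sub \<sigma> K = group_center K \<and>
     class_sizes K = {1, card Xs div card (O_sub \<sigma> K), card Xs'} \<and> solvable K)"

context two_class_types
begin

text \<open>A normal \<open>\<rho>\<close>-subgroup meets \<open>hall\<close> trivially, hence
  commutes with it; but a non-central \<open>\<rho>\<close>-element fixes nothing except
  \<open>\<one>\<close> in the non-trivial group \<open>hall\<close>.\<close>

lemma O_sub_eq_center:
  assumes sH: "subgroup H G" and cH: "pi_number \<rho> (card H)" and ZH: "cntr \<subseteq> H"
  shows "O_sub \<rho> G = cntr"
proof
  have "card cntr dvd card H" using card_subgroup_dvd[OF cntr_subgroup sH ZH] .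
  then have "pi_number \<rho> (card cntr)" using cH pi_number_dvd by blast
  then show "cntr \<subseteq> O_sub \<rho> G"
    unfolding O_sub_def using cntr_normal by (blast intro: generate.incl)
  show "O_sub \<rho> G \<subseteq> cntr"
    unfolding O_sub_def
  proof (rule generate_subgroup_incl[OF _ cntr_subgroup])
    have "R \<subseteq> cntr" if R: "R \<lhd> G" "pi_number \<rho> (card R)" for R
    proof
      fix r assume r: "r \<in> R"
      have sR: "subgroup R G" using R(1) by (rule normal_imp_subgroup)
      have rc: "r \<in> carrier G" using sR r by (rule subgroup.mem_carrier)
      have "R \<inter> hall = {\<one>}"
        using subgroup_coprime_card_trivial[OF sR hall_subgroup pi_number_coprime[OF compl' R(2) card_hall]] .
      then have RH: "R \<inter> hall \<subseteq> {\<one>}" by simp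
      have "m \<in> cent r" if "m \<in> hall" for m
        using normal_imp_commuting[OF R(1) hall_normal RH r that] hall_carrier[OF that] by (simp add: cent_def)
      then have "hall \<inter> cent r = hall" by blast
      then have "hall \<inter> cent r \<noteq> {\<one>}" using hall_nontrivial by blast
      then show "r \<in> cntr"
        using noncentral_rho_element(2)[OF rc subgroup_card_pow_eq_one[OF sR r] R(2)] by blast
    qed
    then show "\<Union> {N. N \<lhd> G \<and> pi_number \<rho> (card N)} \<subseteq> cntr" by blast
  qed
qed

text \<open>Write an element as \<open>m h\<close>. For non-central \<open>h\<close> it is conjugate
  to \<open>h\<close>, whose centraliser is \<open>H\<close>; for central \<open>h\<close> it has
  the centraliser of \<open>m\<close>, which is \<open>hall\<close> times the centre unless
  \<open>m = \<one>\<close>.\<close>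

lemma class_sizes_eq:
  assumes sH: "subgroup H G" and MH: "hall <#> H = carrier G" and triv: "hall \<inter> H = {\<one>}"
    and ab: "\<And>a b. a \<in> H \<Longrightarrow> b \<in> H \<Longrightarrow> a \<otimes> b = b \<otimes> a" and ZH: "cntr \<subset> H"
    and fr: "\<And>h. h \<in> H \<Longrightarrow> h \<notin> cntr \<Longrightarrow> hall \<inter> cent h = {\<one>}"
    and card: "card (carrier G) = card H * card hall"
  shows "class_sizes G = {1, card H div card cntr, card hall}"
proof -
  note Hc = subgroup.mem_carrier[OF sH]
  have noncentral: "class_size G (m \<otimes> h) = card hall" if m: "m \<in> hall" and h: "h \<in> H" "h \<notin> cntr" for m h
  proof -
    have hc: "h \<in> carrier G" using h(1) by (rule Hc)
    have O: "orb hall h = (\<lambda>m. m \<otimes> h) ` hall" using complement_orbit[OF hall_normal hc fr[OF h]] .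
    then have "m \<otimes> h \<in> orb hall h" using m by blast
    then obtain a where "a \<in> hall" "m \<otimes> h = cj a h" by (auto simp: orb_def)
    then have "class_size G (m \<otimes> h) = class_size G h" using class_size_cj hall_carrier hc by simp
    also have "cent h = H"
    proof (rule card_seteq[symmetric])
      show "finite (cent h)" using finite_subgroup[OF cent_subgroup[OF hc]] .
      show "H \<subseteq> cent h" using ab h(1) Hc by (auto simp: cent_def)
      have "card (hall <#> cent h) = card hall * card (cent h)"
        using card_set_mult[OF hall_subgroup cent_subgroup[OF hc]] fr[OF h] by simp
      moreover have "card (hall <#> cent h) \<le> card (carrier G)"
        using finite_carrier by (intro card_mono setmult_subset_G)
          (auto simp: hall_carrier cent_carrier)
      ultimately show "card (cent h) \<le> card H" using card card_pos[OF hall_subgroup] by simp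
    qed
    then have "class_size G h = card hall"
      using class_size_cent[OF hc] card card_pos[OF sH] by simp
    finally show ?thesis .
  qed
  have cm: "class_size G m = card H div card cntr" if m: "m \<in> hall" "m \<noteq> \<one>" for m
  proof -
    have mc: "m \<in> carrier G" using m(1) by (rule hall_carrier)
    have "cent m = hall <#> cntr"
    proof
      show "hall <#> cntr \<subseteq> cent m"
      proof
        fix y assume "y \<in> hall <#> cntr"
        then obtain a z where az: "a \<in> hall" "z \<in> cntr" "y = a \<otimes> z" unfolding set_mult_def by blast
        have "a \<in> cent m" using hall_commute[OF az(1) m(1)] hall_carrier[OF az(1)] by (simp add: cent_def)
        moreover have "z \<in> cent m" using cntr_cj[OF az(2) mc] cntr_carrier[OF az(2)] mc by (simp add: mem_cent)
        ultimately show "y \<in> cent m" using az(3) subgroup.m_closed[OF cent_subgroup[OF mc]] by simp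
      qed
      show "cent m \<subseteq> hall <#> cntr"
      proof
        fix y assume y: "y \<in> cent m"
        then have "y \<in> hall <#> H" using MH cent_carrier by simp
        then obtain a h where ah: "a \<in> hall" "h \<in> H" "y = a \<otimes> h" unfolding set_mult_def by blast
        have ac: "a \<in> carrier G" "h \<in> carrier G" using ah hall_carrier Hc by blast+
        have am: "a \<in> cent m" using hall_commute[OF ah(1) m(1)] ac by (simp add: cent_def)
        have "h = inv a \<otimes> y" using ah ac by simp
        then have "h \<in> cent m"
          using am y cent_subgroup[OF mc] by (simp add: subgroup.m_closed subgroup.m_inv_closed)
        then have "m \<in> cent h" by (rule cent_sym[OF mc])
        then have "h \<in> cntr" using fr[OF ah(2)] m by blast
        then show "y \<in> hall <#> cntr" using ah unfolding set_mult_def by blast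
      qed
    qed
    then have "card (cent m) = card hall * card cntr"
      using card_set_mult[OF hall_subgroup cntr_subgroup] hall_center by simp
    then have "class_size G m * card cntr * card hall = card H * card hall"
      using class_size_cent[OF mc] card by (simp add: ac_simps)
    then have "class_size G m * card cntr = card H" using card_pos[OF hall_subgroup] by simp
    then show ?thesis using card_pos[OF cntr_subgroup] by (metis nonzero_mult_div_cancel_right less_irrefl)
  qed
  have central: "class_size G (m \<otimes> z) = class_size G m" if m: "m \<in> hall" and z: "z \<in> cntr" for m z
  proof -
    have mc: "m \<in> carrier G" "z \<in> carrier G" using m z hall_carrier cntr_carrier by blast+
    have "cent (m \<otimes> z) = cent m"
      using mc z by (auto simp: mem_cent cj_hom cntr_iff)
    then have "class_size G (m \<otimes> z) * card (cent m) = class_size G m * card (cent m)"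
      using class_size_cent[of "m \<otimes> z"] class_size_cent[of m] mc by simp
    then show ?thesis using card_pos[OF cent_subgroup[OF mc(1)]] by simp
  qed
  have one: "class_size G \<one> = 1"
    using class_size_1_iff[OF one_closed] subgroup.one_closed[OF cntr_subgroup] by (simp add: cntr_def)
  show ?thesis
  proof
    show "class_sizes G \<subseteq> {1, card H div card cntr, card hall}"
    proof
      fix s assume "s \<in> class_sizes G"
      then obtain g where g: "g \<in> carrier G" "s = class_size G g" by (auto simp: class_sizes_def)
      then have "g \<in> hall <#> H" using MH by simp
      then obtain m h where mh: "m \<in> hall" "h \<in> H" "g = m \<otimes> h" unfolding set_mult_def by blast
      show "s \<in> {1, card H div card cntr, card hall}"
      proof (cases "h \<in> cntr")
        case True
        then have "s = class_size G m" using central mh g by simp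
        then show ?thesis using cm mh(1) one by (cases "m = \<one>") auto
      next
        case False
        then show ?thesis using noncentral mh g by simp
      qed
    qed
    obtain m where m: "m \<in> hall" "m \<noteq> \<one>" using hall_nontrivial by blast
    obtain h where h: "h \<in> H" "h \<notin> cntr" using ZH by blast
    have "class_size G h = card hall"
      using noncentral[OF subgroup.one_closed[OF hall_subgroup] h] Hc[OF h(1)] by simp
    moreover have "class_size G x \<in> class_sizes G" if "x \<in> carrier G" for x
      using that by (auto simp: class_sizes_def)
    ultimately show "{1, card H div card cntr, card hall} \<subseteq> class_sizes G"
      using one cm[OF m] hall_carrier[OF m(1)] Hc[OF h(1)]
      by (metis empty_subsetI insert_subset one_closed)
  qed
qed

text \<open>The image of \<open>H\<close> is the Frobenius complement. Since
  \<open>cntr \<subseteq> H\<close>, membership in this image can be tested in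
  \<open>G\<close>.\<close>

lemma frobenius_quotient:
  assumes sH: "subgroup H G" and MH: "hall <#> H = carrier G" and triv: "hall \<inter> H = {\<one>}"
    and ZH: "cntr \<subset> H" and fr: "\<And>h. h \<in> H \<Longrightarrow> h \<notin> cntr \<Longrightarrow> hall \<inter> cent h = {\<one>}"
  shows "frobenius_group (G Mod cntr)"
proof -
  note Hc = subgroup.mem_carrier[OF sH]
  define \<phi> where "\<phi> g = cntr #> g" for g
  interpret N: normal cntr G by (rule cntr_normal)
  have gQ: "group (G Mod cntr)" by (rule N.factorgroup_is_group)
  have cQ: "carrier (G Mod cntr) = \<phi> ` carrier G"
    by (auto simp: FactGroup_def RCOSETS_def \<phi>_def)
  have fQ: "finite (carrier (G Mod cntr))" using cQ finite_carrier by simp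
  have "group_hom G (G Mod cntr) \<phi>"
    using gQ N.r_coset_hom_Mod unfolding \<phi>_def group_hom_def group_hom_axioms_def by simp
  then interpret Q: group_hom G "G Mod cntr" \<phi> .
  have eq: "\<exists>z\<in>cntr. x = z \<otimes> y" if "x \<in> carrier G" "y \<in> carrier G" "\<phi> x = \<phi> y" for x y
  proof -
    have "x \<in> cntr #> y" using that rcos_self[OF that(1) cntr_subgroup] by (simp add: \<phi>_def)
    then show ?thesis unfolding r_coset_def by blast
  qed
  have one: "\<phi> x = \<one>\<^bsub>G Mod cntr\<^esub>" if "x \<in> cntr" for x
    using coset_join2[OF cntr_carrier[OF that] cntr_subgroup that] by (simp add: \<phi>_def)
  let ?H = "\<phi> ` H"
  have inH: "x \<in> H" if x: "x \<in> carrier G" "\<phi> x \<in> ?H" for x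
  proof -
    obtain h where h: "h \<in> H" "\<phi> x = \<phi> h" using x(2) by blast
    then obtain z where "z \<in> cntr" "x = z \<otimes> h" using eq[OF x(1) Hc] by blast
    then show ?thesis using ZH h(1) subgroup.m_closed[OF sH] by blast
  qed
  have sub: "subgroup ?H (G Mod cntr)" using sH by (rule Q.subgroup_img_is_subgroup)
  have ne1: "?H \<noteq> {\<one>\<^bsub>G Mod cntr\<^esub>}"
  proof
    assume H1: "?H = {\<one>\<^bsub>G Mod cntr\<^esub>}"
    obtain h where h: "h \<in> H" "h \<notin> cntr" using ZH by blast
    have "\<phi> h = \<phi> \<one>" using H1 h(1) by auto
    then obtain z where "z \<in> cntr" "h = z \<otimes> \<one>" using eq[OF Hc[OF h(1)] one_closed] by blast
    then show False using h(2) cntr_carrier by simp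
  qed
  have neG: "?H \<noteq> carrier (G Mod cntr)"
  proof
    assume "?H = carrier (G Mod cntr)"
    then have "m \<in> H" if "m \<in> hall" for m using inH hall_carrier[OF that] by simp
    then show False using hall_nontrivial triv by blast
  qed
  have mal: "?H \<inter> ((y <#\<^bsub>G Mod cntr\<^esub> ?H) #>\<^bsub>G Mod cntr\<^esub> inv\<^bsub>G Mod cntr\<^esub> y) = {\<one>\<^bsub>G Mod cntr\<^esub>}"
    if y: "y \<in> carrier (G Mod cntr) - ?H" for y
  proof -
    obtain g where g: "g \<in> carrier G" "y = \<phi> g" using y cQ by blast
    then have "g \<in> hall <#> H" using MH by simp
    then obtain m k where mk: "m \<in> hall" "k \<in> H" "g = m \<otimes> k" unfolding set_mult_def by blast
    have mc: "m \<in> carrier G" "k \<in> carrier G" using mk hall_carrier Hc by blast+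
    have "m \<noteq> \<one>"
    proof
      assume "m = \<one>"
      then have "g = k" using mk mc by simp
      then show False using y g mk(2) by blast
    qed
    have conj: "(y <#\<^bsub>G Mod cntr\<^esub> ?H) #>\<^bsub>G Mod cntr\<^esub> inv\<^bsub>G Mod cntr\<^esub> y = (\<lambda>h. \<phi> (cj g h)) ` H"
    proof -
      have "(y <#\<^bsub>G Mod cntr\<^esub> ?H) #>\<^bsub>G Mod cntr\<^esub> inv\<^bsub>G Mod cntr\<^esub> y
          = (\<lambda>h. \<phi> g \<otimes>\<^bsub>G Mod cntr\<^esub> \<phi> h \<otimes>\<^bsub>G Mod cntr\<^esub> inv\<^bsub>G Mod cntr\<^esub> (\<phi> g)) ` H"
        unfolding l_coset_def r_coset_def g(2) by blast
      also have "\<dots> = (\<lambda>h. \<phi> (cj g h)) ` H"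
      proof (rule image_cong[OF refl])
        fix h assume h: "h \<in> H"
        have "\<phi> (cj g h) = \<phi> (g \<otimes> h) \<otimes>\<^bsub>G Mod cntr\<^esub> \<phi> (inv g)"
          unfolding cj_def using g(1) Hc[OF h] by (intro Q.hom_mult) simp_all
        also have "\<dots> = \<phi> g \<otimes>\<^bsub>G Mod cntr\<^esub> \<phi> h \<otimes>\<^bsub>G Mod cntr\<^esub> inv\<^bsub>G Mod cntr\<^esub> (\<phi> g)"
          using Q.hom_mult[OF g(1) Hc[OF h]] Q.hom_inv[OF g(1)] by metis
        finally show "\<phi> g \<otimes>\<^bsub>G Mod cntr\<^esub> \<phi> h \<otimes>\<^bsub>G Mod cntr\<^esub> inv\<^bsub>G Mod cntr\<^esub> (\<phi> g) = \<phi> (cj g h)" by (rule sym)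
      qed
      finally show ?thesis .
    qed
    have trivial: "\<phi> (cj g h) = \<one>\<^bsub>G Mod cntr\<^esub>" if h: "h \<in> H" "\<phi> (cj g h) \<in> ?H" for h
    proof -
      \<comment> \<open>In \<open>g = m k\<close> the factor \<open>k\<close> only permutes
        \<open>H\<close>, so the question reduces to conjugation by
        \<open>m \<in> hall\<close>.\<close>
      define h' where "h' = cj k h"
      have h': "h' \<in> H" using h(1) mk(2) sH by (simp add: h'_def cj_def subgroup.m_closed subgroup.m_inv_closed)
      have h'c: "h' \<in> carrier G" using h' by (rule Hc)
      have cgh: "cj g h = cj m h'" using mk mc Hc[OF h(1)] by (simp add: h'_def cj_mult)
      have "cj m h' \<in> H" using inH[of "cj m h'"] h(2) cgh mc h'c by simp
      \<comment> \<open>This commutator lies in \<open>H\<close> and, by normality, in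
        \<open>hall\<close>, so it is trivial. As \<open>m \<noteq> \<one>\<close> now centralises
        \<open>h'\<close>, the latter is central.\<close>
      then have "cj m h' \<otimes> inv h' \<in> H" using h' sH by (simp add: subgroup.m_closed subgroup.m_inv_closed)
      moreover have "cj m h' \<otimes> inv h' = m \<otimes> cj h' (inv m)"
        using mc h'c by (simp add: cj_def m_assoc)
      moreover have "m \<otimes> cj h' (inv m) \<in> hall"
        using mk(1) normal_cj[OF hall_normal h'c] hall_subgroup
        by (simp add: subgroup.m_closed subgroup.m_inv_closed)
      ultimately have "cj m h' \<otimes> inv h' = \<one>" using triv by auto
      then have "m \<in> cent h'" using commute_if_commutator_trivial[OF mc(1) h'c] by blast
      then have h'z: "h' \<in> cntr" using fr[OF h'] mk(1) \<open>m \<noteq> \<one>\<close> by blast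
      then have "cj m h' = h'" using mc(1) unfolding cntr_iff by blast
      then show ?thesis using one[OF h'z] cgh by simp
    qed
    have 1: "\<one>\<^bsub>G Mod cntr\<^esub> \<in> ?H" using subgroup.one_closed[OF sub] .
    have "\<one>\<^bsub>G Mod cntr\<^esub> = \<phi> (cj g \<one>)" using g(1) by simp
    then have 2: "\<one>\<^bsub>G Mod cntr\<^esub> \<in> (\<lambda>h. \<phi> (cj g h)) ` H"
      using subgroup.one_closed[OF sH] by (rule image_eqI)
    show ?thesis
      unfolding conj
    proof (rule equalityI)
      show "?H \<inter> (\<lambda>h. \<phi> (cj g h)) ` H \<subseteq> {\<one>\<^bsub>G Mod cntr\<^esub>}"
      proof
        fix u assume u: "u \<in> ?H \<inter> (\<lambda>h. \<phi> (cj g h)) ` H"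
        then obtain h where "h \<in> H" "u = \<phi> (cj g h)" by blast
        then show "u \<in> {\<one>\<^bsub>G Mod cntr\<^esub>}" using trivial u by simp
      qed
      show "{\<one>\<^bsub>G Mod cntr\<^esub>} \<subseteq> ?H \<inter> (\<lambda>h. \<phi> (cj g h)) ` H" using 1 2 by (simp only: empty_subsetI insert_subset Int_iff)
    qed
  qed
  show ?thesis
    unfolding frobenius_group_def
    by (intro conjI exI[of _ ?H] ballI gQ fQ sub ne1 neG mal)
qed

text \<open>Commutators lie in \<open>hall\<close>, because modulo it every element comes from the
  abelian \<open>H\<close>; and \<open>hall\<close> is abelian. The derived length is at most
  2.\<close>

lemma solvable:
  assumes sH: "subgroup H G" and MH: "hall <#> H = carrier G"
    and ab: "\<And>a b. a \<in> H \<Longrightarrow> b \<in> H \<Longrightarrow> a \<otimes> b = b \<otimes> a"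
  shows "solvable G"
proof -
  note Hc = subgroup.mem_carrier[OF sH]
  obtain K \<phi> where Q: "quotient_map G (K :: ('a, 'b) monoid_scheme) \<phi>"
    and ker: "\<forall>x\<in>carrier G. \<phi> x = \<one>\<^bsub>K\<^esub> \<longleftrightarrow> x \<in> hall"
    using quotient_exists[OF hall_normal] by blast
  interpret Q: quotient_map G K \<phi> by (rule Q)
  have \<phi>H: "\<exists>h\<in>H. \<phi> x = \<phi> h" if x: "x \<in> carrier G" for x
  proof -
    have "x \<in> hall <#> H" using MH x by simp
    then obtain m h where mh: "m \<in> hall" "h \<in> H" "x = m \<otimes> h" unfolding set_mult_def by blast
    have "\<phi> m = \<one>\<^bsub>K\<^esub>" using ker mh(1) hall_carrier by blast
    then have "\<phi> x = \<phi> h" using mh hall_carrier[OF mh(1)] Hc by simp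
    then show ?thesis using mh(2) by blast
  qed
  have comm: "x \<otimes> y \<otimes> inv x \<otimes> inv y \<in> hall" if xy: "x \<in> carrier G" "y \<in> carrier G" for x y
  proof -
    obtain h k where hk: "h \<in> H" "k \<in> H" "\<phi> x = \<phi> h" "\<phi> y = \<phi> k" using \<phi>H xy by meson
    have "\<phi> (x \<otimes> y \<otimes> inv x \<otimes> inv y) = \<phi> (h \<otimes> k \<otimes> inv h \<otimes> inv k)"
      using xy hk Hc by simp
    also have "h \<otimes> k \<otimes> inv h \<otimes> inv k = \<one>"
      using ab[OF hk(1,2)] Hc[OF hk(1)] Hc[OF hk(2)] by (simp add: m_assoc)
    finally have "\<phi> (x \<otimes> y \<otimes> inv x \<otimes> inv y) = \<one>\<^bsub>K\<^esub>" by simp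
    then show ?thesis using ker xy by (metis inv_closed m_closed)
  qed
  have 1: "derived G (carrier G) \<subseteq> hall"
    unfolding derived_def by (rule generate_subgroup_incl[OF _ hall_subgroup]) (use comm in blast)
  have "derived G hall \<subseteq> {\<one>}"
    unfolding derived_def
  proof (rule generate_subgroup_incl[OF _ triv_subgroup])
    show "derived_set G hall \<subseteq> {\<one>}"
    proof -
      have "a \<otimes> b \<otimes> inv a \<otimes> inv b = \<one>" if "a \<in> hall" "b \<in> hall" for a b
        using hall_commute[OF that] that[THEN hall_carrier] by (simp add: m_assoc)
      then show ?thesis by auto
    qed
  qed
  then have "derived G (derived G (carrier G)) \<subseteq> {\<one>}" using mono_derived[OF 1] by blast
  moreover have "\<one> \<in> derived G (derived G (carrier G))" unfolding derived_def by (rule generate.one)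
  ultimately have "(derived G ^^ 2) (carrier G) = {\<one>}" by (auto simp: numeral_2_eq_2)
  then show ?thesis using solvable_iff_trivial_derived_seq by blast
qed

lemma quasi_frobenius: "quasi_frobenius \<rho> G"
proof -
  obtain H where sH: "subgroup H G" and MH: "hall <#> H = carrier G" and triv: "hall \<inter> H = {\<one>}"
    and cH: "pi_number \<rho> (card H)" and ab: "\<And>a b. a \<in> H \<Longrightarrow> b \<in> H \<Longrightarrow> a \<otimes> b = b \<otimes> a"
    and ZH: "cntr \<subset> H" and fr: "\<And>h. h \<in> H \<Longrightarrow> h \<notin> cntr \<Longrightarrow> hall \<inter> cent h = {\<one>}"
    and card: "card (carrier G) = card H * card hall"
    using frobenius_structure by blast
  have O: "O_sub \<rho> G = cntr" using O_sub_eq_center[OF sH cH] ZH by blast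
  have "H <#> hall = carrier G" using commut_normal[OF sH hall_normal] MH by simp
  moreover have "hall_subgroup \<rho> G H"
    using sH cH card card_pos[OF sH] card_hall pi_number_compl[OF compl'] by (simp add: hall_subgroup_def)
  moreover have "hall_subgroup (pi_compl \<rho>) G hall"
  proof -
    have "pi_number (pi_compl \<rho>) (card hall)" using card_hall pi_number_compl[OF compl'] by simp
    moreover have "pi_number (pi_compl (pi_compl \<rho>)) (card H)"
      using cH pi_number_compl[OF complementary_sym[OF complementary_compl]] by simp
    ultimately show ?thesis
      using hall_subgroup card card_pos[OF hall_subgroup] by (simp add: hall_subgroup_def)
  qed
  moreover have "comm_group (G\<lparr>carrier := H\<rparr>)"
    by (rule group.group_comm_groupI[OF subgroup_imp_group[OF sH]]) (simp add: ab)
  moreover have "comm_group (G\<lparr>carrier := hall\<rparr>)"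
    by (rule group.group_comm_groupI[OF subgroup_imp_group[OF hall_subgroup]]) (simp add: hall_commute)
  moreover have "frobenius_group (G Mod O_sub \<rho> G)"
    unfolding O by (rule frobenius_quotient[OF sH MH triv ZH fr])
  moreover have "O_sub \<rho> G = group_center G" using O group_center_eq by simp
  moreover have "class_sizes G = {1, card H div card (O_sub \<rho> G), card hall}"
    unfolding O by (rule class_sizes_eq[OF sH MH triv ab ZH fr card])
  moreover have "solvable G" using solvable[OF sH MH ab] .
  ultimately show ?thesis unfolding quasi_frobenius_def using hall_normal by blast
qed

end

lemma (in finite_group) quasi_frobenius_if_larger_class:
  assumes \<pi>: "complementary \<pi> \<rho>"
    and good: "\<And>x. x \<in> carrier G \<Longrightarrow> pi_number \<pi> (class_size G x) \<or> pi_number \<rho> (class_size G x)"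
    and noab: "no_abelian_direct_factor G (carrier G)"
    and x: "x \<in> carrier G" "\<not> pi_number \<rho> (class_size G x)"
    and y: "y \<in> carrier G" "\<not> pi_number \<pi> (class_size G y)"
    and max: "\<And>z. z \<in> carrier G \<Longrightarrow> class_size G z \<le> class_size G x"
  shows "quasi_frobenius \<rho> G"
proof -
  have x\<pi>: "pi_number \<pi> (class_size G x)" using good x by blast
  have "two_class_types G \<pi> \<rho> x y"
  proof
    show "pi_number \<rho> (class_size G y)" using good y by blast
    fix z assume z: "z \<in> carrier G" "pi_number \<rho> (class_size G z)"
    then have "class_size G z \<noteq> class_size G x" using x(2) by metis
    then show "class_size G z < class_size G x" using max[OF z(1)] by simp
  qed (use assms x\<pi> in blast)+
  then show ?thesis by (rule two_class_types.quasi_frobenius)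
qed

text \<open>When both types really occur, the largest class size exceeds 1 and so belongs to just
  one of them; this decides which of the two sets takes the role of \<open>\<pi>\<close> in the
  locale.\<close>

lemma (in finite_group) class_pi_separable_structure:
  assumes \<pi>: "complementary \<pi> \<rho>"
    and good: "\<And>x. x \<in> carrier G \<Longrightarrow> pi_number \<pi> (class_size G x) \<or> pi_number \<rho> (class_size G x)"
    and noab: "no_abelian_direct_factor G (carrier G)"
  shows "pi_number \<pi> (card (carrier G)) \<or> pi_number \<rho> (card (carrier G)) \<or>
    quasi_frobenius \<pi> G \<or> quasi_frobenius \<rho> G"
proof (cases "(\<forall>x\<in>carrier G. pi_number \<pi> (class_size G x)) \<or> (\<forall>x\<in>carrier G. pi_number \<rho> (class_size G x))")
  case True
  then show ?thesis
    using one_class_type[OF \<pi> noab] one_class_type[OF complementary_sym[OF \<pi>] noab] by blast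
next
  case False
  then obtain u v where u: "u \<in> carrier G" "\<not> pi_number \<pi> (class_size G u)"
    and v: "v \<in> carrier G" "\<not> pi_number \<rho> (class_size G v)" by blast
  define k where "k = Max (class_size G ` carrier G)"
  have fin: "finite (class_size G ` carrier G)" using finite_carrier by simp
  then have "k \<in> class_size G ` carrier G" unfolding k_def by (rule Max_in) (use u in blast)
  then obtain x where x: "x \<in> carrier G" "k = class_size G x" by blast
  have max: "class_size G z \<le> class_size G x" if "z \<in> carrier G" for z
    unfolding x(2)[symmetric] k_def using fin that by (intro Max_ge) simp_all
  have "\<not> pi_number \<pi> (class_size G x) \<or> \<not> pi_number \<rho> (class_size G x)"
  proof (rule ccontr)
    assume "\<not> ?thesis"
    then have "coprime (class_size G x) (class_size G x)" using pi_number_coprime[OF \<pi>] by blast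
    then have "class_size G x = 1" by simp
    then have "class_size G u \<le> 1" using max[OF u(1)] by simp
    then have "class_size G u = 1" using class_size_pos[OF u(1)] by simp
    then show False using u(2) by simp
  qed
  then show ?thesis
  proof
    assume n: "\<not> pi_number \<rho> (class_size G x)"
    show ?thesis using quasi_frobenius_if_larger_class[OF \<pi> good noab x(1) n u max] by blast
  next
    assume n: "\<not> pi_number \<pi> (class_size G x)"
    have "quasi_frobenius \<pi> G"
      using good by (intro quasi_frobenius_if_larger_class[OF complementary_sym[OF \<pi>] _ noab x(1) n v max]) blast+
    then show ?thesis by blast
  qed
qed

section \<open>Factorised groups\<close>

lemma (in group) internal_direct_carrier:
  assumes U: "subgroup U G"
  shows "internal_direct (G\<lparr>carrier := U\<rparr>) U Y W \<longleftrightarrow> internal_direct G U Y W"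
proof -
  have sub: "subgroup Y (G\<lparr>carrier := U\<rparr>) \<longleftrightarrow> subgroup Y G \<and> Y \<subseteq> U" for Y
    using incl_subgroup[OF U] subgroup_incl[OF _ U] subgroup.subset[of Y "G\<lparr>carrier := U\<rparr>"]
    by auto
  have "Y \<subseteq> U \<and> W \<subseteq> U" if d: "subgroup Y G" "subgroup W G" "Y <#> W = U"
  proof
    show "Y \<subseteq> U"
    proof
      fix y assume "y \<in> Y"
      then have "y = y \<otimes> \<one>" "y \<in> Y" using subgroup.mem_carrier[OF d(1)] by simp_all
      then show "y \<in> U" using d(3) subgroup.one_closed[OF d(2)] unfolding set_mult_def by blast
    qed
    show "W \<subseteq> U"
    proof
      fix w assume "w \<in> W"
      then have "w = \<one> \<otimes> w" "w \<in> W" using subgroup.mem_carrier[OF d(2)] by simp_all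
      then show "w \<in> U" using d(3) subgroup.one_closed[OF d(1)] unfolding set_mult_def by blast
    qed
  qed
  then show ?thesis unfolding internal_direct_def sub by (auto simp: set_mult_def)
qed

lemma (in group) no_abelian_direct_factor_carrier:
  assumes U: "subgroup U G"
  shows "no_abelian_direct_factor (G\<lparr>carrier := U\<rparr>) U \<longleftrightarrow> no_abelian_direct_factor G U"
  unfolding no_abelian_direct_factor_def internal_direct_carrier[OF U] by simp

lemma (in finite_group) internal_direct_subgroups:
  assumes d: "internal_direct G U Y W"
  shows "subgroup Y G" "subgroup W G" "subgroup U G" "Y \<subseteq> U"
proof -
  show sY: "subgroup Y G" and sW: "subgroup W G" using d by (auto simp: internal_direct_def)
  have YW: "Y <#> W = U" and comm: "\<And>y w. y \<in> Y \<Longrightarrow> w \<in> W \<Longrightarrow> y \<otimes> w = w \<otimes> y"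
    using d by (auto simp: internal_direct_def)
  show "subgroup U G" using commuting_product_subgroup[OF sY sW] comm YW by metis
  show "Y \<subseteq> U"
  proof
    fix y assume "y \<in> Y"
    then have "y = y \<otimes> \<one>" "y \<in> Y" using subgroup.mem_carrier[OF sY] by simp_all
    then show "y \<in> U" using YW subgroup.one_closed[OF sW] unfolding set_mult_def by blast
  qed
qed

text \<open>The other factor \<open>W\<close> centralises \<open>Y\<close>, so only the
  \<open>Y\<close>-component of a conjugating element moves \<open>x\<close>.\<close>

lemma (in finite_group) class_size_direct_factor:
  assumes d: "internal_direct G U Y W" and x: "x \<in> Y"
  shows "class_size (G\<lparr>carrier := Y\<rparr>) x = class_size (G\<lparr>carrier := U\<rparr>) x"
proof -
  note s = internal_direct_subgroups[OF d]
  have xc: "x \<in> carrier G" using s(1) x by (rule subgroup.mem_carrier)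
  have "orb U x = orb Y x"
  proof
    show "orb Y x \<subseteq> orb U x" using s(4) by (auto simp: orb_def)
    show "orb U x \<subseteq> orb Y x"
    proof
      fix t assume "t \<in> orb U x"
      then obtain u where u: "u \<in> U" "t = cj u x" by (auto simp: orb_def)
      then obtain y w where yw: "y \<in> Y" "w \<in> W" "u = y \<otimes> w"
        using d unfolding internal_direct_def set_mult_def by blast
      have c: "y \<in> carrier G" "w \<in> carrier G"
        using yw subgroup.mem_carrier[OF s(1)] subgroup.mem_carrier[OF s(2)] by blast+
      have "w \<otimes> x = x \<otimes> w" using d x yw(2) by (simp add: internal_direct_def)
      then have "cj w x = x" using cj_fix_iff c(2) xc by blast
      then have "t = cj y x" using u yw c xc by (simp add: cj_mult)
      then show "t \<in> orb Y x" using yw(1) by (auto simp: orb_def)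
    qed
  qed
  then show ?thesis
    using subgroup_group_facts(2)[OF finite_group_axioms s(1) x]
      subgroup_group_facts(2)[OF finite_group_axioms s(3)] x s(4) by auto
qed

lemma chief_covering_series:
  assumes "chief_series G S n" "\<forall>i<n. covers G A (S (Suc i)) (S i) \<or> covers G B (S (Suc i)) (S i)"
  shows "covering_series G A B S n" "minimal_series G S n"
proof -
  have "S i <#>\<^bsub>G\<^esub> (A \<inter> S (Suc i)) = S (Suc i) \<or> S i <#>\<^bsub>G\<^esub> (B \<inter> S (Suc i)) = S (Suc i)" if "i < n" for i
    using assms(2) that by (simp add: covers_def)
  then show "covering_series G A B S n"
    using assms(1) unfolding chief_series_def covering_series_def by (metis order_refl psubset_imp_subset)
  show "minimal_series G S n"
    unfolding minimal_series_def
  proof (intro allI impI)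
    fix i N assume i: "i < n" and N: "N \<lhd> G" "S i \<subseteq> N" "N \<subseteq> S (Suc i)"
    have "\<not> (S i \<subset> N \<and> N \<subset> S (Suc i))" using assms(1) i N(1) unfolding chief_series_def by metis
    then show "N = S i \<or> N = S (Suc i)" using N(2,3) by blast
  qed
qed

lemma class_pi_separable_subgroup:
  assumes fg: "finite_group G" and \<pi>: "complementary \<pi> \<rho>"
    and A: "subgroup A G" and B: "subgroup B G" and AB: "A <#>\<^bsub>G\<^esub> B = carrier G"
    and ser: "covering_series G A B S n" and min: "minimal_series G S n"
    and good: "\<And>r. r \<in> A \<union> B \<Longrightarrow> pi_number \<pi> (class_size G r) \<or> pi_number \<rho> (class_size G r)"
    and x: "x \<in> A"
  shows "pi_number \<pi> (class_size (G\<lparr>carrier := A\<rparr>) x) \<or> pi_number \<rho> (class_size (G\<lparr>carrier := A\<rparr>) x)"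
proof -
  interpret finite_group G by (rule fg)
  have good': "\<And>r. r \<in> A \<union> B \<Longrightarrow> pi_number \<rho> (class_size G r) \<or> pi_number \<pi> (class_size G r)"
    using good by blast
  show ?thesis
    using class_size_in_factor[OF \<pi> A B AB ser min good x]
      class_size_in_factor[OF complementary_sym[OF \<pi>] A B AB ser min good' x] good[of x] x by blast
qed

theorem theoremC:
  fixes G :: "('a, 'b) monoid_scheme" and A B :: "'a set" and \<pi> :: "nat set"
  assumes "group G" and "finite (carrier G)"
    and "\<pi> \<subseteq> {p. Factorial_Ring.prime p}"
    and "subgroup A G" and "subgroup B G" and "A <#>\<^bsub>G\<^esub> B = carrier G"
    and "core_factorisation G A B"
    and "class_pi_separable_factorisation \<pi> G A B"
  shows "(\<forall>F \<in> {A, B}. \<forall>X0 Z.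
            internal_direct G F X0 Z \<and> comm_group (G\<lparr>carrier := Z\<rparr>) \<and>
            no_abelian_direct_factor G X0 \<longrightarrow>
            (pi_number \<pi> (card X0) \<or> pi_number (pi_compl \<pi>) (card X0)) \<or>
            (\<exists>\<sigma> \<in> {\<pi>, pi_compl \<pi>}. \<exists>Xs Xs'.
               Xs <#>\<^bsub>G\<^esub> Xs' = X0 \<and>
               hall_subgroup \<sigma> (G\<lparr>carrier := X0\<rparr>) Xs \<and>
               hall_subgroup (pi_compl \<sigma>) (G\<lparr>carrier := X0\<rparr>) Xs' \<and>
               normal Xs' (G\<lparr>carrier := X0\<rparr>) \<and>
               comm_group (G\<lparr>carrier := Xs\<rparr>) \<and> comm_group (G\<lparr>carrier := Xs'\<rparr>) \<and>
               frobenius_group (G\<lparr>carrier := X0\<rparr> Mod O_sub \<sigma> (G\<lparr>carrier := X0\<rparr>)) \<and>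
               O_sub \<sigma> (G\<lparr>carrier := X0\<rparr>) = group_center (G\<lparr>carrier := X0\<rparr>) \<and>
               class_sizes (G\<lparr>carrier := X0\<rparr>) =
                 {1, card Xs div card (O_sub \<sigma> (G\<lparr>carrier := X0\<rparr>)), card Xs'} \<and>
               solvable (G\<lparr>carrier := X0\<rparr>))) \<and>
         class_pi_separable \<pi> (G\<lparr>carrier := A\<rparr>) \<and> class_pi_separable \<pi> (G\<lparr>carrier := B\<rparr>)"
proof -
  interpret finite_group G
    using assms(1,2) by (simp add: finite_group_def finite_group_axioms_def)
  note A = assms(4) and B = assms(5) and AB = assms(6)
  have \<pi>: "complementary \<pi> (pi_compl \<pi>)" by (rule complementary_compl)
  have good: "pi_number \<pi> (class_size G r) \<or> pi_number (pi_compl \<pi>) (class_size G r)" if "r \<in> A \<union> B" for r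
    using assms(8) that unfolding class_pi_separable_factorisation_def by blast
  then have good': "pi_number \<pi> (class_size G r) \<or> pi_number (pi_compl \<pi>) (class_size G r)" if "r \<in> B \<union> A" for r
    using that by blast
  obtain S n where S: "chief_series G S n"
    and cov: "\<forall>i<n. covers G A (S (Suc i)) (S i) \<or> covers G B (S (Suc i)) (S i)"
    using assms(7) unfolding core_factorisation_def by blast
  then have cov': "\<forall>i<n. covers G B (S (Suc i)) (S i) \<or> covers G A (S (Suc i)) (S i)" by blast
  \<comment> \<open>Taking inverses exchanges the factors, so the result for the first factor of a
    factorisation applies to \<open>B\<close> as well.\<close>
  have BA: "B <#>\<^bsub>G\<^esub> A = carrier G"
  proof
    show "B <#>\<^bsub>G\<^esub> A \<subseteq> carrier G" using A B by (simp add: setmult_subset_G subgroup.subset)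
    show "carrier G \<subseteq> B <#>\<^bsub>G\<^esub> A"
    proof
      fix g assume g: "g \<in> carrier G"
      then have "inv\<^bsub>G\<^esub> g \<in> A <#>\<^bsub>G\<^esub> B" using AB by simp
      then obtain a b where ab: "a \<in> A" "b \<in> B" "inv\<^bsub>G\<^esub> g = a \<otimes>\<^bsub>G\<^esub> b" unfolding set_mult_def by blast
      have "g = inv\<^bsub>G\<^esub> (a \<otimes>\<^bsub>G\<^esub> b)" using g by (simp flip: ab(3))
      also have "\<dots> = inv\<^bsub>G\<^esub> b \<otimes>\<^bsub>G\<^esub> inv\<^bsub>G\<^esub> a"
        using ab subgroup.mem_carrier[OF A] subgroup.mem_carrier[OF B] by (simp add: inv_mult_group)
      finally show "g \<in> B <#>\<^bsub>G\<^esub> A"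
        using ab subgroup.m_inv_closed[OF A] subgroup.m_inv_closed[OF B] unfolding set_mult_def by blast
    qed
  qed
  have sepA: "class_pi_separable \<pi> (G\<lparr>carrier := A\<rparr>)"
    using class_pi_separable_subgroup[OF finite_group_axioms \<pi> A B AB chief_covering_series[OF S cov] good]
    unfolding class_pi_separable_def by simp
  have sepB: "class_pi_separable \<pi> (G\<lparr>carrier := B\<rparr>)"
    using class_pi_separable_subgroup[OF finite_group_axioms \<pi> B A BA chief_covering_series[OF S cov'] good']
    unfolding class_pi_separable_def by simp
  have main: "(pi_number \<pi> (card U) \<or> pi_number (pi_compl \<pi>) (card U)) \<or>
      (\<exists>\<sigma>\<in>{\<pi>, pi_compl \<pi>}. quasi_frobenius \<sigma> (G\<lparr>carrier := U\<rparr>))"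
    if F: "F \<in> {A, B}" and d: "internal_direct G F U Z" and noab: "no_abelian_direct_factor G U" for F U Z
  proof -
    note s = internal_direct_subgroups[OF d]
    have "finite_group (G\<lparr>carrier := U\<rparr>)"
      using subgroup_group_facts(1)[OF finite_group_axioms s(1) subgroup.one_closed[OF s(1)]] .
    then interpret U: finite_group "G\<lparr>carrier := U\<rparr>" .
    \<comment> \<open>The class sizes of elements of \<open>U\<close> are the same in
      \<open>U\<close> as in \<open>F\<close>, so \<open>U\<close> inherits separability from
      \<open>A\<close> or \<open>B\<close>.\<close>
    have "pi_number \<pi> (class_size (G\<lparr>carrier := U\<rparr>) x) \<or> pi_number (pi_compl \<pi>) (class_size (G\<lparr>carrier := U\<rparr>) x)"
      if x: "x \<in> carrier (G\<lparr>carrier := U\<rparr>)" for x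
      using F sepA sepB class_size_direct_factor[OF d, of x] x s(4) unfolding class_pi_separable_def by auto
    moreover have "no_abelian_direct_factor (G\<lparr>carrier := U\<rparr>) (carrier (G\<lparr>carrier := U\<rparr>))"
      using noab no_abelian_direct_factor_carrier[OF s(1)] by simp
    ultimately show ?thesis using U.class_pi_separable_structure[OF \<pi>] by auto
  qed
  have unfold_qf: "quasi_frobenius \<sigma> (G\<lparr>carrier := U\<rparr>) \<longleftrightarrow> (\<exists>Xs Xs'.
      Xs <#>\<^bsub>G\<^esub> Xs' = U \<and> hall_subgroup \<sigma> (G\<lparr>carrier := U\<rparr>) Xs \<and>
      hall_subgroup (pi_compl \<sigma>) (G\<lparr>carrier := U\<rparr>) Xs' \<and> Xs' \<lhd> G\<lparr>carrier := U\<rparr> \<and>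
      comm_group (G\<lparr>carrier := Xs\<rparr>) \<and> comm_group (G\<lparr>carrier := Xs'\<rparr>) \<and>
      frobenius_group (G\<lparr>carrier := U\<rparr> Mod O_sub \<sigma> (G\<lparr>carrier := U\<rparr>)) \<and>
      O_sub \<sigma> (G\<lparr>carrier := U\<rparr>) = group_center (G\<lparr>carrier := U\<rparr>) \<and>
      class_sizes (G\<lparr>carrier := U\<rparr>) = {1, card Xs div card (O_sub \<sigma> (G\<lparr>carrier := U\<rparr>)), card Xs'} \<and>
      solvable (G\<lparr>carrier := U\<rparr>))" for \<sigma> U
    unfolding quasi_frobenius_def by (simp add: set_mult_def)
  show ?thesis
  proof (intro conjI ballI allI impI sepA sepB)
    fix F U Z
    assume "F \<in> {A, B}" and "internal_direct G F U Z \<and> comm_group (G\<lparr>carrier := Z\<rparr>) \<and> no_abelian_direct_factor G U"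
    then show "(pi_number \<pi> (card U) \<or> pi_number (pi_compl \<pi>) (card U)) \<or>
      (\<exists>\<sigma>\<in>{\<pi>, pi_compl \<pi>}. \<exists>Xs Xs'.
      Xs <#>\<^bsub>G\<^esub> Xs' = U \<and> hall_subgroup \<sigma> (G\<lparr>carrier := U\<rparr>) Xs \<and>
      hall_subgroup (pi_compl \<sigma>) (G\<lparr>carrier := U\<rparr>) Xs' \<and> Xs' \<lhd> G\<lparr>carrier := U\<rparr> \<and>
      comm_group (G\<lparr>carrier := Xs\<rparr>) \<and> comm_group (G\<lparr>carrier := Xs'\<rparr>) \<and>
      frobenius_group (G\<lparr>carrier := U\<rparr> Mod O_sub \<sigma> (G\<lparr>carrier := U\<rparr>)) \<and>
      O_sub \<sigma> (G\<lparr>carrier := U\<rparr>) = group_center (G\<lparr>carrier := U\<rparr>) \<and>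
      class_sizes (G\<lparr>carrier := U\<rparr>) = {1, card Xs div card (O_sub \<sigma> (G\<lparr>carrier := U\<rparr>)), card Xs'} \<and>
      solvable (G\<lparr>carrier := U\<rparr>))"
      unfolding unfold_qf[symmetric] using main by (elim conjE)
  qed
qed

end
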